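(* Assume the non-oscillatory case $G^h=G|_{\bar\Omega^h}$ with $G\in\mathcal C^\infty(\bar\Omega,\mathbb R^{3\times3}_{\mathrm{sym,pos}})$, that $\lim_{h\to0}\frac1{h^2}\inf\mathcal E^h=0$, and that all Riemann curvatures of $G$ vanish on $\omega\times\{0\}$. Let $y_0\in\mathcal C^\infty(\bar\omega,\mathbb R^3)$ satisfy $(\nabla y_0)^{\mathsf T}\nabla y_0=\bar{\mathcal G}_{2\times2}$ and $((\nabla y_0)^{\mathsf T}\nabla\vec b_0)_{\mathrm{sym}}=\frac12\partial_3G(x',0)_{2\times2}$. Then there is $C>0$, depending on $G,\omega,W$ but not on $V$, such that for all $V\in W^{2,2}(\omega,\mathbb R^3)$ with $((\nabla y_0)^{\mathsf T}\nabla V)_{\mathrm{sym}}=0$: $$\mathrm{dist}^2_{W^{2,2}(\omega,\mathbb R^3)}\Big(V,\{Sy_0+c:S\in so(3),c\in\mathbb R^3\}\Big)\le C\int_\omega\mathcal Q_2\big(x',(\nabla y_0)^{\mathsf T}\nabla\vec p+(\nabla V)^{\mathsf T}\nabla\vec b_0\big)dx'.$$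
   Context: $\omega\subset\mathbb R^2$ open, bounded, connected, Lipschitz; $\Omega^h=\omega\times(-h/2,h/2)$, $\Omega=\omega\times(-1/2,1/2)$. $W:\mathbb R^{3\times3}\to[0,\infty]$ Borel with $W(RF)=W(F)$ for $R\in SO(3)$, $W=0$ on $SO(3)$, $W(F)\ge c\,\mathrm{dist}^2(F,SO(3))$ ($c>0$), $W$ finite and $\mathcal C^2$ near $SO(3)$. $\mathcal E^h(u)=\frac1h\int_{\Omega^h}W(\nabla u\,(G^h)^{-1/2})dx$. $\bar{\mathcal G}=G(\cdot,0)$. $\vec b_0=(\nabla y_0)(\bar{\mathcal G}_{2\times2})^{-1}(\bar{\mathcal G}_{13},\bar{\mathcal G}_{23})^{\mathsf T}+\sqrt{\det\bar{\mathcal G}/\det\bar{\mathcal G}_{2\times2}}\frac{\partial_1y_0\times\partial_2y_0}{|\cdot|}$; $Q_0=[\partial_1y_0,\partial_2y_0,\vec b_0]$; $\vec p=-Q_0^{-\mathsf T}[\nabla V^{\mathsf T}\vec b_0;0]$. $\bar A=\bar{\mathcal G}^{1/2}$, $\mathcal Q_3(F)=D^2W(Id_3)(F,F)$, $\mathcal Q_2(x',F)=\min\{\mathcal Q_3(\bar A^{-1}\tilde F\bar A^{-1}):\tilde F\in\mathbb R^{3\times3},\tilde F_{2\times2}=F\}$. Riemann curvatures $R_{iklm}=\frac12(\partial_{kl}G_{im}+\partial_{im}G_{kl}-\partial_{km}G_{il}-\partial_{il}G_{km})+G_{np}(\Gamma^n_{kl}\Gamma^p_{im}-\Gamma^n_{km}\Gamma^p_{il})$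 with $\Gamma^i_{kl}=\frac12G^{im}(\partial_lG_{mk}+\partial_kG_{ml}-\partial_mG_{kl})$. *)

theory Defs
  imports "HOL-Analysis.Analysis" "HOL-Analysis.Cross3"
begin

definition pd :: "('a::real_normed_vector \<Rightarrow> 'b::real_normed_vector) \<Rightarrow> 'a \<Rightarrow> 'a \<Rightarrow> 'b" where
  "pd f v x = frechet_derivative f (at x) v"

fun Ck_on :: "nat \<Rightarrow> 'a::euclidean_space set \<Rightarrow> ('a \<Rightarrow> 'b::real_normed_vector) \<Rightarrow> bool" where
  "Ck_on 0 S f = continuous_on S f"
| "Ck_on (Suc k) S f =
     (continuous_on S f \<and> f differentiable_on S \<and> (\<forall>i\<in>Basis. Ck_on k S (\<lambda>x. pd f i x)))"

definition Cinf_on :: "'a::euclidean_space set \<Rightarrow> ('a \<Rightarrow> 'b::real_normed_vector) \<Rightarrow> bool" where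
  "Cinf_on S f \<longleftrightarrow> (\<forall>k. Ck_on k S f)"

definition Cinf_closure :: "'a::euclidean_space set \<Rightarrow> ('a \<Rightarrow> 'b::real_normed_vector) \<Rightarrow> bool" where
  "Cinf_closure S f \<longleftrightarrow>
     (\<exists>U g. open U \<and> closure S \<subseteq> U \<and> Cinf_on U g \<and> (\<forall>x\<in>closure S. g x = f x))"

definition test_fun :: "(real^'n) set \<Rightarrow> (real^'n \<Rightarrow> real) \<Rightarrow> bool" where
  "test_fun U \<phi> \<longleftrightarrow> Cinf_on UNIV \<phi> \<and> compact (closure {x. \<phi> x \<noteq> 0})
      \<and> closure {x. \<phi> x \<noteq> 0} \<subseteq> U"

definition loc_integrable :: "(real^'n) set \<Rightarrow> (real^'n \<Rightarrow> real^'m) \<Rightarrow> bool" where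
  "loc_integrable U f \<longleftrightarrow> (\<forall>K. compact K \<and> K \<subseteq> U \<longrightarrow> set_integrable lebesgue K f)"

definition weak_partial :: "(real^'n) set \<Rightarrow> (real^'n \<Rightarrow> real^'m) \<Rightarrow> 'n \<Rightarrow> (real^'n \<Rightarrow> real^'m) \<Rightarrow> bool" where
  "weak_partial U f i g \<longleftrightarrow> loc_integrable U f \<and> loc_integrable U g \<and>
     (\<forall>\<phi>. test_fun U \<phi> \<longrightarrow>
        (LINT x:U|lebesgue. pd \<phi> (axis i 1) x *\<^sub>R f x) = - (LINT x:U|lebesgue. \<phi> x *\<^sub>R g x))"

definition wpd :: "(real^'n) set \<Rightarrow> (real^'n \<Rightarrow> real^'m) \<Rightarrow> 'n \<Rightarrow> (real^'n \<Rightarrow> real^'m)" where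
  "wpd U f i = (SOME g. weak_partial U f i g)"

definition wgrad :: "(real^'n) set \<Rightarrow> (real^'n \<Rightarrow> real^'m) \<Rightarrow> real^'n \<Rightarrow> real^'n^'m" where
  "wgrad U f x = (\<chi> a b. wpd U f b x $ a)"

definition L2 :: "(real^'n) set \<Rightarrow> (real^'n \<Rightarrow> real^'m) \<Rightarrow> bool" where
  "L2 U f \<longleftrightarrow> set_borel_measurable lebesgue U f \<and> set_integrable lebesgue U (\<lambda>x. (norm (f x))\<^sup>2)"

definition W12 :: "(real^'n) set \<Rightarrow> (real^'n \<Rightarrow> real^'m) \<Rightarrow> bool" where
  "W12 U f \<longleftrightarrow> L2 U f \<and> (\<forall>i. \<exists>g. weak_partial U f i g \<and> L2 U g)"

definition W22 :: "(real^'n) set \<Rightarrow> (real^'n \<Rightarrow> real^'m) \<Rightarrow> bool" where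
  "W22 U f \<longleftrightarrow> W12 U f \<and> (\<forall>i. W12 U (wpd U f i))"

definition W22_norm :: "(real^'n) set \<Rightarrow> (real^'n \<Rightarrow> real^'m) \<Rightarrow> real" where
  "W22_norm U f = sqrt ((LINT x:U|lebesgue. (norm (f x))\<^sup>2)
      + (\<Sum>i\<in>UNIV. LINT x:U|lebesgue. (norm (wpd U f i x))\<^sup>2)
      + (\<Sum>i\<in>UNIV. \<Sum>j\<in>UNIV. LINT x:U|lebesgue. (norm (wpd U (wpd U f i) j x))\<^sup>2))"

definition lipschitz_domain :: "(real^2) set \<Rightarrow> bool" where
  "lipschitz_domain \<omega> \<longleftrightarrow> open \<omega> \<and>
     (\<forall>z\<in>frontier \<omega>. \<exists>r>0. \<exists>Q::real^2^2. \<exists>g::real\<Rightarrow>real. \<exists>L.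
        orthogonal_matrix Q \<and> L-lipschitz_on UNIV g \<and>
        ball z r \<inter> \<omega> = {x\<in>ball z r. (Q *v (x - z)) $ 2 < g ((Q *v (x - z)) $ 1)})"

definition pt3 :: "real^2 \<Rightarrow> real \<Rightarrow> real^3" where
  "pt3 x' t = (\<chi> i. if i = 1 then x' $ 1 else if i = 2 then x' $ 2 else t)"

definition plate :: "(real^2) set \<Rightarrow> real \<Rightarrow> (real^3) set" where
  "plate \<omega> h = {pt3 x' t | x' t. x' \<in> \<omega> \<and> -h/2 < t \<and> t < h/2}"

definition emb23 :: "2 \<Rightarrow> 3" where
  "emb23 i = (if i = 1 then 1 else 2)"

definition sub22 :: "real^3^3 \<Rightarrow> real^2^2" where
  "sub22 A = (\<chi> i j. A $ emb23 i $ emb23 j)"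

definition symm :: "real^'n^'n \<Rightarrow> real^'n^'n" where
  "symm A = (1/2) *\<^sub>R (A + transpose A)"

definition sym_posdef :: "real^'n^'n \<Rightarrow> bool" where
  "sym_posdef A \<longleftrightarrow> transpose A = A \<and> (\<forall>v. v \<noteq> 0 \<longrightarrow> v \<bullet> (A *v v) > 0)"

definition msqrt :: "real^'n^'n \<Rightarrow> real^'n^'n" where
  "msqrt A = (THE B. sym_posdef B \<and> B ** B = A)"

definition SO3 :: "(real^3^3) set" where
  "SO3 = {R. transpose R ** R = mat 1 \<and> det R = 1}"

definition so3 :: "(real^3^3) set" where
  "so3 = {S. transpose S = - S}"

definition admissible_W :: "(real^3^3 \<Rightarrow> ennreal) \<Rightarrow> bool" where
  "admissible_W W \<longleftrightarrow> W \<in> borel_measurable borel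
     \<and> (\<forall>R\<in>SO3. \<forall>F. W (R ** F) = W F)
     \<and> (\<forall>R\<in>SO3. W R = 0)
     \<and> (\<exists>c>0. \<forall>F. W F \<ge> ennreal (c * (infdist F SO3)\<^sup>2))
     \<and> (\<exists>U. open U \<and> SO3 \<subseteq> U \<and> (\<forall>F\<in>U. W F < \<infinity>) \<and> Ck_on 2 U (\<lambda>F. enn2real (W F)))"

definition Q3 :: "(real^3^3 \<Rightarrow> ennreal) \<Rightarrow> real^3^3 \<Rightarrow> real" where
  "Q3 W F = pd (\<lambda>X. pd (\<lambda>Y. enn2real (W Y)) F X) F (mat 1)"

definition Q2 :: "(real^3^3 \<Rightarrow> ennreal) \<Rightarrow> (real^3 \<Rightarrow> real^3^3) \<Rightarrow> real^2 \<Rightarrow> real^2^2 \<Rightarrow> real" where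
  "Q2 W G x' F = (let A = msqrt (G (pt3 x' 0)) in
     Inf {Q3 W (matrix_inv A ** Ft ** matrix_inv A) | Ft. sub22 Ft = F})"

definition energy :: "(real^3^3 \<Rightarrow> ennreal) \<Rightarrow> (real^3 \<Rightarrow> real^3^3) \<Rightarrow> (real^2) set \<Rightarrow> real
     \<Rightarrow> (real^3 \<Rightarrow> real^3) \<Rightarrow> ennreal" where
  "energy W G \<omega> h u = ennreal (1/h) *
     (\<integral>\<^sup>+ x\<in>plate \<omega> h. W (wgrad (plate \<omega> h) u x ** matrix_inv (msqrt (G x))) \<partial>lebesgue)"

definition inf_energy :: "(real^3^3 \<Rightarrow> ennreal) \<Rightarrow> (real^3 \<Rightarrow> real^3^3) \<Rightarrow> (real^2) set \<Rightarrow> real \<Rightarrow> ennreal" where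
  "inf_energy W G \<omega> h = (INF u\<in>{u. W12 (plate \<omega> h) u}. energy W G \<omega> h u)"

definition ginv :: "(real^3 \<Rightarrow> real^3^3) \<Rightarrow> real^3 \<Rightarrow> real^3^3" where
  "ginv G x = matrix_inv (G x)"

definition dG :: "(real^3 \<Rightarrow> real^3^3) \<Rightarrow> 3 \<Rightarrow> 3 \<Rightarrow> 3 \<Rightarrow> real^3 \<Rightarrow> real" where
  "dG G l m k x = pd (\<lambda>y. G y $ m $ k) (axis l 1) x"

definition ddG :: "(real^3 \<Rightarrow> real^3^3) \<Rightarrow> 3 \<Rightarrow> 3 \<Rightarrow> 3 \<Rightarrow> 3 \<Rightarrow> real^3 \<Rightarrow> real" where
  "ddG G k l i m x = pd (\<lambda>y. dG G l i m y) (axis k 1) x"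

definition Christoffel :: "(real^3 \<Rightarrow> real^3^3) \<Rightarrow> 3 \<Rightarrow> 3 \<Rightarrow> 3 \<Rightarrow> real^3 \<Rightarrow> real" where
  "Christoffel G i k l x = (1/2) * (\<Sum>m\<in>UNIV. ginv G x $ i $ m *
      (dG G l m k x + dG G k m l x - dG G m k l x))"

definition Riemann :: "(real^3 \<Rightarrow> real^3^3) \<Rightarrow> 3 \<Rightarrow> 3 \<Rightarrow> 3 \<Rightarrow> 3 \<Rightarrow> real^3 \<Rightarrow> real" where
  "Riemann G i k l m x =
     (1/2) * (ddG G k l i m x + ddG G i m k l x - ddG G k m i l x - ddG G i l k m x)
     + (\<Sum>n\<in>UNIV. \<Sum>p\<in>UNIV. G x $ n $ p *
          (Christoffel G n k l x * Christoffel G p i m x - Christoffel G n k m x * Christoffel G p i l x))"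

definition col3 :: "real^3 \<Rightarrow> real^3 \<Rightarrow> real^3 \<Rightarrow> real^3^3" where
  "col3 a b c = (\<chi> i j. if j = 1 then a $ i else if j = 2 then b $ i else c $ i)"

definition grad :: "(real^2 \<Rightarrow> real^3) \<Rightarrow> real^2 \<Rightarrow> real^2^3" where
  "grad y x' = jacobian y (at x')"

definition b0 :: "(real^3 \<Rightarrow> real^3^3) \<Rightarrow> (real^2 \<Rightarrow> real^3) \<Rightarrow> real^2 \<Rightarrow> real^3" where
  "b0 G y0 x' = (let Gb = G (pt3 x' 0); d1 = pd y0 (axis 1 1) x'; d2 = pd y0 (axis 2 1) x';
      n = cross3 d1 d2 in
     grad y0 x' *v (matrix_inv (sub22 Gb) *v (\<chi> i. Gb $ emb23 i $ 3))
     + (sqrt (det Gb / det (sub22 Gb)) / norm n) *\<^sub>R n)"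

definition Q0 :: "(real^3 \<Rightarrow> real^3^3) \<Rightarrow> (real^2 \<Rightarrow> real^3) \<Rightarrow> real^2 \<Rightarrow> real^3^3" where
  "Q0 G y0 x' = col3 (pd y0 (axis 1 1) x') (pd y0 (axis 2 1) x') (b0 G y0 x')"

definition lift3 :: "real^2 \<Rightarrow> real^3" where
  "lift3 v = (\<chi> i. if i = 1 then v $ 1 else if i = 2 then v $ 2 else 0)"

definition pvec :: "(real^3 \<Rightarrow> real^3^3) \<Rightarrow> (real^2 \<Rightarrow> real^3) \<Rightarrow> (real^2) set \<Rightarrow> (real^2 \<Rightarrow> real^3)
     \<Rightarrow> real^2 \<Rightarrow> real^3" where
  "pvec G y0 \<omega> V x' = - (transpose (matrix_inv (Q0 G y0 x')) *v
      lift3 (transpose (wgrad \<omega> V x') *v b0 G y0 x'))"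

end

theory Submission
  imports Defs
begin

text \<open>
  If \<open>(\<nabla>y\<^sub>0)\<^sup>T\<nabla>V\<close> is skew, then \<open>\<partial>\<^sub>iV = s \<times> \<partial>\<^sub>iy\<^sub>0\<close> and \<open>p = s \<times> b\<^sub>0\<close> for one axial field \<open>s\<close> in \<open>W\<^sup>1\<^sup>,\<^sup>2\<close>, because
  \<open>\<partial>\<^sub>1y\<^sub>0, \<partial>\<^sub>2y\<^sub>0, b\<^sub>0\<close> is a frame. The terms without derivatives of \<open>s\<close> cancel in the bending strain, which
  becomes \<open>F\<^sub>i\<^sub>j = \<partial>\<^sub>iy\<^sub>0 \<sqdot> (\<partial>\<^sub>js \<times> b\<^sub>0)\<close>. Symmetry of the second weak derivatives of \<open>V\<close> gives
  \<open>\<partial>\<^sub>1s \<times> \<partial>\<^sub>2y\<^sub>0 = \<partial>\<^sub>2s \<times> \<partial>\<^sub>1y\<^sub>0\<close>, so \<open>F\<close> is symmetric and determines \<open>\<nabla>s\<close> pointwise. As \<open>W\<close> dominates the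
  squared distance to \<open>SO(3)\<close>, the form \<open>Q\<^sub>2\<close> controls \<open>|F|\<^sup>2\<close> and hence \<open>|\<nabla>s|\<^sup>2\<close>. The Poincare
  inequality for \<open>s\<close> and then for \<open>V - a \<times> y\<^sub>0\<close>, with \<open>a\<close> the constant approximating \<open>s\<close>, yields the estimate.

  The Poincare inequality is proved without extension or density theorems: a weak derivative
  controls increments along segments that stay in the domain, which settles balls; a
  neighbourhood of a boundary point is translated into a ball by the graph condition, and connectedness chains a
  finite cover.
\<close>

section \<open>Calculus of smooth functions\<close>

text \<open>Weak derivatives enter through \<open>wpd\<close>, an arbitrary choice among almost
  everywhere equal functions. So \<open>pvec\<close> is a pointwise expression in chosen
  representatives, and its derivatives become accessible only once it is recognised almost
  everywhere as \<open>s x b0\<close>, a Sobolev field times a smooth one. Symmetry of the strain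
  matters because the lower bound for \<open>Q2\<close> comes from symmetric parts alone; a skew
  part would escape it. The identity between the derivatives of \<open>s\<close> also removes their
  components along \<open>b0\<close>, and the entries of the strain are exactly the remaining
  components. Uniformity in \<open>V\<close> rests on the frame: its determinant
  \<open>b0 . (d1 x d2)\<close> equals the square root of \<open>det G\<close>, which is bounded
  below on the closed midplane. Both sides of the estimate are kept as integrals with values in the
  extended nonnegative reals, so that neither finiteness of the right-hand side nor measurability of
  the \<open>Q2\<close> integrand has to be established.\<close>

lemma pd_eqI: "(f has_derivative D) (at x) \<Longrightarrow> pd f v x = D v"
  unfolding pd_def by (simp add: frechet_derivative_at[symmetric])

lemma pd_cong_open:
  assumes "open S" "x \<in> S" "\<And>y. y \<in> S \<Longrightarrow> f y = g y"
  shows "pd f v x = pd g v x"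
proof -
  have "(f has_derivative D) (at x) \<longleftrightarrow> (g has_derivative D) (at x)" for D
    using assms has_derivative_transform_within_open[of f D x UNIV S g]
      has_derivative_transform_within_open[of g D x UNIV S f] by auto
  then show ?thesis by (simp add: pd_def frechet_derivative_def)
qed

lemma differentiable_imp_has_derivative_pd:
  "f differentiable (at x) \<Longrightarrow> (f has_derivative (\<lambda>v. pd f v x)) (at x)"
  using frechet_derivative_works[of f "at x"] by (simp add: pd_def)

lemma linear_pd: "f differentiable (at x) \<Longrightarrow> linear (\<lambda>v. pd f v x)"
  using differentiable_imp_has_derivative_pd has_derivative_linear by blast

lemma pd_expand:
  fixes f :: "'a::euclidean_space \<Rightarrow> 'b::real_normed_vector"
  assumes "f differentiable (at x)"
  shows "pd f v x = (\<Sum>i\<in>Basis. (v \<bullet> i) *\<^sub>R pd f i x)"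
proof -
  interpret linear "\<lambda>v. pd f v x" by (rule linear_pd[OF assms])
  have "pd f v x = pd f (\<Sum>i\<in>Basis. (v \<bullet> i) *\<^sub>R i) x" by (simp add: euclidean_representation)
  also have "\<dots> = (\<Sum>i\<in>Basis. (v \<bullet> i) *\<^sub>R pd f i x)" by (simp add: sum scale)
  finally show ?thesis .
qed

lemma Ck_on_SucI:
  assumes "open S" "\<And>x. x \<in> S \<Longrightarrow> f differentiable (at x)"
    "\<And>i. i \<in> Basis \<Longrightarrow> Ck_on k S (\<lambda>x. pd f i x)"
  shows "Ck_on (Suc k) S f"
  using assms by (auto simp: differentiable_on_def at_within_open[of _ S]
      intro!: continuous_at_imp_continuous_on differentiable_imp_continuous_within)

lemma Ck_on_Suc_differentiable: "Ck_on (Suc k) S f \<Longrightarrow> open S \<Longrightarrow> x \<in> S \<Longrightarrow> f differentiable (at x)"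
  by (auto simp: differentiable_on_def at_within_open[of _ S])

lemma Ck_on_cong:
  assumes "open S" "\<And>x. x \<in> S \<Longrightarrow> f x = g x" "Ck_on k S f"
  shows "Ck_on k S g"
  using assms
proof (induction k arbitrary: f g)
  case 0
  then show ?case by (simp cong: continuous_on_cong)
next
  case (Suc k)
  have d: "g differentiable (at x)" if "x \<in> S" for x
  proof -
    have "(f has_derivative (\<lambda>v. pd f v x)) (at x)"
      using Ck_on_Suc_differentiable[OF Suc.prems(3,1) that]
      by (rule differentiable_imp_has_derivative_pd)
    then have "(g has_derivative (\<lambda>v. pd f v x)) (at x)"
      using has_derivative_transform_within_open[of f _ x UNIV S g] Suc.prems(1,2) that by auto
    then show ?thesis by (auto simp: differentiable_def)
  qed
  show ?case
  proof (rule Ck_on_SucI[OF Suc.prems(1) d])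
    fix i :: 'a assume "i \<in> Basis"
    then have "Ck_on k S (\<lambda>x. pd f i x)" using Suc.prems by simp
    then show "Ck_on k S (\<lambda>x. pd g i x)"
      by (rule Suc.IH[OF Suc.prems(1), rotated]) (rule pd_cong_open[OF Suc.prems(1)], auto simp: Suc.prems(2))
  qed
qed

lemma Ck_on_lower: "Ck_on (Suc k) S f \<Longrightarrow> Ck_on k S f"
proof (induction k arbitrary: f)
  case (Suc k)
  then show ?case by (auto)
qed auto

lemma Ck_on_subset: "Ck_on k S f \<Longrightarrow> T \<subseteq> S \<Longrightarrow> Ck_on k T f"
  by (induction k arbitrary: f) (auto intro: continuous_on_subset differentiable_on_subset)

lemma Ck_on_Un:
  assumes "open S" "open T" "Ck_on k S f" "Ck_on k T f"
  shows "Ck_on k (S \<union> T) f"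
  using assms(3,4)
proof (induction k arbitrary: f)
  case 0
  then show ?case using assms by (simp add: continuous_on_open_Un)
next
  case (Suc k)
  then show ?case
    using assms Ck_on_Suc_differentiable[OF Suc.prems(1)] Ck_on_Suc_differentiable[OF Suc.prems(2)]
    by (intro Ck_on_SucI) auto
qed

lemma Ck_on_const: "Ck_on k S (\<lambda>x::'a::euclidean_space. c)"
proof (induction k arbitrary: c)
  case (Suc k)
  have "pd (\<lambda>x. c) v = (\<lambda>x. 0)" for v :: 'a by (auto simp: pd_def)
  then show ?case using Suc by simp
qed simp

lemma Ck_on_bounded_linear:
  fixes f :: "'a::euclidean_space \<Rightarrow> 'b::real_normed_vector"
  assumes L: "bounded_linear L" and S: "open S" and f: "Ck_on k S f"
  shows "Ck_on k S (\<lambda>x. L (f x))"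
  using f
proof (induction k arbitrary: f)
  case 0
  then show ?case using L by (auto intro: bounded_linear.continuous_on)
next
  case (Suc k)
  have D: "((\<lambda>x. L (f x)) has_derivative (\<lambda>v. L (pd f v x))) (at x)" if "x \<in> S" for x
    by (intro bounded_linear.has_derivative[OF L] differentiable_imp_has_derivative_pd
        Ck_on_Suc_differentiable[OF Suc.prems S that])
  show ?case
  proof (rule Ck_on_SucI[OF S])
    fix i :: 'a assume "i \<in> Basis"
    then have "Ck_on k S (\<lambda>x. L (pd f i x))" using Suc by auto
    then show "Ck_on k S (\<lambda>x. pd (\<lambda>x. L (f x)) i x)"
      by (rule Ck_on_cong[OF S, rotated]) (simp add: pd_eqI[OF D])
  qed (use D in \<open>auto simp: differentiable_def\<close>)
qed

lemma Ck_on_add: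
  assumes S: "open S" and f: "Ck_on k S f" and g: "Ck_on k S g"
  shows "Ck_on k S (\<lambda>x. f x + g x)"
  using f g
proof (induction k arbitrary: f g)
  case 0
  then show ?case by (auto intro: continuous_on_add)
next
  case (Suc k)
  have D: "((\<lambda>x. f x + g x) has_derivative (\<lambda>v. pd f v x + pd g v x)) (at x)" if "x \<in> S" for x
    by (intro has_derivative_add differentiable_imp_has_derivative_pd
        Ck_on_Suc_differentiable[OF _ S that]) (rule Suc.prems)+
  show ?case
  proof (rule Ck_on_SucI[OF S])
    fix i :: 'a assume "i \<in> Basis"
    then have "Ck_on k S (\<lambda>x. pd f i x + pd g i x)" using Suc by auto
    then show "Ck_on k S (\<lambda>x. pd (\<lambda>x. f x + g x) i x)"
      by (rule Ck_on_cong[OF S, rotated]) (simp add: pd_eqI[OF D])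
  qed (use D in \<open>auto simp: differentiable_def\<close>)
qed

lemma Ck_on_sum:
  assumes "open S" "\<And>i. i \<in> I \<Longrightarrow> Ck_on k S (f i)"
  shows "Ck_on k S (\<lambda>x. \<Sum>i\<in>I. f i x)"
  using assms(2) by (induction I rule: infinite_finite_induct)
    (auto intro: Ck_on_add Ck_on_const assms(1))

lemma Ck_on_bilinear:
  fixes f :: "'a::euclidean_space \<Rightarrow> 'b::real_normed_vector"
  assumes B: "bounded_bilinear B" and S: "open S" and f: "Ck_on k S f" and g: "Ck_on k S g"
  shows "Ck_on k S (\<lambda>x. B (f x) (g x))"
  using f g
proof (induction k arbitrary: f g)
  case 0
  then show ?case using bounded_bilinear.continuous_on[OF B] by auto
next
  case (Suc k)
  have D: "((\<lambda>x. B (f x) (g x)) has_derivative (\<lambda>v. B (f x) (pd g v x) + B (pd f v x) (g x))) (at x)"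
    if "x \<in> S" for x
    by (intro bounded_bilinear.FDERIV[OF B] differentiable_imp_has_derivative_pd
        Ck_on_Suc_differentiable[OF _ S that]) (rule Suc.prems)+
  show ?case
  proof (rule Ck_on_SucI[OF S])
    fix i :: 'a assume i: "i \<in> Basis"
    have "Ck_on k S (\<lambda>x. B (f x) (pd g i x) + B (pd f i x) (g x))"
      using Suc.prems i Ck_on_lower[OF Suc.prems(1)] Ck_on_lower[OF Suc.prems(2)]
      by (intro Ck_on_add S Suc.IH) auto
    then show "Ck_on k S (\<lambda>x. pd (\<lambda>x. B (f x) (g x)) i x)"
      by (rule Ck_on_cong[OF S, rotated]) (simp add: pd_eqI[OF D])
  qed (use D in \<open>auto simp: differentiable_def\<close>)
qed

lemmas Ck_on_mult = Ck_on_bilinear[OF bounded_bilinear_mult]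
lemmas Ck_on_scaleR = Ck_on_bilinear[OF bounded_bilinear_scaleR]

text \<open>By \<open>pd_expand\<close>, each partial derivative of the composite is a combination
  with constant coefficients of partial derivatives of \<open>f\<close> composed with the same
  affine map, so the induction closes without a general chain rule of order k.\<close>

lemma Ck_on_affine:
  fixes f :: "'a::euclidean_space \<Rightarrow> 'b::real_normed_vector" and L :: "'c::euclidean_space \<Rightarrow> 'a"
  assumes L: "bounded_linear L" and S: "open S" and T: "open T"
    and sub: "\<And>x. x \<in> S \<Longrightarrow> L x + d \<in> T" and f: "Ck_on k T f"
  shows "Ck_on k S (\<lambda>x. f (L x + d))"
  using f
proof (induction k arbitrary: f)
  case 0
  have "continuous_on S (\<lambda>x. L x + d)"
    by (intro continuous_intros bounded_linear.continuous_on[OF L])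
  then show ?case using 0 sub
    by (auto intro!: continuous_on_compose2[of T f])
next
  case (Suc k)
  have D: "((\<lambda>x. f (L x + d)) has_derivative (\<lambda>v. pd f (L v) (L x + d))) (at x)"
    if "x \<in> S" for x
  proof -
    have 1: "(f has_derivative (\<lambda>v. pd f v (L x + d))) (at (L x + d))"
      by (intro differentiable_imp_has_derivative_pd
        Ck_on_Suc_differentiable[OF Suc.prems T sub[OF that]])
    have "((\<lambda>x. L x + d) has_derivative L) (at x)"
      using has_derivative_add[OF bounded_linear_imp_has_derivative[OF L] has_derivative_const[of d]]
      by simp
    from has_derivative_compose[OF this 1] show ?thesis .
  qed
  show ?case
  proof (rule Ck_on_SucI[OF S])
    fix i :: 'c assume i: "i \<in> Basis"
    have "Ck_on k S (\<lambda>x. \<Sum>j\<in>Basis. (L i \<bullet> j) *\<^sub>R pd f j (L x + d))"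
      using Suc.prems i by (intro Ck_on_sum S Ck_on_scaleR Suc.IH Ck_on_const) auto
    then show "Ck_on k S (\<lambda>x. pd (\<lambda>x. f (L x + d)) i x)"
    proof (rule Ck_on_cong[OF S, rotated])
      fix x assume "x \<in> S"
      then show "(\<Sum>j\<in>Basis. (L i \<bullet> j) *\<^sub>R pd f j (L x + d)) = pd (\<lambda>x. f (L x + d)) i x"
        using Ck_on_Suc_differentiable[OF Suc.prems T sub] by (simp add: pd_eqI[OF D] pd_expand[of f _ "L i"])
    qed
  qed (use D in \<open>auto simp: differentiable_def\<close>)
qed

text \<open>The derivative involves only \<open>inverse f\<close> and a derivative of
  \<open>f\<close>, so the induction on the order works with \<open>f\<close> fixed.\<close>

lemma Ck_on_inverse:
  fixes f :: "'a::euclidean_space \<Rightarrow> real"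
  assumes S: "open S" and f: "Ck_on k S f" and nz: "\<And>x. x \<in> S \<Longrightarrow> f x \<noteq> 0"
  shows "Ck_on k S (\<lambda>x. inverse (f x))"
  using f
proof (induction k)
  case 0
  then show ?case using nz by (auto intro!: continuous_intros)
next
  case (Suc k)
  have D: "((\<lambda>x. inverse (f x)) has_derivative (\<lambda>v. - (inverse (f x) * pd f v x * inverse (f x)))) (at x)"
    if "x \<in> S" for x
    by (intro Deriv.has_derivative_inverse nz that differentiable_imp_has_derivative_pd
        Ck_on_Suc_differentiable[OF _ S that]) (rule Suc.prems)+
  show ?case
  proof (rule Ck_on_SucI[OF S])
    fix i :: 'a assume i: "i \<in> Basis"
    have "Ck_on k S (\<lambda>x. - 1 * (inverse (f x) * pd f i x * inverse (f x)))"
      using Suc.prems i Ck_on_lower[OF Suc.prems] by (intro Ck_on_mult S Ck_on_const Suc.IH) auto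
    then show "Ck_on k S (\<lambda>x. pd (\<lambda>x. inverse (f x)) i x)"
      by (rule Ck_on_cong[OF S, rotated]) (simp add: pd_eqI[OF D])
  qed (use D in \<open>auto simp: differentiable_def\<close>)
qed

lemma Ck_on_sqrt:
  fixes f :: "'a::euclidean_space \<Rightarrow> real"
  assumes S: "open S" and f: "Ck_on k S f" and pos: "\<And>x. x \<in> S \<Longrightarrow> f x > 0"
  shows "Ck_on k S (\<lambda>x. sqrt (f x))"
  using f
proof (induction k)
  case 0
  then show ?case by (auto intro!: continuous_intros)
next
  case (Suc k)
  have D: "((\<lambda>x. sqrt (f x)) has_derivative (\<lambda>v. pd f v x * (1/2 * inverse (sqrt (f x))))) (at x)"
    if "x \<in> S" for x
  proof -
    have "(f has_derivative (\<lambda>v. pd f v x)) (at x)"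
      by (intro differentiable_imp_has_derivative_pd Ck_on_Suc_differentiable[OF _ S that]) (rule Suc.prems)+
    from has_derivative_real_sqrt[OF pos[OF that] this] show ?thesis
      by (simp add: divide_simps mult.commute)
  qed
  show ?case
  proof (rule Ck_on_SucI[OF S])
    fix i :: 'a assume i: "i \<in> Basis"
    have "Ck_on k S (\<lambda>x. pd f i x * (1/2 * inverse (sqrt (f x))))"
      using Suc.prems i pos Ck_on_lower[OF Suc.prems]
      by (intro Ck_on_mult S Ck_on_const Ck_on_inverse Suc.IH) (auto simp: less_imp_neq[symmetric])
    then show "Ck_on k S (\<lambda>x. pd (\<lambda>x. sqrt (f x)) i x)"
      by (rule Ck_on_cong[OF S, rotated]) (simp add: pd_eqI[OF D])
  qed (use D in \<open>auto simp: differentiable_def\<close>)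
qed

lemma Cinf_on_pd:
  assumes "Cinf_on S f" "open S"
  shows "Cinf_on S (\<lambda>x. pd f v x)"
  unfolding Cinf_on_def
proof
  fix k
  have f: "Ck_on (Suc k) S f" using assms by (auto simp: Cinf_on_def)
  then have "Ck_on k S (\<lambda>x. \<Sum>i\<in>Basis. (v \<bullet> i) *\<^sub>R pd f i x)"
    by (intro Ck_on_sum assms Ck_on_scaleR Ck_on_const) auto
  then show "Ck_on k S (\<lambda>x. pd f v x)"
    by (rule Ck_on_cong[OF assms(2), rotated])
      (use Ck_on_Suc_differentiable[OF f assms(2)] in \<open>simp add: pd_expand[of f _ v]\<close>)
qed

lemma Cinf_on_differentiable: "Cinf_on S f \<Longrightarrow> open S \<Longrightarrow> x \<in> S \<Longrightarrow> f differentiable (at x)"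
  using Ck_on_Suc_differentiable[of 0] by (metis Cinf_on_def)

lemma Cinf_on_continuous: "Cinf_on S f \<Longrightarrow> continuous_on S f"
  by (metis Cinf_on_def Ck_on.simps(1))

lemma Cinf_on_has_derivative:
  "Cinf_on S f \<Longrightarrow> open S \<Longrightarrow> x \<in> S \<Longrightarrow> (f has_derivative (\<lambda>v. pd f v x)) (at x)"
  by (intro differentiable_imp_has_derivative_pd Cinf_on_differentiable)

section \<open>Bump functions and the fundamental lemma\<close>

text \<open>The extra power of s makes the claim stable under splitting off one coefficient of the
  polynomial.\<close>

lemma poly_over_exp_tendsto_0:
  fixes q :: "real poly"
  shows "((\<lambda>s. s ^ k * poly q s / exp s) \<longlongrightarrow> 0) at_top"
proof (induction q arbitrary: k)
  case 0
  show ?case by simp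
next
  case (pCons a q)
  have "((\<lambda>s. a * (s ^ k / exp s) + s ^ Suc k * poly q s / exp s) \<longlongrightarrow> a * 0 + 0) at_top"
    by (intro tendsto_intros tendsto_power_div_exp_0 pCons.IH)
  then show ?case by (simp add: algebra_simps add_divide_distrib)
qed

text \<open>The polynomial factor in 1/t is carried along because this class is closed under
  differentiation; the plain flat function exp(-1/t) is \<open>flat 1\<close>.\<close>

definition flat :: "real poly \<Rightarrow> real \<Rightarrow> real" where
  "flat p t = (if t > 0 then poly p (1/t) * exp (- (1/t)) else 0)"

text \<open>For t > 0 the derivative of p(1/t) exp(-1/t) is t^(-2) (p - p')(1/t) exp(-1/t), and
  \<open>[:0,0,1:]\<close> is the square of the variable 1/t. At 0 both one-sided difference
  quotients tend to 0.\<close>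

lemma flat_has_derivative:
  "(flat p has_real_derivative flat ([:0,0,1:] * (p - pderiv p)) t) (at t)"
proof (rule linorder_cases[of t 0])
  assume t: "t < 0"
  have "((\<lambda>_. 0) has_real_derivative 0) (at t)" by simp
  then have "(flat p has_real_derivative 0) (at t)"
    by (rule has_field_derivative_transform_within_open[of _ _ _ "{..<0}"]) (use t in \<open>auto simp: flat_def\<close>)
  then show ?thesis using t by (simp add: flat_def)
next
  assume t: "t > 0"
  have "((\<lambda>t. poly p (1/t) * exp (- (1/t))) has_real_derivative
      poly ([:0,0,1:] * (p - pderiv p)) (1/t) * exp (- (1/t))) (at t)"
    using t
    by (auto intro!: derivative_eq_intros poly_DERIV[THEN DERIV_chain2] simp: field_simps power2_eq_square)
  then have "(flat p has_real_derivative poly ([:0,0,1:] * (p - pderiv p)) (1/t) * exp (- (1/t))) (at t)"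
    by (rule has_field_derivative_transform_within_open[of _ _ _ "{0<..}"]) (use t in \<open>auto simp: flat_def\<close>)
  then show ?thesis using t by (simp add: flat_def)
next
  assume t: "t = 0"
  \<comment> \<open>With s = 1/h the difference quotient at 0 from the right is s p(s) / exp
    s.\<close>
  have "((\<lambda>s. s ^ 1 * poly p s / exp s) \<longlongrightarrow> 0) at_top"
    by (rule poly_over_exp_tendsto_0)
  then have "((\<lambda>h. inverse h ^ 1 * poly p (inverse h) / exp (inverse h)) \<longlongrightarrow> 0) (at_right 0)"
    by (rule filterlim_compose[OF _ filterlim_inverse_at_top_right])
  then have r: "((\<lambda>h. (flat p h - flat p 0) / h) \<longlongrightarrow> 0) (at_right 0)"
    by (rule Lim_transform_eventually)
      (auto simp: eventually_at_right_field flat_def exp_minus field_simps intro!: exI[of _ 1])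
  have l: "((\<lambda>h. (flat p h - flat p 0) / h) \<longlongrightarrow> 0) (at_left 0)"
    by (rule Lim_transform_eventually[OF tendsto_const])
      (auto simp: eventually_at_left_field flat_def intro!: exI[of _ "-1"])
  have "((\<lambda>h. (flat p h - flat p 0) / h) \<longlongrightarrow> 0) (at 0)"
    using l r by (simp add: filterlim_at_split)
  then have "(flat p has_real_derivative 0) (at 0)"
    by (simp add: has_field_derivative_iff)
  then show ?thesis using t by (simp add: flat_def)
qed

lemma Cinf_on_flat: "Cinf_on UNIV (flat p)"
proof -
  have "Ck_on k UNIV (flat p)" for k
  proof (induction k arbitrary: p)
    case 0
    show ?case using flat_has_derivative[of p]
      by (auto intro!: continuous_at_imp_continuous_on intro: DERIV_isCont)
  next
    case (Suc k)
    have D: "(flat p has_derivative (\<lambda>v. v * flat ([:0,0,1:] * (p - pderiv p)) t)) (at t)" for t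
      using flat_has_derivative[of p t] 
      by (rule has_field_derivative_imp_has_derivative[THEN has_derivative_eq_rhs]) (simp add: fun_eq_iff)
    have "(\<lambda>t. pd (flat p) 1 t) = flat ([:0,0,1:] * (p - pderiv p))"
      by (auto simp: pd_eqI[OF D])
    moreover have "flat p differentiable (at t)" for t using D by (auto simp: differentiable_def)
    ultimately show ?case using Suc by (intro Ck_on_SucI) auto
  qed
  then show ?thesis by (simp add: Cinf_on_def)
qed

text \<open>The factors are exp(-1/x) at x = n(t - a) and x = n(b - t), so the values increase to
  the indicator of the open interval as n grows. The arguments are written as linear map plus
  constant to match \<open>Ck_on_affine\<close>.\<close>

definition bump1 :: "nat \<Rightarrow> real \<Rightarrow> real \<Rightarrow> real \<Rightarrow> real" where
  "bump1 n a b t = flat 1 (real n * t + - real n * a) * flat 1 (- real n * t + real n * b)"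

lemma Cinf_on_bump1: "Cinf_on UNIV (bump1 n a b)"
  using Cinf_on_flat[of 1] unfolding Cinf_on_def bump1_def
  by (intro allI Ck_on_mult Ck_on_affine[where T=UNIV and L="\<lambda>t. real n * t"] 
      Ck_on_affine[where T=UNIV and L="\<lambda>t. - real n * t"] bounded_linear_mult_right) auto

lemma bump1_bounds: "0 \<le> bump1 n a b t" "bump1 n a b t \<le> 1"
proof -
  have "0 \<le> flat 1 t" "flat 1 t \<le> 1" for t by (auto simp: flat_def)
  then show "0 \<le> bump1 n a b t" "bump1 n a b t \<le> 1"
    by (auto simp: bump1_def intro!: mult_nonneg_nonneg mult_le_one)
qed

lemma bump1_eq_0: "\<not> (a < t \<and> t < b) \<Longrightarrow> bump1 n a b t = 0"
proof -
  assume *: "\<not> (a < t \<and> t < b)"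
  have "real n * t \<le> real n * a \<or> real n * b \<le> real n * t"
    using * by (auto intro!: mult_left_mono simp: not_less)
  then show ?thesis by (auto simp: bump1_def flat_def)
qed

lemma flat_1_tendsto:
  assumes "c > 0"
  shows "(\<lambda>n. flat 1 (real n * c)) \<longlonglongrightarrow> 1"
proof -
  have "(\<lambda>n. exp (- (1 / (real n * c)))) \<longlonglongrightarrow> exp (- 0)"
    using assms by (intro tendsto_intros real_tendsto_divide_at_top[of _ 1] 
        filterlim_at_top_mult_tendsto_pos[OF tendsto_const] filterlim_real_sequentially) auto
  then have "(\<lambda>n. exp (- (1 / (real n * c)))) \<longlonglongrightarrow> 1" by simp
  then show ?thesis
    by (rule Lim_transform_eventually)
      (use assms in \<open>auto simp: flat_def eventually_sequentially intro!: exI[of _ 1]\<close>)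
qed

lemma bump1_tendsto:
  assumes "a < t" "t < b"
  shows "(\<lambda>n. bump1 n a b t) \<longlonglongrightarrow> 1"
proof -
  have "(\<lambda>n. flat 1 (real n * (t - a)) * flat 1 (real n * (b - t))) \<longlonglongrightarrow> 1 * 1"
    using assms by (intro tendsto_mult flat_1_tendsto) auto
  then show ?thesis by (simp add: bump1_def algebra_simps)
qed

text \<open>The product form over coordinates approximates box indicators and also makes mixed
  partial derivatives computable by hand.\<close>

definition bump :: "nat \<Rightarrow> real^'n \<Rightarrow> real^'n \<Rightarrow> real^'n \<Rightarrow> real" where
  "bump n a b x = (\<Prod>i\<in>UNIV. bump1 n (a $ i) (b $ i) (x $ i))"

lemma Cinf_on_bump1_nth: "Cinf_on UNIV (\<lambda>x::real^'n. bump1 n a b (x $ i))"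
  unfolding Cinf_on_def
  using Ck_on_affine[where T=UNIV and S=UNIV and L="\<lambda>x::real^'n. x $ i" and d=0]
    Cinf_on_bump1[of n a b] by (auto simp: Cinf_on_def bounded_linear_vec_nth)

lemma Ck_on_prod:
  fixes f :: "'i \<Rightarrow> 'a::euclidean_space \<Rightarrow> real"
  assumes "open S" "\<And>i. i \<in> I \<Longrightarrow> Ck_on k S (f i)"
  shows "Ck_on k S (\<lambda>x. \<Prod>i\<in>I. f i x)"
  using assms(2) by (induction I rule: infinite_finite_induct)
    (auto intro: Ck_on_mult Ck_on_const assms(1))

lemma Cinf_on_bump: "Cinf_on UNIV (bump n a b)"
  unfolding Cinf_on_def bump_def[abs_def]
  by (intro allI Ck_on_prod Cinf_on_bump1_nth[unfolded Cinf_on_def, rule_format]) auto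

lemma bump_bounds: "0 \<le> bump n a b x" "bump n a b x \<le> 1"
  by (auto simp: bump_def intro!: prod_nonneg prod_le_1 bump1_bounds)

lemma bump_eq_0: "x \<notin> box a b \<Longrightarrow> bump n a b x = 0"
  by (auto simp: bump_def mem_box_cart intro!: bump1_eq_0)

lemma bump_tendsto:
  fixes x :: "real^'n"
  shows "(\<lambda>n. bump n a b x) \<longlonglongrightarrow> indicator (box a b) x"
proof (cases "x \<in> box a b")
  case True
  then have "(\<lambda>n. bump n a b x) \<longlonglongrightarrow> (\<Prod>i\<in>(UNIV::'n set). 1)"
    unfolding bump_def by (intro tendsto_prod bump1_tendsto) (auto simp: mem_box_cart)
  then show ?thesis using True by simp
next
  case False
  then show ?thesis by (simp add: bump_eq_0)
qed

lemma test_fun_bump: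
  assumes "cbox a b \<subseteq> U"
  shows "test_fun U (bump n a b)"
proof -
  have "closure {x. bump n a b x \<noteq> 0} \<subseteq> cbox a b"
    using bump_eq_0[of _ a b n] box_subset_cbox[of a b] by (intro closure_minimal) auto
  then show ?thesis using assms compact_Int_closed[OF compact_cbox[of a b] closed_closure[of "{x. bump n a b x \<noteq> 0}"]]
    by (auto simp: test_fun_def Cinf_on_bump Int_absorb1)
qed

lemma borel_measurable_lebesgue_continuous:
  "continuous_on UNIV f \<Longrightarrow> f \<in> borel_measurable lebesgue"
  by (intro measurable_completion) (simp add: borel_measurable_continuous_onI)

text \<open>The bumps are bounded by 1 and tend pointwise to the indicator of the open box;
  dominated convergence with majorant |h| on the closed box passes to the limit.\<close>

lemma set_integral_box_eq_0:
  fixes h :: "real^'n \<Rightarrow> real^'m"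
  assumes U: "open U" and h: "loc_integrable U h"
    and 0: "\<And>n. (LINT x:U|lebesgue. bump n a b x *\<^sub>R h x) = 0" and ab: "cbox a b \<subseteq> U"
  shows "(LINT x:box a b|lebesgue. h x) = 0"
proof -
  have H: "integrable lebesgue (\<lambda>x. indicator (cbox a b) x *\<^sub>R h x)"
    using h ab by (auto simp: loc_integrable_def set_integrable_def)
  have "(\<lambda>n. LINT x|lebesgue. bump n a b x *\<^sub>R (indicator (cbox a b) x *\<^sub>R h x))
     \<longlonglongrightarrow> (LINT x|lebesgue. indicator (box a b) x *\<^sub>R (indicator (cbox a b) x *\<^sub>R h x))"
  proof (rule integral_dominated_convergence[where w="\<lambda>x. norm (indicator (cbox a b) x *\<^sub>R h x)"])
    show "(\<lambda>x. bump n a b x *\<^sub>R (indicator (cbox a b) x *\<^sub>R h x)) \<in> borel_measurable lebesgue" for n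
      using H borel_measurable_lebesgue_continuous[OF Cinf_on_continuous[OF Cinf_on_bump]]
      by (intro borel_measurable_scaleR[of _ _ "\<lambda>x. indicator (cbox a b) x *\<^sub>R h x"]) auto
    show "AE x in lebesgue. (\<lambda>n. bump n a b x *\<^sub>R (indicator (cbox a b) x *\<^sub>R h x))
        \<longlonglongrightarrow> indicator (box a b) x *\<^sub>R (indicator (cbox a b) x *\<^sub>R h x)"
      by (intro AE_I2 tendsto_scaleR bump_tendsto tendsto_const)
    show "AE x in lebesgue. norm (bump n a b x *\<^sub>R (indicator (cbox a b) x *\<^sub>R h x))
        \<le> norm (indicator (cbox a b) x *\<^sub>R h x)" for n
    proof (rule AE_I2)
      fix x
      have "norm (bump n a b x *\<^sub>R (indicator (cbox a b) x *\<^sub>R h x)) = bump n a b x * norm (indicator (cbox a b) x *\<^sub>R h x)"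
        using bump_bounds(1)[of n a b x] by (simp add: abs_of_nonneg abs_mult)
      also have "\<dots> \<le> norm (indicator (cbox a b) x *\<^sub>R h x)"
        using bump_bounds[of n a b x] by (intro mult_left_le_one_le) auto
      finally show "norm (bump n a b x *\<^sub>R (indicator (cbox a b) x *\<^sub>R h x))
        \<le> norm (indicator (cbox a b) x *\<^sub>R h x)" .
    qed
    show "(\<lambda>x. indicator (box a b) x *\<^sub>R (indicator (cbox a b) x *\<^sub>R h x)) \<in> borel_measurable lebesgue"
      using H by (intro borel_measurable_scaleR[of _ _ "\<lambda>x. indicator (cbox a b) x *\<^sub>R h x"])
        (auto intro!: borel_measurable_indicator)
  qed (rule integrable_norm[OF H])
  moreover have "(LINT x|lebesgue. bump n a b x *\<^sub>R (indicator (cbox a b) x *\<^sub>R h x)) = 0" for n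
  proof -
    have "bump n a b x *\<^sub>R (indicator (cbox a b) x *\<^sub>R h x) = indicator U x *\<^sub>R bump n a b x *\<^sub>R h x" for x
      using ab bump_eq_0[of x a b n] box_subset_cbox[of a b] by (auto simp: indicator_def)
    then show ?thesis using 0[of n] by (simp only: set_lebesgue_integral_def)
  qed
  moreover have "indicator (box a b) x *\<^sub>R (indicator (cbox a b) x *\<^sub>R h x) = indicator (box a b) x *\<^sub>R h x" for x
    using box_subset_cbox[of a b] by (auto simp: indicator_def)
  ultimately show ?thesis
    by (simp only: set_lebesgue_integral_def LIMSEQ_const_iff)
qed

text \<open>Boxes are stable under intersection and generate the Borel sets, so Dynkin's argument
  extends the vanishing to all Borel sets; \<open>tot\<close> is what settles complements. A
  Lebesgue set differs from a Borel set only by a null set.\<close>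

lemma AE_eq_0_if_box_integrals_eq_0:
  fixes H :: "'a::euclidean_space \<Rightarrow> real"
  assumes H: "integrable lebesgue H" and 0: "\<And>a b. (LINT x:box a b|lebesgue. H x) = 0"
    and tot: "(LINT x|lebesgue. H x) = 0"
  shows "AE x in lebesgue. H x = 0"
proof -
  have borel: "(LINT x:A|lebesgue. H x) = 0" if A: "A \<in> sets borel" for A
  proof -
    have "Int_stable (range (\<lambda>(a, b). box a b :: 'a set))"
      by (auto simp: Int_stable_def box_Int_box)
    moreover have "(range (\<lambda>(a, b). box a b :: 'a set)) \<subseteq> Pow UNIV" by auto
    moreover have "A \<in> sigma_sets UNIV (range (\<lambda>(a, b). box a b))"
       using A unfolding borel_eq_box by simp
    ultimately show ?thesis
    proof (induction rule: sigma_sets_induct_disjoint)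
      case (basic A) then show ?case using 0 by auto
    next
      case empty then show ?case by (simp add: set_lebesgue_integral_def)
    next
      case (compl A)
      then have [measurable]: "A \<in> sets borel" by (simp add: borel_eq_box)
      have "(LINT x|lebesgue. H x - indicator A x *\<^sub>R H x) = 0"
        using compl.IH tot H
        by (subst Bochner_Integration.integral_diff) 
          (auto simp: set_lebesgue_integral_def intro!: integrable_mult_indicator[of A lebesgue H, simplified])
      moreover have "indicator (UNIV - A) x *\<^sub>R H x = H x - indicator A x *\<^sub>R H x" for x
        by (auto simp: indicator_def)
      ultimately show ?case by (simp add: set_lebesgue_integral_def)
    next
      case (union F)
      then have F: "\<And>i. F i \<in> sets borel" by (simp add: borel_eq_box subset_eq)
      have "(LINT x:(\<Union>i. F i)|lebesgue. H x) = (\<Sum>i. LINT x:F i|lebesgue. H x)"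
        using F union.hyps H
        by (intro lebesgue_integral_countable_add)
          (auto simp: disjoint_family_on_def set_integrable_def intro!: integrable_mult_indicator[of _ lebesgue H, simplified])
      then show ?case using union.IH by simp
    qed
  qed
  show ?thesis
  proof (rule density_unique_real[OF H, of "\<lambda>_. 0"])
    fix A :: "'a set" assume "A \<in> sets lebesgue"
    then obtain S N N' where A: "A = S \<union> N" "N \<subseteq> N'" "N' \<in> null_sets lborel" "S \<in> sets lborel"
      by (rule sets_completionE)
    have N: "AE x in lebesgue. x \<notin> N'"
      by (intro AE_not_in null_sets_completionI A)
    have "(LINT x:A|lebesgue. H x) = (LINT x:S|lebesgue. H x)"
      unfolding set_lebesgue_integral_def
    proof (rule integral_cong_AE)
      show "AE x in lebesgue. indicator A x *\<^sub>R H x = indicator S x *\<^sub>R H x"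
        using N by eventually_elim (use A in \<open>auto simp: indicator_def\<close>)
    qed (use H A(4) \<open>A \<in> sets lebesgue\<close> in \<open>auto intro!: borel_measurable_scaleR[of "indicator _"] borel_measurable_indicator simp del: real_scaleR_def\<close>)
    then show "(LINT x:A|lebesgue. H x) = (LINT x:A|lebesgue. 0)"
      using borel[of S] A by (simp add: set_lebesgue_integral_def)
  qed simp
qed

text \<open>Only bumps over closed boxes inside \<open>U\<close> are used as test functions. This
  weak hypothesis pays off later, where mixed derivatives have to be interchanged for bumps
  only.\<close>

lemma fundamental_lemma:
  fixes h :: "real^'n \<Rightarrow> real^'m"
  assumes U: "open U" and h: "loc_integrable U h"
    and 0: "\<And>n a b. cbox a b \<subseteq> U \<Longrightarrow> (LINT x:U|lebesgue. bump n a b x *\<^sub>R h x) = 0"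
  shows "AE x in lebesgue. x \<in> U \<longrightarrow> h x = 0"
proof -
  have cb: "AE x in lebesgue. x \<in> cbox a b \<longrightarrow> h x = 0" if ab: "cbox a b \<subseteq> U" for a b
  proof -
    \<comment> \<open>Cutting \<open>h\<close> off outside \<open>box a b\<close> makes it globally
      integrable, and its integral over any box becomes one over a box inside
      \<open>box a b\<close>.\<close>
    have hb: "integrable lebesgue (\<lambda>x. indicator (box c d \<inter> box a b) x *\<^sub>R h x)" for c d
    proof -
      have "set_integrable lebesgue (cbox a b) h" using h ab by (auto simp: loc_integrable_def)
      then have "set_integrable lebesgue (box c d \<inter> box a b) h"
        by (rule set_integrable_subset) (use box_subset_cbox[of a b] in auto)
      then show ?thesis by (simp add: set_integrable_def)
    qed
    have z: "(LINT x|lebesgue. indicator (box c d \<inter> box a b) x *\<^sub>R h x) = 0" for c d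
    proof -
      obtain c' d' where cd: "box c d \<inter> box a b = box c' d'" 
        using box_Int_box[of c d a b] by blast
      show ?thesis
      \<comment> \<open>When the open box is empty, the closed box with the same corners may still
        be nonempty and leave \<open>U\<close>, so the limit argument is reserved for the other
        case.\<close>
      proof (cases "box c' d' = {}")
        case False
        then have "closure (box c' d') = cbox c' d'" by (rule closure_box)
        moreover have "closure (box c' d') \<subseteq> cbox a b"
          using cd box_subset_cbox[of a b] by (intro closure_minimal) auto
        ultimately have "cbox c' d' \<subseteq> U" using ab by auto
        from set_integral_box_eq_0[OF U h 0[OF this] this]
        show ?thesis by (simp add: cd set_lebesgue_integral_def)
      qed (simp add: cd)
    qed
    have tot: "box a b \<inter> box a b = box a b" by auto
    have comp: "AE x in lebesgue. indicator (box a b) x * h x $ i = 0" for i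
    proof (rule AE_eq_0_if_box_integrals_eq_0)
      have eq: "indicator (box c d) x * (indicator (box a b) x * h x $ i)
            = (indicator (box c d \<inter> box a b) x *\<^sub>R h x) $ i" for c d x
        by (auto simp: indicator_def)
      show "integrable lebesgue (\<lambda>x. indicator (box a b) x * h x $ i)"
        using integrable_bounded_linear[OF bounded_linear_vec_nth[of i] hb[of a b]] by (simp add: tot)
      show "(LINT x:box c d|lebesgue. indicator (box a b) x * h x $ i) = 0" for c d
        unfolding set_lebesgue_integral_def real_scaleR_def eq
        using integral_bounded_linear[OF bounded_linear_vec_nth[of i] hb[of c d]] z[of c d] by simp
      show "(LINT x|lebesgue. indicator (box a b) x * h x $ i) = 0"
        using integral_bounded_linear[OF bounded_linear_vec_nth[of i] hb[of a b]] z[of a b]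
        by (simp add: tot)
    qed
    have "AE x in lebesgue. \<forall>i. indicator (box a b) x * h x $ i = 0"
      using comp by (subst AE_all_countable) blast
    moreover have "AE x in lebesgue. x \<notin> cbox a b - box a b"
      using negligible_frontier_interval[of a b] by (intro AE_not_in) (simp add: negligible_iff_null_sets)
    ultimately show ?thesis
      by eventually_elim (auto simp: vec_eq_iff indicator_def)
  qed
  obtain D where D: "countable D" "D \<subseteq> Pow U" "\<And>X. X \<in> D \<Longrightarrow> \<exists>a b. X = cbox a b" "\<Union>D = U"
    using open_countable_Union_open_cbox[OF U] by metis
  have "AE x in lebesgue. x \<in> X \<longrightarrow> h x = 0" if X: "X \<in> D" for X
  proof -
    obtain a b where "X = cbox a b" using D(3)[OF X] by blast
    moreover have "X \<subseteq> U" using D(2) X by auto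
    ultimately show ?thesis using cb by auto
  qed
  then have "AE x in lebesgue. \<forall>X\<in>D. x \<in> X \<longrightarrow> h x = 0"
    by (subst AE_ball_countable[OF D(1)]) blast
  then show ?thesis by eventually_elim (use D(4) in auto)
qed

section \<open>Weak derivatives\<close>

lemma test_fun_outside: "test_fun U \<phi> \<Longrightarrow> x \<notin> closure {x. \<phi> x \<noteq> 0} \<Longrightarrow> \<phi> x = 0"
  using closure_subset[of "{x. \<phi> x \<noteq> 0}"] by auto

lemma test_fun_continuous: "test_fun U \<phi> \<Longrightarrow> continuous_on UNIV \<phi>"
  by (auto simp: test_fun_def intro: Cinf_on_continuous)

lemma test_fun_has_derivative: "test_fun U \<phi> \<Longrightarrow> (\<phi> has_derivative (\<lambda>v. pd \<phi> v x)) (at x)"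
  by (auto simp: test_fun_def intro: Cinf_on_has_derivative)

lemma test_fun_smaller_support:
  assumes "test_fun U \<phi>" "Cinf_on UNIV \<psi>" "\<And>x. x \<notin> closure {x. \<phi> x \<noteq> 0} \<Longrightarrow> \<psi> x = 0"
  shows "test_fun U \<psi>"
proof -
  have "closure {x. \<psi> x \<noteq> 0} \<subseteq> closure {x. \<phi> x \<noteq> 0}"
    using assms(3) by (intro closure_minimal) auto
  then show ?thesis
    using assms compact_Int_closed[of "closure {x. \<phi> x \<noteq> 0}" "closure {x. \<psi> x \<noteq> 0}"]
    by (auto simp: test_fun_def Int_absorb1)
qed

lemma test_fun_pd:
  assumes "test_fun U \<phi>"
  shows "test_fun U (\<lambda>x. pd \<phi> v x)"
proof (rule test_fun_smaller_support[OF assms])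
  show "Cinf_on UNIV (\<lambda>x. pd \<phi> v x)"
    using assms by (auto simp: test_fun_def intro: Cinf_on_pd)
  fix x assume x: "x \<notin> closure {x. \<phi> x \<noteq> 0}"
  have "pd \<phi> v x = pd (\<lambda>_. 0) v x"
    by (rule pd_cong_open[of "- closure {x. \<phi> x \<noteq> 0}"]) (use x assms test_fun_outside in auto)
  then show "pd \<phi> v x = 0" by (simp add: pd_def)
qed

text \<open>The factor \<open>a\<close> is arbitrary outside \<open>U\<close>. The product is smooth
  on \<open>U\<close> and zero off the support of the test function, and these two open sets cover
  the space.\<close>

lemma test_fun_mult:
  fixes a :: "real^'n \<Rightarrow> real"
  assumes U: "open U" and \<phi>: "test_fun U \<phi>" and a: "Cinf_on U a"
  shows "test_fun U (\<lambda>x. a x * \<phi> x)"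
proof (rule test_fun_smaller_support[OF \<phi>])
  let ?K = "closure {x. \<phi> x \<noteq> 0}"
  have KU: "U \<union> - ?K = UNIV" using \<phi> by (auto simp: test_fun_def)
  have "Ck_on k UNIV (\<lambda>x. a x * \<phi> x)" for k
  proof -
    have "Ck_on k U (\<lambda>x. a x * \<phi> x)"
    proof (rule Ck_on_mult[OF U])
      show "Ck_on k U a" using a unfolding Cinf_on_def by blast
      have "Ck_on k UNIV \<phi>" using \<phi> unfolding test_fun_def Cinf_on_def by blast
      then show "Ck_on k U \<phi>" by (rule Ck_on_subset) simp
    qed
    moreover have "Ck_on k (- ?K) (\<lambda>x. a x * \<phi> x)"
      by (rule Ck_on_cong[OF _ _ Ck_on_const[of _ _ 0]]) (auto dest: test_fun_outside[OF \<phi>])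
    ultimately show ?thesis using Ck_on_Un[of U "- ?K" k] U KU by auto
  qed
  then show "Cinf_on UNIV (\<lambda>x. a x * \<phi> x)" by (simp add: Cinf_on_def)
  show "a x * \<phi> x = 0" if "x \<notin> ?K" for x
    using test_fun_outside[OF \<phi> that] by simp
qed

lemma test_fun_bounded:
  assumes "test_fun U \<phi>"
  obtains B where "\<And>x. \<bar>\<phi> x\<bar> \<le> B"
proof -
  let ?K = "closure {x. \<phi> x \<noteq> 0}"
  have "compact (\<phi> ` ?K)"
    using assms test_fun_continuous[OF assms]
    by (intro compact_continuous_image) (auto simp: test_fun_def intro: continuous_on_subset)
  then obtain B where B: "B > 0" "\<forall>x\<in>\<phi> ` ?K. norm x \<le> B"
    using compact_imp_bounded bounded_pos by blast
  then have "\<bar>\<phi> x\<bar> \<le> B" for x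
    using test_fun_outside[OF assms, of x] B by (cases "x \<in> ?K") auto
  then show ?thesis using that by blast
qed

lemma test_fun_measurable: "test_fun U \<phi> \<Longrightarrow> \<phi> \<in> borel_measurable lebesgue"
  by (intro borel_measurable_lebesgue_continuous test_fun_continuous)

lemma integrable_bounded_scaleR:
  fixes f :: "'a \<Rightarrow> 'b::{second_countable_topology,banach}"
  assumes "integrable M f" "\<phi> \<in> borel_measurable M" "\<And>x. \<bar>\<phi> x\<bar> \<le> (B::real)"
  shows "integrable M (\<lambda>x. \<phi> x *\<^sub>R f x)"
proof (rule Bochner_Integration.integrable_bound)
  show "integrable M (\<lambda>x. B *\<^sub>R f x)" using assms by auto
  show "AE x in M. norm (\<phi> x *\<^sub>R f x) \<le> norm (B *\<^sub>R f x)"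
    using assms(3) by (intro AE_I2) (auto intro!: mult_right_mono simp: order_trans[OF _ abs_ge_self])
qed (use assms in auto)

lemma test_fun_integrable:
  assumes \<phi>: "test_fun U \<phi>" and f: "loc_integrable U f"
  shows "set_integrable lebesgue U (\<lambda>x. \<phi> x *\<^sub>R f x)"
proof -
  let ?K = "closure {x. \<phi> x \<noteq> 0}"
  obtain B where B: "\<And>x. \<bar>\<phi> x\<bar> \<le> B" using test_fun_bounded[OF \<phi>] by blast
  have "integrable lebesgue (\<lambda>x. indicator ?K x *\<^sub>R f x)"
    using f \<phi> by (auto simp: loc_integrable_def set_integrable_def test_fun_def)
  then have "integrable lebesgue (\<lambda>x. \<phi> x *\<^sub>R indicator ?K x *\<^sub>R f x)"
    by (rule integrable_bounded_scaleR[OF _ test_fun_measurable[OF \<phi>] B])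
  moreover have "\<phi> x *\<^sub>R indicator ?K x *\<^sub>R f x = indicator U x *\<^sub>R \<phi> x *\<^sub>R f x" for x
  proof (cases "x \<in> ?K")
    case True
    then have "x \<in> U" using \<phi> by (auto simp: test_fun_def)
    then show ?thesis using True by simp
  next
    case False
    then show ?thesis using test_fun_outside[OF \<phi> False] by simp
  qed
  ultimately show ?thesis by (simp only: set_integrable_def)
qed

lemma loc_integrable_add:
  "loc_integrable U f \<Longrightarrow> loc_integrable U g \<Longrightarrow> loc_integrable U (\<lambda>x. f x + g x)"
  by (auto simp: loc_integrable_def intro!: set_integral_add)

lemma loc_integrable_const: "loc_integrable U (\<lambda>x::real^'a. c)"
  unfolding loc_integrable_def
proof (intro allI impI, elim conjE)
  fix K :: "(real^'a) set" assume K: "compact K"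
  have "emeasure lborel K < \<infinity>"
    using emeasure_bounded_finite[OF compact_imp_bounded[OF K]] by simp
  then have "integrable lebesgue (indicator K :: _ \<Rightarrow> real)"
    using K by (auto simp: integrable_indicator_iff compact_imp_closed borel_closed)
  then show "set_integrable lebesgue K (\<lambda>x. c)"
    unfolding set_integrable_def by (rule integrable_scaleR_left)
qed

lemma loc_integrable_linear:
  "bounded_linear L \<Longrightarrow> loc_integrable U f \<Longrightarrow> loc_integrable U (\<lambda>x. L (f x))"
  unfolding loc_integrable_def set_integrable_def
  using integrable_bounded_linear[of L lebesgue "\<lambda>x. indicator _ x *\<^sub>R f x"]
  by (auto simp: bounded_linear.linear linear_cmul)

lemma loc_integrable_scaleR:
  assumes a: "continuous_on U a" and f: "loc_integrable U f"
  shows "loc_integrable U (\<lambda>x. a x *\<^sub>R f x)"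
  unfolding loc_integrable_def
proof (intro allI impI, elim conjE)
  fix K assume K: "compact K" "K \<subseteq> U"
  have aK: "continuous_on K a" using a K continuous_on_subset by blast
  obtain B where B: "B > 0" "\<forall>x\<in>a ` K. norm x \<le> B"
    using compact_imp_bounded[OF compact_continuous_image[OF aK K(1)]] bounded_pos by blast
  have "integrable lebesgue (\<lambda>x. indicator K x *\<^sub>R f x)"
    using f K by (auto simp: loc_integrable_def set_integrable_def)
  moreover have "(\<lambda>x. indicator K x *\<^sub>R a x) \<in> borel_measurable lebesgue"
    using borel_measurable_continuous_on_indicator[OF _ aK] K
    by (intro measurable_completion) (auto simp: compact_imp_closed borel_closed)
  moreover have "\<bar>indicator K x *\<^sub>R a x\<bar> \<le> B" for x using B by (auto simp: indicator_def)
  ultimately have "integrable lebesgue (\<lambda>x. (indicator K x *\<^sub>R a x) *\<^sub>R indicator K x *\<^sub>R f x)"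
    by (rule integrable_bounded_scaleR)
  moreover have "(indicator K x *\<^sub>R a x) *\<^sub>R indicator K x *\<^sub>R f x = indicator K x *\<^sub>R a x *\<^sub>R f x" for x
    by (auto simp: indicator_def)
  ultimately show "set_integrable lebesgue K (\<lambda>x. a x *\<^sub>R f x)"
    by (simp only: set_integrable_def)
qed

lemma loc_integrable_cong_AE:
  assumes f: "loc_integrable U f" and ae: "AE x in lebesgue. x \<in> U \<longrightarrow> f x = f' x"
  shows "loc_integrable U f'"
  unfolding loc_integrable_def
proof (intro allI impI, elim conjE)
  fix K assume K: "compact K" "K \<subseteq> U"
  have i: "integrable lebesgue (\<lambda>x. indicator K x *\<^sub>R f x)"
    using f K by (auto simp: loc_integrable_def set_integrable_def)
  have ae': "AE x in lebesgue. indicator K x *\<^sub>R f x = indicator K x *\<^sub>R f' x"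
    using ae by eventually_elim (use K in \<open>auto simp: indicator_def\<close>)
  have "(\<lambda>x. indicator K x *\<^sub>R f' x) \<in> borel_measurable lebesgue"
    using i by (intro borel_measurable_AE[OF _ ae']) auto
  then show "set_integrable lebesgue K f'"
    using integrable_cong_AE[OF _ _ ae'] i by (auto simp: set_integrable_def)
qed

text \<open>Needed because \<open>wpd\<close> is a choice: identities for it hold almost everywhere,
  and here they are carried through the defining integrals.\<close>

lemma weak_partial_cong_AE:
  assumes w: "weak_partial U f i g" and ae: "AE x in lebesgue. x \<in> U \<longrightarrow> f x = f' x"
    "AE x in lebesgue. x \<in> U \<longrightarrow> g x = g' x"
  shows "weak_partial U f' i g'"
proof -
  have l: "loc_integrable U f" "loc_integrable U g" using w by (auto simp: weak_partial_def)
  have l': "loc_integrable U f'" "loc_integrable U g'"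
    using loc_integrable_cong_AE l ae by blast+
  have eq: "(LINT x:U|lebesgue. \<phi> x *\<^sub>R h x) = (LINT x:U|lebesgue. \<phi> x *\<^sub>R h' x)"
    if "test_fun U \<phi>" "loc_integrable U h" "loc_integrable U h'" "AE x in lebesgue. x \<in> U \<longrightarrow> h x = h' x"
    for \<phi> and h h' :: "real^'a \<Rightarrow> real^'b"
    unfolding set_lebesgue_integral_def
  proof (rule integral_cong_AE)
    show "AE x in lebesgue. indicator U x *\<^sub>R \<phi> x *\<^sub>R h x = indicator U x *\<^sub>R \<phi> x *\<^sub>R h' x"
      using that(4) by eventually_elim (auto simp: indicator_def)
  qed (use test_fun_integrable[OF that(1,2)] test_fun_integrable[OF that(1,3)] in
        \<open>simp_all only: set_integrable_def borel_measurable_integrable\<close>)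
  show ?thesis unfolding weak_partial_def
  proof (intro conjI allI impI l')
    fix \<phi> assume \<phi>: "test_fun U \<phi>"
    show "(LINT x:U|lebesgue. pd \<phi> (axis i 1) x *\<^sub>R f' x) = - (LINT x:U|lebesgue. \<phi> x *\<^sub>R g' x)"
      unfolding eq[OF \<phi> l(2) l'(2) ae(2), symmetric] 
        eq[OF test_fun_pd[OF \<phi>, of "axis i 1"] l(1) l'(1) ae(1), symmetric]
      using w \<phi> unfolding weak_partial_def by blast
  qed
qed

lemma weak_partial_linear:
  assumes L: "bounded_linear L" and w: "weak_partial U f i g"
  shows "weak_partial U (\<lambda>x. L (f x)) i (\<lambda>x. L (g x))"
proof -
  have l: "loc_integrable U f" "loc_integrable U g" using w by (auto simp: weak_partial_def)
  interpret L: bounded_linear L by (rule L)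
  have eq: "(LINT x:U|lebesgue. \<phi> x *\<^sub>R L (h x)) = L (LINT x:U|lebesgue. \<phi> x *\<^sub>R h x)"
    if "test_fun U \<phi>" "loc_integrable U h" for \<phi> h
    using integral_bounded_linear[OF L test_fun_integrable[OF that, unfolded set_integrable_def]]
    by (simp add: set_lebesgue_integral_def L.scaleR)
  show ?thesis unfolding weak_partial_def
  proof (intro conjI allI impI)
    show "loc_integrable U (\<lambda>x. L (f x))" "loc_integrable U (\<lambda>x. L (g x))"
      using loc_integrable_linear[OF L] l by auto
    fix \<phi> assume \<phi>: "test_fun U \<phi>"
    show "(LINT x:U|lebesgue. pd \<phi> (axis i 1) x *\<^sub>R L (f x)) = - (LINT x:U|lebesgue. \<phi> x *\<^sub>R L (g x))"
      using w \<phi> unfolding eq[OF \<phi> l(2)] eq[OF test_fun_pd[OF \<phi>] l(1)]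
      by (simp add: weak_partial_def L.neg)
  qed
qed

lemma weak_partial_add:
  assumes w: "weak_partial U f i g" and w': "weak_partial U f' i g'"
  shows "weak_partial U (\<lambda>x. f x + f' x) i (\<lambda>x. g x + g' x)"
proof -
  have l: "loc_integrable U f" "loc_integrable U g" "loc_integrable U f'" "loc_integrable U g'"
    using w w' by (auto simp: weak_partial_def)
  have eq: "(LINT x:U|lebesgue. \<phi> x *\<^sub>R (h x + h' x)) = (LINT x:U|lebesgue. \<phi> x *\<^sub>R h x) + (LINT x:U|lebesgue. \<phi> x *\<^sub>R h' x)"
    if "test_fun U \<phi>" "loc_integrable U h" "loc_integrable U h'" for \<phi> and h h' :: "real^'a \<Rightarrow> real^'b"
    using set_integral_add(2)[OF test_fun_integrable[OF that(1,2)] test_fun_integrable[OF that(1,3)]]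
    by (simp add: scaleR_add_right)
  show ?thesis unfolding weak_partial_def
  proof (intro conjI allI impI loc_integrable_add l)
    fix \<phi> assume \<phi>: "test_fun U \<phi>"
    show "(LINT x:U|lebesgue. pd \<phi> (axis i 1) x *\<^sub>R (f x + f' x)) = - (LINT x:U|lebesgue. \<phi> x *\<^sub>R (g x + g' x))"
      using w w' \<phi> unfolding eq[OF \<phi> l(2,4)] eq[OF test_fun_pd[OF \<phi>] l(1,3)]
      by (simp add: weak_partial_def)
  qed
qed

lemma weak_partial_zero: "weak_partial U (\<lambda>x. 0) i (\<lambda>x. 0)"
  by (auto simp: weak_partial_def loc_integrable_const)

lemma weak_partial_sum:
  assumes "\<And>k. k \<in> I \<Longrightarrow> weak_partial U (f k) i (g k)"
  shows "weak_partial U (\<lambda>x. \<Sum>k\<in>I. f k x) i (\<lambda>x. \<Sum>k\<in>I. g k x)"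
  using assms by (induction I rule: infinite_finite_induct) (auto intro: weak_partial_add weak_partial_zero)

lemma weak_partial_diff:
  assumes w: "weak_partial U f i g" and w': "weak_partial U f' i g'"
  shows "weak_partial U (\<lambda>x. f x - f' x) i (\<lambda>x. g x - g' x)"
  using weak_partial_add[OF w weak_partial_linear[OF bounded_linear_minus[OF bounded_linear_ident] w']] by simp

text \<open>The hypothesis on \<open>f\<close> is applied to the test function
  \<open>a x * \<phi> x\<close>; the Leibniz rule for its derivative produces the additional
  term.\<close>

lemma weak_partial_scaleR:
  assumes U: "open U" and a: "Cinf_on U a" and w: "weak_partial U f i g"
  shows "weak_partial U (\<lambda>x. a x *\<^sub>R f x) i (\<lambda>x. pd a (axis i 1) x *\<^sub>R f x + a x *\<^sub>R g x)"
  unfolding weak_partial_def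
proof (intro conjI allI impI)
  have l: "loc_integrable U f" "loc_integrable U g" using w by (auto simp: weak_partial_def)
  have a': "Cinf_on U (\<lambda>x. pd a (axis i 1) x)" by (rule Cinf_on_pd[OF a U])
  show "loc_integrable U (\<lambda>x. a x *\<^sub>R f x)"
    by (intro loc_integrable_scaleR Cinf_on_continuous[OF a] l)
  show "loc_integrable U (\<lambda>x. pd a (axis i 1) x *\<^sub>R f x + a x *\<^sub>R g x)"
    by (intro loc_integrable_add loc_integrable_scaleR Cinf_on_continuous[OF a] Cinf_on_continuous[OF a'] l)
  fix \<phi> assume \<phi>: "test_fun U \<phi>"
  note t1 = test_fun_mult[OF U \<phi> a] and t2 = test_fun_mult[OF U \<phi> a'] 
    and t3 = test_fun_mult[OF U test_fun_pd[OF \<phi>] a]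
  have D: "pd (\<lambda>x. a x * \<phi> x) (axis i 1) x = a x * pd \<phi> (axis i 1) x + pd a (axis i 1) x * \<phi> x"
    if "x \<in> U" for x
    by (rule pd_eqI[OF has_derivative_mult[OF Cinf_on_has_derivative[OF a U that] test_fun_has_derivative[OF \<phi>]]])
  have D': "pd \<phi> (axis i 1) x *\<^sub>R a x *\<^sub>R f x
      = pd (\<lambda>x. a x * \<phi> x) (axis i 1) x *\<^sub>R f x - (pd a (axis i 1) x * \<phi> x) *\<^sub>R f x" if "x \<in> U" for x
    unfolding D[OF that] by (simp add: algebra_simps)
  have "(LINT x:U|lebesgue. pd \<phi> (axis i 1) x *\<^sub>R a x *\<^sub>R f x)
     = (LINT x:U|lebesgue. pd (\<lambda>x. a x * \<phi> x) (axis i 1) x *\<^sub>R f x - (pd a (axis i 1) x * \<phi> x) *\<^sub>R f x)"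
    unfolding set_lebesgue_integral_def
  proof (rule Bochner_Integration.integral_cong[OF refl])
    fix x
    show "indicator U x *\<^sub>R pd \<phi> (axis i 1) x *\<^sub>R a x *\<^sub>R f x = indicator U x *\<^sub>R
        (pd (\<lambda>x. a x * \<phi> x) (axis i 1) x *\<^sub>R f x - (pd a (axis i 1) x * \<phi> x) *\<^sub>R f x)"
      using D'[of x] by (cases "x \<in> U") simp_all
  qed
  also have "\<dots> = (LINT x:U|lebesgue. pd (\<lambda>x. a x * \<phi> x) (axis i 1) x *\<^sub>R f x)
      - (LINT x:U|lebesgue. (pd a (axis i 1) x * \<phi> x) *\<^sub>R f x)"
    by (intro set_integral_diff test_fun_integrable[OF test_fun_pd[OF t1] l(1)] test_fun_integrable[OF t2 l(1)])
  also have "(LINT x:U|lebesgue. pd (\<lambda>x. a x * \<phi> x) (axis i 1) x *\<^sub>R f x) = - (LINT x:U|lebesgue. (a x * \<phi> x) *\<^sub>R g x)"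
    using w t1 by (simp add: weak_partial_def)
  also have "- (LINT x:U|lebesgue. (a x * \<phi> x) *\<^sub>R g x) - (LINT x:U|lebesgue. (pd a (axis i 1) x * \<phi> x) *\<^sub>R f x)
    = - (LINT x:U|lebesgue. (pd a (axis i 1) x * \<phi> x) *\<^sub>R f x + (a x * \<phi> x) *\<^sub>R g x)"
    using set_integral_add(2)[OF test_fun_integrable[OF t2 l(1)] test_fun_integrable[OF t1 l(2)]] by simp
  also have "(LINT x:U|lebesgue. (pd a (axis i 1) x * \<phi> x) *\<^sub>R f x + (a x * \<phi> x) *\<^sub>R g x)
    = (LINT x:U|lebesgue. \<phi> x *\<^sub>R (pd a (axis i 1) x *\<^sub>R f x + a x *\<^sub>R g x))"
    by (simp add: scaleR_add_right mult.commute)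
  finally show "(LINT x:U|lebesgue. pd \<phi> (axis i 1) x *\<^sub>R a x *\<^sub>R f x)
    = - (LINT x:U|lebesgue. \<phi> x *\<^sub>R (pd a (axis i 1) x *\<^sub>R f x + a x *\<^sub>R g x))" .
qed

text \<open>Expanding the smooth factor in the standard basis leaves scalar functions times fixed
  linear images of \<open>f\<close>, so the scalar Leibniz rule suffices. Cross products and matrix
  actions are the instances of interest.\<close>

lemma weak_partial_bilinear:
  fixes a :: "real^'n \<Rightarrow> 'b::euclidean_space" and B :: "'b \<Rightarrow> real^'m \<Rightarrow> real^'k"
  assumes U: "open U" and B: "bounded_bilinear B" and a: "Cinf_on U a" and w: "weak_partial U f i g"
  shows "weak_partial U (\<lambda>x. B (a x) (f x)) i (\<lambda>x. B (pd a (axis i 1) x) (f x) + B (a x) (g x))"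
proof -
  interpret B: bounded_bilinear B by (rule B)
  have rep: "B v z = (\<Sum>k\<in>Basis. (v \<bullet> k) *\<^sub>R B k z)" for v z
  proof -
    have "B v z = B (\<Sum>k\<in>Basis. (v \<bullet> k) *\<^sub>R k) z" by (simp add: euclidean_representation)
    then show ?thesis by (simp add: B.sum_left B.scaleR_left)
  qed
  have c: "Cinf_on U (\<lambda>x. a x \<bullet> k)" for k
    using a U Ck_on_bounded_linear[OF bounded_linear_inner_left[of k] U] by (auto simp: Cinf_on_def)
  have D: "pd (\<lambda>x. a x \<bullet> k) v x = pd a v x \<bullet> k" if "x \<in> U" for k v x
    by (rule pd_eqI[OF has_derivative_inner_left[OF Cinf_on_has_derivative[OF a U that]]])
  have "weak_partial U (\<lambda>x. \<Sum>k\<in>Basis. (a x \<bullet> k) *\<^sub>R B k (f x)) i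
      (\<lambda>x. \<Sum>k\<in>Basis. pd (\<lambda>x. a x \<bullet> k) (axis i 1) x *\<^sub>R B k (f x) + (a x \<bullet> k) *\<^sub>R B k (g x))"
    by (intro weak_partial_sum weak_partial_scaleR U c weak_partial_linear[OF B.bounded_linear_right w])
  then show ?thesis
    by (rule weak_partial_cong_AE) 
      (auto simp: rep[symmetric] D sum.distrib intro!: AE_I2)
qed

lemma weak_partial_unique:
  assumes U: "open U" and w: "weak_partial U f i g" "weak_partial U f i g'"
  shows "AE x in lebesgue. x \<in> U \<longrightarrow> g x = g' x"
proof -
  have d: "weak_partial U (\<lambda>x. 0) i (\<lambda>x. g x - g' x)"
    using weak_partial_diff[OF w] by simp
  have "AE x in lebesgue. x \<in> U \<longrightarrow> g x - g' x = 0"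
    using d by (intro fundamental_lemma U) (auto simp: weak_partial_def test_fun_bump)
  then show ?thesis by simp
qed

lemma weak_partial_wpd: "weak_partial U f i g \<Longrightarrow> weak_partial U f i (wpd U f i)"
  unfolding wpd_def by (rule someI[of "weak_partial U f i"])

lemma wpd_AE_eq:
  assumes "open U" "weak_partial U f i g"
  shows "AE x in lebesgue. x \<in> U \<longrightarrow> wpd U f i x = g x"
  using weak_partial_unique[OF assms(1) weak_partial_wpd[OF assms(2)] assms(2)] .

text \<open>In two variables a bump has the form p(x1) q(x2), for which both mixed derivatives are
  p'(x1) q'(x2).\<close>

lemma pd_pd_bump_commute:
  fixes a b :: "real^2"
  shows "pd (\<lambda>x. pd (bump n a b) (axis i 1) x) (axis j 1) x = pd (\<lambda>x. pd (bump n a b) (axis j 1) x) (axis i 1) x"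
proof -
  let ?P = "bump1 n (a $ 1) (b $ 1)" and ?Q = "bump1 n (a $ 2) (b $ 2)"
  have s: "Cinf_on UNIV ?P" "Cinf_on UNIV ?Q" "Cinf_on UNIV (\<lambda>t. pd ?P 1 t)" "Cinf_on UNIV (\<lambda>t. pd ?Q 1 t)"
    by (auto intro: Cinf_on_bump1 Cinf_on_pd)
  have ch: "((\<lambda>x::real^2. p (x $ k)) has_derivative (\<lambda>v. v $ k * pd p 1 (x $ k))) (at x)"
    if "Cinf_on UNIV p" for p :: "real \<Rightarrow> real" and k x
  proof -
    have "(p has_derivative (\<lambda>v. pd p v (x $ k))) (at (x $ k))"
      by (rule Cinf_on_has_derivative[OF that]) auto
    moreover have "(\<lambda>v. pd p v (x $ k)) = (\<lambda>v. v * pd p 1 (x $ k))"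
    proof
      show "pd p v (x $ k) = v * pd p 1 (x $ k)" for v
        using pd_expand[OF Cinf_on_differentiable[OF that open_UNIV UNIV_I], of v "x $ k"]
        unfolding Basis_real_def by simp
    qed
    ultimately have "(p has_derivative (\<lambda>v. v * pd p 1 (x $ k))) (at (x $ k))" by metis
    from has_derivative_compose[OF bounded_linear_imp_has_derivative[OF bounded_linear_vec_nth] this]
    show ?thesis .
  qed
  have D: "pd (\<lambda>x::real^2. p (x $ 1) * q (x $ 2)) v x = p (x $ 1) * (v $ 2 * pd q 1 (x $ 2)) + v $ 1 * pd p 1 (x $ 1) * q (x $ 2)"
    if "Cinf_on UNIV p" "Cinf_on UNIV q" for p q :: "real \<Rightarrow> real" and v x
    by (rule pd_eqI[OF has_derivative_mult[OF ch[OF that(1)] ch[OF that(2)]]])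
  have eq: "bump n a b = (\<lambda>x. ?P (x $ 1) * ?Q (x $ 2))"
    by (auto simp: bump_def UNIV_2)
  have 1: "pd (bump n a b) (axis 1 1) = (\<lambda>x. pd ?P 1 (x $ 1) * ?Q (x $ 2))"
    unfolding eq by (rule ext) (subst D[OF s(1,2)], simp add: axis_def)
  have 2: "pd (bump n a b) (axis 2 1) = (\<lambda>x. ?P (x $ 1) * pd ?Q 1 (x $ 2))"
    unfolding eq by (rule ext) (subst D[OF s(1,2)], simp add: axis_def)
  have "pd (pd (bump n a b) (axis 1 1)) (axis 2 1) x = pd (pd (bump n a b) (axis 2 1)) (axis 1 1) x"
    unfolding 1 2 by (subst D[OF s(3,2)], subst D[OF s(1,4)], simp add: axis_def)
  moreover have "i = 1 \<or> i = 2" "j = 1 \<or> j = 2" using exhaust_2 by auto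
  ultimately show ?thesis by auto
qed

text \<open>Tested with a bump, both weak second derivatives become the integral of \<open>f\<close>
  against a mixed second derivative of the bump, and these coincide.\<close>

lemma weak_partial_commute:
  fixes f :: "real^2 \<Rightarrow> real^'m"
  assumes U: "open U" and i: "weak_partial U f i g" "weak_partial U g j h"
    and j: "weak_partial U f j g'" "weak_partial U g' i h'"
  shows "AE x in lebesgue. x \<in> U \<longrightarrow> h x = h' x"
proof -
  have l: "loc_integrable U h" "loc_integrable U h'" using i j by (auto simp: weak_partial_def)
  have "AE x in lebesgue. x \<in> U \<longrightarrow> h x - h' x = 0"
  proof (rule fundamental_lemma[OF U])
    show "loc_integrable U (\<lambda>x. h x - h' x)"
      using loc_integrable_add[OF l(1) loc_integrable_linear[OF bounded_linear_minus[OF bounded_linear_ident] l(2)]] by simp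
    fix n and a b :: "real^2" assume ab: "cbox a b \<subseteq> U"
    let ?\<phi> = "bump n a b"
    note \<phi> = test_fun_bump[OF ab, of n]
    have *: "(LINT x:U|lebesgue. ?\<phi> x *\<^sub>R h x) = (LINT x:U|lebesgue. pd (\<lambda>x. pd ?\<phi> (axis j 1) x) (axis i 1) x *\<^sub>R f x)"
      if "weak_partial U f i g" "weak_partial U g j h" for i j g and h :: "real^2 \<Rightarrow> real^'m"
      using that \<phi> test_fun_pd[OF \<phi>] by (auto simp: weak_partial_def)
    have "(LINT x:U|lebesgue. ?\<phi> x *\<^sub>R h x) = (LINT x:U|lebesgue. ?\<phi> x *\<^sub>R h' x)"
      using *[OF i] *[OF j] by (simp add: pd_pd_bump_commute[of n a b i j])
    moreover have "(LINT x:U|lebesgue. ?\<phi> x *\<^sub>R h x - ?\<phi> x *\<^sub>R h' x) = (LINT x:U|lebesgue. ?\<phi> x *\<^sub>R h x) - (LINT x:U|lebesgue. ?\<phi> x *\<^sub>R h' x)"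
      by (intro set_integral_diff test_fun_integrable[OF \<phi>] l)
    ultimately show "(LINT x:U|lebesgue. ?\<phi> x *\<^sub>R (h x - h' x)) = 0"
      by (simp add: scaleR_diff_right)
  qed
  then show ?thesis by simp
qed

section \<open>Increments of weakly differentiable functions\<close>

lemma integral_lborel_translate:
  fixes f :: "'a::euclidean_space \<Rightarrow> 'b::{banach,second_countable_topology}"
  assumes "f \<in> borel_measurable borel"
  shows "(LINT x|lborel. f (x + c)) = (LINT x|lborel. f x)"
proof -
  have "(LINT x|lborel. f x) = (LINT x|distr lborel borel ((+) c). f x)"
    by (simp only: lborel_distr_plus)
  also have "\<dots> = (LINT x|lborel. f (c + x))"
    using assms by (intro integral_distr) auto
  finally show ?thesis by (simp add: add.commute)
qed

lemma nn_integral_lborel_translate: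
  fixes f :: "'a::euclidean_space \<Rightarrow> ennreal"
  assumes "f \<in> borel_measurable borel"
  shows "(\<integral>\<^sup>+x. f (x + c) \<partial>lborel) = (\<integral>\<^sup>+x. f x \<partial>lborel)"
proof -
  have "(\<integral>\<^sup>+x. f x \<partial>lborel) = (\<integral>\<^sup>+x. f x \<partial>distr lborel borel ((+) c))"
    by (simp only: lborel_distr_plus)
  also have "\<dots> = (\<integral>\<^sup>+x. f (c + x) \<partial>lborel)"
    using assms by (intro nn_integral_distr) auto
  finally show ?thesis by (simp add: add.commute)
qed

lemma integrable_lborel_translate:
  fixes f :: "'a::euclidean_space \<Rightarrow> 'b::{banach,second_countable_topology}"
  assumes "integrable lborel f"
  shows "integrable lborel (\<lambda>x. f (x + c))"
proof -
  have [measurable]: "f \<in> borel_measurable borel" using borel_measurable_integrable[OF assms] by simp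
  have "(\<integral>\<^sup>+x. norm (f (x + c)) \<partial>lborel) = (\<integral>\<^sup>+x. norm (f x) \<partial>lborel)"
    by (rule nn_integral_lborel_translate) simp
  then show ?thesis using assms by (simp add: integrable_iff_bounded)
qed

text \<open>In the applications the norms of the slices are bounded uniformly in \<open>t\<close>,
  by translation invariance or because one factor is bounded; the finite length of the strip does
  the rest.\<close>

lemma integrable_strip:
  fixes K :: "real \<times> 'a::euclidean_space \<Rightarrow> 'b::{banach,second_countable_topology}"
  assumes [measurable]: "K \<in> borel_measurable (borel \<Otimes>\<^sub>M borel)"
    and B: "\<And>t. t \<in> {0..1} \<Longrightarrow> (\<integral>\<^sup>+x. norm (K (t, x)) \<partial>lborel) \<le> C" and C: "C < \<infinity>"
  shows "integrable (lborel \<Otimes>\<^sub>M lborel) (\<lambda>(t, x). indicator {0..1} t *\<^sub>R K (t, x))"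
proof (rule integrableI_bounded)
  show "(\<lambda>(t, x). indicator {0..1} t *\<^sub>R K (t, x)) \<in> borel_measurable (lborel \<Otimes>\<^sub>M lborel)"
    by measurable
  have "(\<integral>\<^sup>+p. norm (case p of (t, x) \<Rightarrow> indicator {0..1} t *\<^sub>R K (t, x)) \<partial>(lborel \<Otimes>\<^sub>M lborel))
     = (\<integral>\<^sup>+t. \<integral>\<^sup>+x. norm (indicator {0..1} t *\<^sub>R K (t, x)) \<partial>lborel \<partial>lborel)"
    by (subst lborel.nn_integral_fst[symmetric]) simp_all
  also have "\<dots> \<le> (\<integral>\<^sup>+t. C * indicator {0..1::real} t \<partial>lborel)"
    by (intro nn_integral_mono) (auto simp: B indicator_def)
  also have "\<dots> = C" by (simp add: nn_integral_cmult_indicator)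
  finally show "(\<integral>\<^sup>+p. norm (case p of (t, x) \<Rightarrow> indicator {0..1} t *\<^sub>R K (t, x)) \<partial>(lborel \<Otimes>\<^sub>M lborel)) < \<infinity>"
    using C by (rule le_less_trans)
qed

lemma Fubini_strip:
  fixes K :: "real \<times> 'a::euclidean_space \<Rightarrow> 'b::{banach,second_countable_topology}"
  assumes "K \<in> borel_measurable (borel \<Otimes>\<^sub>M borel)"
    and "\<And>t. t \<in> {0..1} \<Longrightarrow> (\<integral>\<^sup>+x. norm (K (t, x)) \<partial>lborel) \<le> C" and "C < \<infinity>"
  shows "(LINT t:{0..1}|lborel. (LINT x|lborel. K (t, x))) = (LINT x|lborel. (LINT t:{0..1}|lborel. K (t, x)))"
    and "integrable lborel (\<lambda>x. (LINT t:{0..1}|lborel. K (t, x)))"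
proof -
  note I = integrable_strip[OF assms]
  show "(LINT t:{0..1}|lborel. (LINT x|lborel. K (t, x))) = (LINT x|lborel. (LINT t:{0..1}|lborel. K (t, x)))"
    using lborel_pair.Fubini_integral[OF I] by (simp add: set_lebesgue_integral_def)
  show "integrable lborel (\<lambda>x. (LINT t:{0..1}|lborel. K (t, x)))"
    using lborel_pair.integrable_snd[OF I] by (simp add: set_lebesgue_integral_def)
qed

lemma test_fun_FTC:
  fixes \<phi> :: "real^'n \<Rightarrow> real" and v :: "'b::{banach,second_countable_topology}"
  assumes "test_fun U \<phi>"
  shows "(LINT t:{0..1}|lborel. pd \<phi> e (x - t *\<^sub>R e) *\<^sub>R v) = (\<phi> x - \<phi> (x - e)) *\<^sub>R v"
proof -
  \<comment> \<open>The point moves in direction \<open>-e\<close>, hence the minus sign in the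
    antiderivative.\<close>
  have D: "((\<lambda>t. - \<phi> (x - t *\<^sub>R e)) has_real_derivative pd \<phi> e (x - t *\<^sub>R e)) (at t)" for t
  proof -
    have l: "((\<lambda>t. x - t *\<^sub>R e) has_derivative (\<lambda>s. - s *\<^sub>R e)) (at t)"
      by (auto intro!: derivative_eq_intros)
    have lin: "pd \<phi> (- s *\<^sub>R e) y = - (s * pd \<phi> e y)" for s y
    proof -
      have "linear (\<lambda>v. pd \<phi> v y)"
        using test_fun_has_derivative[OF assms] has_derivative_linear by blast
      then show ?thesis using linear_cmul[of "\<lambda>v. pd \<phi> v y" "- s" e] by simp
    qed
    have "((\<lambda>t. \<phi> (x - t *\<^sub>R e)) has_derivative (\<lambda>s. - (s * pd \<phi> e (x - t *\<^sub>R e)))) (at t)"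
      using has_derivative_compose[OF l test_fun_has_derivative[OF assms]] 
      by (simp only: lin)
    from has_derivative_minus[OF this] show ?thesis
      by (simp add: has_field_derivative_def mult_commute_abs)
  qed
  have "continuous_on UNIV (\<lambda>x. pd \<phi> e x)" by (rule test_fun_continuous[OF test_fun_pd[OF assms]])
  then have "continuous_on UNIV (\<lambda>t. pd \<phi> e (x - t *\<^sub>R e))"
    by (rule continuous_on_compose2) (auto intro!: continuous_intros)
  then have c: "isCont (\<lambda>t. pd \<phi> e (x - t *\<^sub>R e)) t" for t by (simp add: continuous_on_eq_continuous_at)
  have "(LINT t|lborel. pd \<phi> e (x - t *\<^sub>R e) * indicator {0..1} t) = - \<phi> (x - 1 *\<^sub>R e) - - \<phi> (x - 0 *\<^sub>R e)"
    by (rule integral_FTC_Icc_real) (auto intro: D c)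
  moreover have "integrable lborel (\<lambda>t. pd \<phi> e (x - t *\<^sub>R e) * indicator {0..1} t)"
    by (rule borel_integrable_atLeastAtMost) (rule c)
  then have "(LINT t|lborel. (pd \<phi> e (x - t *\<^sub>R e) * indicator {0..1} t) *\<^sub>R v)
    = (LINT t|lborel. pd \<phi> e (x - t *\<^sub>R e) * indicator {0..1} t) *\<^sub>R v"
    by (rule integral_scaleR_left)
  ultimately show ?thesis by (simp add: set_lebesgue_integral_def mult.commute)
qed

lemma test_fun_translate:
  fixes \<phi> :: "real^'n \<Rightarrow> real"
  assumes "test_fun V \<phi>" and "\<And>y. y \<in> V \<Longrightarrow> y + d \<in> U"
  shows "test_fun U (\<lambda>x. \<phi> (x - d))"
  unfolding test_fun_def
proof (intro conjI)
  show "Cinf_on UNIV (\<lambda>x. \<phi> (x - d))"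
    using assms(1) Ck_on_affine[of "\<lambda>x. x" UNIV UNIV "- d"] by (auto simp: test_fun_def Cinf_on_def)
  have "{x. \<phi> (x - d) \<noteq> 0} = (\<lambda>x. d + x) ` {x. \<phi> x \<noteq> 0}"
    by (auto simp: image_iff) (metis add.commute diff_add_cancel)
  then have *: "closure {x. \<phi> (x - d) \<noteq> 0} = (\<lambda>x. d + x) ` closure {x. \<phi> x \<noteq> 0}"
    by (simp add: closure_translation)
  show "compact (closure {x. \<phi> (x - d) \<noteq> 0})"
    using assms(1) unfolding * by (intro compact_translation) (auto simp: test_fun_def)
  show "closure {x. \<phi> (x - d) \<noteq> 0} \<subseteq> U"
    using assms unfolding * by (auto simp: test_fun_def add.commute)
qed

lemma pd_translate: "pd (\<lambda>x. \<phi> (x - d)) v x = pd \<phi> v (x - d)" if "test_fun U \<phi>"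
proof -
  have "((\<lambda>x. x - d) has_derivative (\<lambda>v. v)) (at x)" by (auto intro!: derivative_eq_intros)
  from has_derivative_compose[OF this test_fun_has_derivative[OF that]]
  show ?thesis by (rule pd_eqI)
qed

lemma test_fun_borel [measurable_dest]:
  "test_fun U \<phi> \<Longrightarrow> \<phi> \<in> borel_measurable borel"
  by (intro borel_measurable_continuous_onI test_fun_continuous)

lemma test_fun_lborel_integrable:
  fixes f :: "real^'n \<Rightarrow> 'b::{banach,second_countable_topology}"
  assumes "test_fun U \<phi>" "integrable lborel f"
  shows "integrable lborel (\<lambda>x. \<phi> x *\<^sub>R f x)"
proof -
  obtain B where "\<And>x. \<bar>\<phi> x\<bar> \<le> B" using test_fun_bounded[OF assms(1)] by blast
  then show ?thesis using assms test_fun_borel[OF assms(1)] by (intro integrable_bounded_scaleR) auto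
qed

lemma nn_integral_norm_scaleR_le:
  fixes f :: "'a \<Rightarrow> 'b::{banach,second_countable_topology}"
  assumes "\<And>x. \<bar>a x\<bar> \<le> B" "f \<in> borel_measurable M"
  shows "(\<integral>\<^sup>+x. norm (a x *\<^sub>R f x) \<partial>M) \<le> ennreal B * (\<integral>\<^sup>+x. norm (f x) \<partial>M)"
proof -
  have "0 \<le> B" using assms(1) abs_ge_zero order_trans by blast
  have "(\<integral>\<^sup>+x. norm (a x *\<^sub>R f x) \<partial>M) \<le> (\<integral>\<^sup>+x. ennreal B * norm (f x) \<partial>M)"
    using assms(1) \<open>0 \<le> B\<close> by (intro nn_integral_mono) (auto simp: ennreal_mult[symmetric] intro!: ennreal_leI mult_right_mono)
  then show ?thesis using assms(2) by (simp add: nn_integral_cmult)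
qed

text \<open>Testing with all translates of one test function along the segment turns the weak derivative
  into an integrated difference quotient; no mollification is needed.\<close>

lemma weak_derivative_increment:
  fixes f g :: "real^'n \<Rightarrow> real^'m"
  assumes V: "open V" and seg: "\<And>y t. y \<in> V \<Longrightarrow> t \<in> {0..1} \<Longrightarrow> y + t *\<^sub>R e \<in> U"
    and f: "integrable lborel f" and g: "integrable lborel g"
    and w: "\<And>\<phi>. test_fun U \<phi> \<Longrightarrow> (LINT x|lborel. pd \<phi> e x *\<^sub>R f x) = - (LINT x|lborel. \<phi> x *\<^sub>R g x)"
  shows "AE y in lborel. y \<in> V \<longrightarrow> f (y + e) - f y = (LINT t:{0..1}|lborel. g (y + t *\<^sub>R e))"
proof -
  have [measurable]: "f \<in> borel_measurable borel" "g \<in> borel_measurable borel"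
    using f g by auto
  have fin: "(\<integral>\<^sup>+x. norm (f x) \<partial>lborel) < \<infinity>" "(\<integral>\<^sup>+x. norm (g x) \<partial>lborel) < \<infinity>"
    using f g by (simp_all add: integrable_iff_bounded)
  have gt: "(\<integral>\<^sup>+x. norm (g (x + t *\<^sub>R e)) \<partial>lborel) = (\<integral>\<^sup>+x. norm (g x) \<partial>lborel)" for t
    by (rule nn_integral_lborel_translate) simp
  define J where "J y = (LINT t:{0..1}|lborel. g (y + t *\<^sub>R e))" for y
  have J: "integrable lborel J"
    unfolding J_def
    using Fubini_strip(2)[of "\<lambda>(t, y). g (y + t *\<^sub>R e)" "\<integral>\<^sup>+x. norm (g x) \<partial>lborel"] fin gt by simp
  \<comment> \<open>The identity to be proved is that \<open>H\<close> vanishes almost everywhere on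
    \<open>V\<close>; it is obtained by testing.\<close>
  define H where "H y = f (y + e) - f y - J y" for y
  have H: "integrable lborel H" unfolding H_def
    by (intro Bochner_Integration.integrable_diff integrable_lborel_translate f J)
  have H0: "(LINT y|lborel. \<phi> y *\<^sub>R H y) = 0" if \<phi>: "test_fun V \<phi>" for \<phi>
  proof -
    note [measurable] = test_fun_borel[OF \<phi>] test_fun_borel[OF test_fun_pd[OF \<phi>]]
    obtain B where B: "\<And>x. \<bar>\<phi> x\<bar> \<le> B" using test_fun_bounded[OF \<phi>] by blast
    obtain B' where B': "\<And>x. \<bar>pd \<phi> e x\<bar> \<le> B'" using test_fun_bounded[OF test_fun_pd[OF \<phi>]] by blast
    \<comment> \<open>Averaging the translated derivative over \<open>t\<close> yields the
      difference of the test function at \<open>x\<close> and \<open>x - e\<close>, by the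
      fundamental theorem of calculus on the segment.\<close>
    have "(LINT t:{0..1}|lborel. (LINT x|lborel. pd \<phi> e (x - t *\<^sub>R e) *\<^sub>R f x))
      = (LINT x|lborel. (LINT t:{0..1}|lborel. pd \<phi> e (x - t *\<^sub>R e) *\<^sub>R f x))"
      using Fubini_strip(1)[of "\<lambda>(t, x). pd \<phi> e (x - t *\<^sub>R e) *\<^sub>R f x" "ennreal B' * (\<integral>\<^sup>+x. norm (f x) \<partial>lborel)"]
        nn_integral_norm_scaleR_le[of "\<lambda>x. pd \<phi> e (x - _ *\<^sub>R e)" B' f lborel] B' fin
      by (simp add: ennreal_mult_less_top)
    also have "\<dots> = (LINT x|lborel. (\<phi> x - \<phi> (x - e)) *\<^sub>R f x)"
      by (simp add: test_fun_FTC[OF \<phi>])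
    finally have 1: "(LINT t:{0..1}|lborel. (LINT x|lborel. pd \<phi> e (x - t *\<^sub>R e) *\<^sub>R f x))
      = (LINT x|lborel. (\<phi> x - \<phi> (x - e)) *\<^sub>R f x)" .
    \<comment> \<open>The segments from \<open>V\<close> stay in \<open>U\<close>, so every
      translate of the test function by \<open>t e\<close> is admissible in
      \<open>w\<close>.\<close>
    have 2: "(LINT x|lborel. pd \<phi> e (x - t *\<^sub>R e) *\<^sub>R f x) = - (LINT y|lborel. \<phi> y *\<^sub>R g (y + t *\<^sub>R e))"
      if "t \<in> {0..1}" for t
    proof -
      have t: "test_fun U (\<lambda>x. \<phi> (x - t *\<^sub>R e))"
        by (rule test_fun_translate[OF \<phi>]) (use seg that in auto)
      have "(LINT x|lborel. pd \<phi> e (x - t *\<^sub>R e) *\<^sub>R f x) = - (LINT x|lborel. \<phi> (x - t *\<^sub>R e) *\<^sub>R g x)"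
        using w[OF t] by (simp add: pd_translate[OF \<phi>])
      also have "(LINT x|lborel. \<phi> (x - t *\<^sub>R e) *\<^sub>R g x) = (LINT y|lborel. \<phi> y *\<^sub>R g (y + t *\<^sub>R e))"
        using integral_lborel_translate[of "\<lambda>x. \<phi> (x - t *\<^sub>R e) *\<^sub>R g x" "t *\<^sub>R e"] by simp
      finally show ?thesis .
    qed
    have "(LINT t:{0..1}|lborel. (LINT y|lborel. \<phi> y *\<^sub>R g (y + t *\<^sub>R e)))
      = (LINT y|lborel. (LINT t:{0..1}|lborel. \<phi> y *\<^sub>R g (y + t *\<^sub>R e)))"
      using Fubini_strip(1)[of "\<lambda>(t, y). \<phi> y *\<^sub>R g (y + t *\<^sub>R e)" "ennreal B * (\<integral>\<^sup>+x. norm (g x) \<partial>lborel)"]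
        nn_integral_norm_scaleR_le[of \<phi> B "\<lambda>y. g (y + _ *\<^sub>R e)" lborel] B fin
      by (simp add: ennreal_mult_less_top gt)
    also have "\<dots> = (LINT y|lborel. \<phi> y *\<^sub>R J y)" by (simp add: J_def)
    finally have 3: "(LINT t:{0..1}|lborel. (LINT y|lborel. \<phi> y *\<^sub>R g (y + t *\<^sub>R e))) = (LINT y|lborel. \<phi> y *\<^sub>R J y)" .
    have 4: "(LINT x|lborel. (\<phi> x - \<phi> (x - e)) *\<^sub>R f x) = - (LINT y|lborel. \<phi> y *\<^sub>R J y)"
    proof -
      have "(LINT x|lborel. (\<phi> x - \<phi> (x - e)) *\<^sub>R f x)
          = (LINT t:{0..1}|lborel. - (LINT y|lborel. \<phi> y *\<^sub>R g (y + t *\<^sub>R e)))"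
        unfolding 1[symmetric] by (rule set_lebesgue_integral_cong) (use 2 in auto)
      also have "\<dots> = - (LINT y|lborel. \<phi> y *\<^sub>R J y)"
        unfolding 3[symmetric] by (simp add: set_lebesgue_integral_def)
      finally show ?thesis .
    qed
    have i1: "integrable lborel (\<lambda>x. \<phi> x *\<^sub>R f x)" by (rule test_fun_lborel_integrable[OF \<phi> f])
    have i2: "integrable lborel (\<lambda>x. \<phi> (x - e) *\<^sub>R f x)"
      using B by (intro integrable_bounded_scaleR[OF f, of _ B]) auto
    have "(LINT x|lborel. (\<phi> x - \<phi> (x - e)) *\<^sub>R f x) = (LINT x|lborel. \<phi> x *\<^sub>R f x) - (LINT x|lborel. \<phi> (x - e) *\<^sub>R f x)"
      using i1 i2 by (simp add: scaleR_diff_left)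
    also have "(LINT x|lborel. \<phi> (x - e) *\<^sub>R f x) = (LINT y|lborel. \<phi> y *\<^sub>R f (y + e))"
      using integral_lborel_translate[of "\<lambda>x. \<phi> (x - e) *\<^sub>R f x" e] by simp
    finally have "(LINT x|lborel. \<phi> x *\<^sub>R f x) - (LINT y|lborel. \<phi> y *\<^sub>R f (y + e)) = - (LINT y|lborel. \<phi> y *\<^sub>R J y)"
      unfolding 4 by (rule sym)
    moreover have "a - b = - j \<Longrightarrow> b - a = j" for a b j :: "real^'m" by (metis minus_diff_eq minus_minus)
    ultimately have 5: "(LINT y|lborel. \<phi> y *\<^sub>R f (y + e)) - (LINT x|lborel. \<phi> x *\<^sub>R f x) = (LINT y|lborel. \<phi> y *\<^sub>R J y)"
      by blast
    have "(LINT y|lborel. \<phi> y *\<^sub>R H y) = (LINT y|lborel. \<phi> y *\<^sub>R f (y + e)) - (LINT x|lborel. \<phi> x *\<^sub>R f x) - (LINT y|lborel. \<phi> y *\<^sub>R J y)"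
      unfolding H_def scaleR_diff_right
      using test_fun_lborel_integrable[OF \<phi> integrable_lborel_translate[OF f]] test_fun_lborel_integrable[OF \<phi> J] i1
      by simp
    then show ?thesis using 5 by simp
  qed
  have "AE y in lebesgue. y \<in> V \<longrightarrow> H y = 0"
  proof (rule fundamental_lemma[OF V])
    have HL: "integrable lebesgue H" using H by (simp add: integrable_completion)
    show "loc_integrable V H"
      unfolding loc_integrable_def set_integrable_def
      using integrable_mult_indicator[OF _ HL] by (auto simp: compact_imp_closed borel_closed)
    fix n and a b :: "real^'n" assume ab: "cbox a b \<subseteq> V"
    have "indicator V x *\<^sub>R bump n a b x *\<^sub>R H x = bump n a b x *\<^sub>R H x" for x
      using bump_eq_0[of x a b n] box_subset_cbox[of a b] ab by (cases "x \<in> V") auto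
    then have "(LINT x:V|lebesgue. bump n a b x *\<^sub>R H x) = (LINT x|lebesgue. bump n a b x *\<^sub>R H x)"
      by (simp only: set_lebesgue_integral_def)
    also have "\<dots> = (LINT x|lborel. bump n a b x *\<^sub>R H x)"
      using test_fun_lborel_integrable[OF test_fun_bump[OF ab, of n] H] by (intro integral_completion) auto
    finally show "(LINT x:V|lebesgue. bump n a b x *\<^sub>R H x) = 0"
      using H0[OF test_fun_bump[OF ab]] by simp
  qed
  then show ?thesis by (simp add: AE_completion_iff H_def J_def)
qed

section \<open>Weak derivatives of constants and of smooth fields\<close>

lemma test_fun_integrable_lborel:
  fixes \<psi> :: "real^'n \<Rightarrow> real"
  assumes "test_fun U \<psi>"
  shows "integrable lborel \<psi>"
proof -
  let ?K = "closure {x. \<psi> x \<noteq> 0}"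
  have "compact ?K" using assms by (simp add: test_fun_def)
  then have "integrable lborel (indicator ?K :: _ \<Rightarrow> real)"
    using emeasure_bounded_finite[OF compact_imp_bounded[of ?K]] by (simp add: integrable_indicator_iff)
  then have "integrable lborel (\<lambda>x. \<psi> x *\<^sub>R (indicator ?K x :: real))"
    by (rule test_fun_lborel_integrable[OF assms])
  moreover have "\<psi> x *\<^sub>R (indicator ?K x :: real) = \<psi> x" for x
    using test_fun_outside[OF assms, of x] by (cases "x \<in> ?K") auto
  ultimately show ?thesis by (simp only:)
qed

text \<open>Averaging over translates leaves the integral unchanged and replaces the derivative by
  \<open>\<phi> x - \<phi> (x - e)\<close>, which integrates to zero by translation invariance. No
  integration by coordinates is involved.\<close>

lemma integral_pd_test_fun:
  fixes \<phi> :: "real^'n \<Rightarrow> real"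
  assumes \<phi>: "test_fun U \<phi>"
  shows "(LINT x|lborel. pd \<phi> e x) = 0"
proof -
  note [measurable] = test_fun_borel[OF \<phi>] test_fun_borel[OF test_fun_pd[OF \<phi>]]
  note int = test_fun_integrable_lborel
  have fin: "(\<integral>\<^sup>+x. norm (pd \<phi> e x) \<partial>lborel) < \<infinity>"
    using int[OF test_fun_pd[OF \<phi>]] by (simp add: integrable_iff_bounded)
  have tr: "(\<integral>\<^sup>+x. norm (pd \<phi> e (x - t *\<^sub>R e)) \<partial>lborel) = (\<integral>\<^sup>+x. norm (pd \<phi> e x) \<partial>lborel)" for t
    using nn_integral_lborel_translate[of "\<lambda>x. norm (pd \<phi> e x)" "- t *\<^sub>R e"] by simp
  have tr': "(LINT x|lborel. pd \<phi> e (x - t *\<^sub>R e)) = (LINT x|lborel. pd \<phi> e x)" for t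
    using integral_lborel_translate[of "\<lambda>x. pd \<phi> e x" "- t *\<^sub>R e"] by simp
  have "(LINT x|lborel. pd \<phi> e x) = (LINT t:{0..1::real}|lborel. (LINT x|lborel. pd \<phi> e (x - t *\<^sub>R e)))"
    unfolding tr' by (simp add: set_lebesgue_integral_def)
  also have "\<dots> = (LINT x|lborel. (LINT t:{0..1}|lborel. pd \<phi> e (x - t *\<^sub>R e)))"
    using Fubini_strip(1)[of "\<lambda>(t, x). pd \<phi> e (x - t *\<^sub>R e)" "\<integral>\<^sup>+x. norm (pd \<phi> e x) \<partial>lborel"] fin tr
    by simp
  also have "\<dots> = (LINT x|lborel. \<phi> x - \<phi> (x - e))"
    using test_fun_FTC[OF \<phi>, of e _ "1::real"] by simp
  also have "\<dots> = (LINT x|lborel. \<phi> x) - (LINT x|lborel. \<phi> (x - e))"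
    using int[OF \<phi>] integrable_lborel_translate[OF int[OF \<phi>], of "- e"] by simp
  also have "\<dots> = 0"
    using integral_lborel_translate[of \<phi> "- e"] by simp
  finally show ?thesis .
qed

lemma weak_partial_const:
  fixes U :: "(real^'n) set" and c :: "real^'m"
  shows "weak_partial U (\<lambda>x. c) i (\<lambda>x. 0)"
  unfolding weak_partial_def
proof (intro conjI allI impI loc_integrable_const)
  fix \<phi> :: "real^'n \<Rightarrow> real" assume \<phi>: "test_fun U \<phi>"
  have "indicator U x *\<^sub>R pd \<phi> (axis i 1) x *\<^sub>R c = pd \<phi> (axis i 1) x *\<^sub>R c" for x
  proof (cases "x \<in> U")
    case False
    then have "x \<notin> closure {x. pd \<phi> (axis i 1) x \<noteq> 0}"
      using test_fun_pd[OF \<phi>, of "axis i 1"] by (auto simp: test_fun_def)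
    then show ?thesis using test_fun_outside[OF test_fun_pd[OF \<phi>, of "axis i 1"], of x] by simp
  qed simp
  then have "(LINT x:U|lebesgue. pd \<phi> (axis i 1) x *\<^sub>R c) = (LINT x|lebesgue. pd \<phi> (axis i 1) x *\<^sub>R c)"
    by (simp only: set_lebesgue_integral_def)
  also have "\<dots> = (LINT x|lborel. pd \<phi> (axis i 1) x *\<^sub>R c)"
    using test_fun_borel[OF test_fun_pd[OF \<phi>, of "axis i 1"]] by (intro integral_completion) simp
  also have "\<dots> = 0"
    using integral_pd_test_fun[OF \<phi>, of "axis i 1"]
      integral_scaleR_left[of c lborel "\<lambda>x. pd \<phi> (axis i 1) x"]
      test_fun_integrable_lborel[OF test_fun_pd[OF \<phi>, of "axis i 1"]] by simp
  finally show "(LINT x:U|lebesgue. pd \<phi> (axis i 1) x *\<^sub>R c) = - (LINT x:U|lebesgue. \<phi> x *\<^sub>R 0)"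
    by (simp add: set_lebesgue_integral_def)
qed

text \<open>A smooth field is its own product with the constant 1 of \<open>real^1\<close>, so the
  Leibniz rule applied to a constant gives the claim.\<close>

lemma weak_partial_smooth:
  fixes a :: "real^'n \<Rightarrow> real^'m"
  assumes U: "open U" and a: "Cinf_on U a"
  shows "weak_partial U a i (\<lambda>x. pd a (axis i 1) x)"
proof -
  have B: "bounded_bilinear (\<lambda>(v::real^'m) (r::real^1). r $ 1 *\<^sub>R v)"
    by (rule bounded_bilinear.flip[OF bounded_bilinear.comp1[OF bounded_bilinear_scaleR bounded_linear_vec_nth]])
  show ?thesis
    using weak_partial_bilinear[OF U B a weak_partial_const[of U "1::real^1" i]] by simp
qed

section \<open>The Poincare inequality on Lipschitz domains\<close>

text \<open>Global Borel functions are used so that translations and Fubini apply directly, while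
  the test functions see only \<open>U\<close>. All directions \<open>e\<close> are included because
  increments are taken along arbitrary segments. The gradient energy may be infinite.\<close>

definition borel_sobolev :: "(real^'n) set \<Rightarrow> (real^'n \<Rightarrow> real^'m) \<Rightarrow> ('n \<Rightarrow> real^'n \<Rightarrow> real^'m) \<Rightarrow> bool" where
  "borel_sobolev U f g \<longleftrightarrow> integrable lborel f \<and> (\<forall>i. integrable lborel (g i)) \<and>
     (\<forall>\<phi> e. test_fun U \<phi> \<longrightarrow>
       (LINT x|lborel. pd \<phi> e x *\<^sub>R f x) = - (LINT x|lborel. \<phi> x *\<^sub>R (\<Sum>i\<in>UNIV. e $ i *\<^sub>R g i x)))"

definition grad_energy :: "('n::finite \<Rightarrow> real^'n \<Rightarrow> real^'m) \<Rightarrow> ennreal" where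
  "grad_energy g = (\<integral>\<^sup>+x. ennreal (\<Sum>i\<in>UNIV. (norm (g i x))\<^sup>2) \<partial>lborel)"

text \<open>Cauchy-Schwarz against 1 on the unit interval. If \<open>g\<close> is not integrable
  there, its integral is 0 by convention and the bound is trivial.\<close>

lemma nn_integral_norm_Icc_le:
  fixes g :: "real \<Rightarrow> real^'m"
  assumes [measurable]: "g \<in> borel_measurable borel"
  shows "ennreal ((norm (LINT t:{0..1}|lborel. g t))\<^sup>2) \<le> (\<integral>\<^sup>+t. indicator {0..1} t * ennreal ((norm (g t))\<^sup>2) \<partial>lborel)"
proof (cases "set_integrable lborel {0..1} g")
  case False
  then show ?thesis by (simp add: set_lebesgue_integral_def set_integrable_def not_integrable_integral_eq)
next
  case True
  have "ennreal (norm (LINT t:{0..1}|lborel. g t)) \<le> (\<integral>\<^sup>+t. norm (indicator {0..1} t *\<^sub>R g t) \<partial>lborel)"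
    using True unfolding set_lebesgue_integral_def set_integrable_def by (rule integral_norm_bound_ennreal)
  also have "\<dots> = (\<integral>\<^sup>+t. (indicator {0..1} t * ennreal (norm (g t))) * indicator {0..1} t \<partial>lborel)"
    by (intro nn_integral_cong) (auto simp: indicator_def)
  finally have "(ennreal (norm (LINT t:{0..1}|lborel. g t)))\<^sup>2
      \<le> (\<integral>\<^sup>+t. (indicator {0..1} t * ennreal (norm (g t))) * indicator {0..1} t \<partial>lborel)\<^sup>2"
    by (rule power_mono) simp
  also have "\<dots> \<le> (\<integral>\<^sup>+t. (indicator {0..1} t * ennreal (norm (g t)))\<^sup>2 \<partial>lborel) * (\<integral>\<^sup>+t. (indicator {0..1::real} t)\<^sup>2 \<partial>lborel)"
    by (rule Cauchy_Schwarz_nn_integral) auto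
  also have "(\<integral>\<^sup>+t. (indicator {0..1::real} t :: ennreal)\<^sup>2 \<partial>lborel) = (\<integral>\<^sup>+t. indicator {0..1::real} t \<partial>lborel)"
    by (intro nn_integral_cong) (auto simp: indicator_def)
  also have "\<dots> = 1" by simp
  also have "(\<integral>\<^sup>+t. (indicator {0..1} t * ennreal (norm (g t)))\<^sup>2 \<partial>lborel)
      = (\<integral>\<^sup>+t. indicator {0..1} t * ennreal ((norm (g t))\<^sup>2) \<partial>lborel)"
    by (intro nn_integral_cong) (auto simp: indicator_def ennreal_power)
  finally show ?thesis by (simp add: ennreal_power)
qed

lemma norm_sum_coordinates_le:
  fixes v :: "'n::finite \<Rightarrow> real^'m" and e :: "real^'n"
  shows "(norm (\<Sum>i\<in>UNIV. e $ i *\<^sub>R v i))\<^sup>2 \<le> (norm e)\<^sup>2 * (\<Sum>i\<in>UNIV. (norm (v i))\<^sup>2)"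
proof -
  have "norm (\<Sum>i\<in>UNIV. e $ i *\<^sub>R v i) \<le> (\<Sum>i\<in>UNIV. \<bar>e $ i\<bar> * norm (v i))"
    by (rule order_trans[OF norm_sum]) simp
  then have "(norm (\<Sum>i\<in>UNIV. e $ i *\<^sub>R v i))\<^sup>2 \<le> (\<Sum>i\<in>UNIV. \<bar>e $ i\<bar> * norm (v i))\<^sup>2"
    by (rule power_mono) simp
  also have "\<dots> \<le> (\<Sum>i\<in>UNIV. \<bar>e $ i\<bar>\<^sup>2) * (\<Sum>i\<in>UNIV. (norm (v i))\<^sup>2)"
    by (rule Cauchy_Schwarz_ineq_sum)
  also have "(\<Sum>i\<in>UNIV. \<bar>e $ i\<bar>\<^sup>2) = (norm e)\<^sup>2"
    by (simp add: norm_vec_def L2_set_def sum_nonneg)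
  finally show ?thesis .
qed

text \<open>The increment is an average of directional derivatives along the segment. After
  Cauchy-Schwarz and Fubini each slice in \<open>t\<close> is a translate and contributes at most
  |e|^2 times the whole gradient energy.\<close>

lemma increment_energy_le:
  fixes f :: "real^'n \<Rightarrow> real^'m"
  assumes V: "open V" and seg: "\<And>y t. y \<in> V \<Longrightarrow> t \<in> {0..1} \<Longrightarrow> y + t *\<^sub>R e \<in> U"
    and fg: "borel_sobolev U f g"
  shows "(\<integral>\<^sup>+y. indicator V y * ennreal ((norm (f (y + e) - f y))\<^sup>2) \<partial>lborel) \<le> ennreal ((norm e)\<^sup>2) * grad_energy g"
proof -
  let ?G = "\<lambda>x. \<Sum>i\<in>UNIV. e $ i *\<^sub>R g i x"
  have f: "integrable lborel f" and gi: "\<And>i. integrable lborel (g i)" using fg by (auto simp: borel_sobolev_def)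
  have [measurable]: "g i \<in> borel_measurable borel" for i using borel_measurable_integrable[OF gi] by simp
  have "AE y in lborel. y \<in> V \<longrightarrow> f (y + e) - f y = (LINT t:{0..1}|lborel. ?G (y + t *\<^sub>R e))"
    using fg f gi by (intro weak_derivative_increment[OF V seg]) (auto simp: borel_sobolev_def)
  then have "(\<integral>\<^sup>+y. indicator V y * ennreal ((norm (f (y + e) - f y))\<^sup>2) \<partial>lborel)
      \<le> (\<integral>\<^sup>+y. (\<integral>\<^sup>+t. indicator {0..1} t * ennreal ((norm (?G (y + t *\<^sub>R e)))\<^sup>2) \<partial>lborel) \<partial>lborel)"
  proof (intro nn_integral_mono_AE, eventually_elim)
    fix y assume "y \<in> V \<longrightarrow> f (y + e) - f y = (LINT t:{0..1}|lborel. ?G (y + t *\<^sub>R e))"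
    then show "indicator V y * ennreal ((norm (f (y + e) - f y))\<^sup>2)
        \<le> (\<integral>\<^sup>+t. indicator {0..1} t * ennreal ((norm (?G (y + t *\<^sub>R e)))\<^sup>2) \<partial>lborel)"
      using nn_integral_norm_Icc_le[of "\<lambda>t. ?G (y + t *\<^sub>R e)"] by (cases "y \<in> V") auto
  qed
  also have "\<dots> = (\<integral>\<^sup>+t. (\<integral>\<^sup>+y. indicator {0..1} t * ennreal ((norm (?G (y + t *\<^sub>R e)))\<^sup>2) \<partial>lborel) \<partial>lborel)"
    by (rule lborel_pair.Fubini') measurable
  also have "\<dots> = (\<integral>\<^sup>+t. indicator {0..1::real} t * (\<integral>\<^sup>+x. ennreal ((norm (?G x))\<^sup>2) \<partial>lborel) \<partial>lborel)"
  proof (intro nn_integral_cong)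
    fix t :: real
    have "(\<integral>\<^sup>+y. indicator {0..1} t * ennreal ((norm (?G (y + t *\<^sub>R e)))\<^sup>2) \<partial>lborel)
      = indicator {0..1} t * (\<integral>\<^sup>+y. ennreal ((norm (?G (y + t *\<^sub>R e)))\<^sup>2) \<partial>lborel)"
      by (rule nn_integral_cmult) measurable
    then show "(\<integral>\<^sup>+y. indicator {0..1} t * ennreal ((norm (?G (y + t *\<^sub>R e)))\<^sup>2) \<partial>lborel)
      = indicator {0..1} t * (\<integral>\<^sup>+x. ennreal ((norm (?G x))\<^sup>2) \<partial>lborel)"
      using nn_integral_lborel_translate[of "\<lambda>x. ennreal ((norm (?G x))\<^sup>2)" "t *\<^sub>R e"] by simp
  qed
  also have "\<dots> = (\<integral>\<^sup>+x. ennreal ((norm (?G x))\<^sup>2) \<partial>lborel)"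
    by (simp add: nn_integral_multc)
  also have "\<dots> \<le> (\<integral>\<^sup>+x. ennreal ((norm e)\<^sup>2) * ennreal (\<Sum>i\<in>UNIV. (norm (g i x))\<^sup>2) \<partial>lborel)"
    by (intro nn_integral_mono) (simp add: ennreal_mult[symmetric] sum_nonneg norm_sum_coordinates_le ennreal_leI)
  also have "\<dots> = ennreal ((norm e)\<^sup>2) * grad_energy g"
    unfolding grad_energy_def by (rule nn_integral_cmult) measurable
  finally show ?thesis .
qed

text \<open>The right-hand side involves the gradient on all of \<open>U\<close>; this makes the property stable
  under translating \<open>A\<close> inside \<open>U\<close> and under gluing.\<close>

definition rel_poincare :: "(real^2) set \<Rightarrow> (real^2) set \<Rightarrow> bool" where
  "rel_poincare U A \<longleftrightarrow> (\<exists>C::real. C \<ge> 0 \<and> (\<forall>(f::real^2 \<Rightarrow> real^3) g. borel_sobolev U f g \<longrightarrow>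
     (\<exists>c. (\<integral>\<^sup>+x. indicator A x * ennreal ((norm (f x - c))\<^sup>2) \<partial>lborel) \<le> ennreal C * grad_energy g)))"

section \<open>Local Poincare inequalities and their gluing\<close>

lemma emeasure_lborel_bounded_eq_measure:
  "bounded A \<Longrightarrow> emeasure lborel A = ennreal (measure lborel A)"
  using emeasure_bounded_finite[of A] by (intro emeasure_eq_ennreal_measure) (auto simp: less_top[symmetric])

lemma norm_diff_sq_le:
  fixes a b :: "'a::real_normed_vector"
  shows "(norm (a - c))\<^sup>2 \<le> 2 * (norm (a - b))\<^sup>2 + 2 * (norm (b - c))\<^sup>2"
proof -
  have "norm (a - c) \<le> norm (a - b) + norm (b - c)" using norm_triangle_ineq[of "a - b" "b - c"] by simp
  then have "(norm (a - c))\<^sup>2 \<le> (norm (a - b) + norm (b - c))\<^sup>2" by (rule power_mono) simp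
  also have "\<dots> \<le> 2 * (norm (a - b))\<^sup>2 + 2 * (norm (b - c))\<^sup>2"
    using sum_squares_bound[of "norm (a - b)" "norm (b - c)"] by (simp add: power2_sum)
  finally show ?thesis .
qed

lemma ennreal_norm_diff_sq_le:
  fixes a b :: "'a::real_normed_vector"
  shows "ennreal ((norm (a - c))\<^sup>2) \<le> 2 * ennreal ((norm (a - b))\<^sup>2) + 2 * ennreal ((norm (b - c))\<^sup>2)"
proof -
  have "ennreal ((norm (a - c))\<^sup>2) \<le> ennreal (2 * (norm (a - b))\<^sup>2 + 2 * (norm (b - c))\<^sup>2)"
    by (rule ennreal_leI[OF norm_diff_sq_le])
  then show ?thesis by (simp add: ennreal_mult)
qed

text \<open>If every constant failed, so would every value f(y) with y in the ball. Integrating over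
  y bounds the double integral of |f(x) - f(y)|^2 from below by C m E, where E is the gradient
  energy; in the variable v = x - y the increment estimate bounds it from above by 4 r^2 M E. Mean
  values of \<open>f\<close> are thereby avoided.\<close>

lemma rel_poincare_ball:
  assumes r: "r > 0" and sub: "ball z r \<subseteq> U"
  shows "rel_poincare U (ball z r)"
proof -
  let ?B = "ball z r"
  define m where "m = measure lborel ?B"
  define M where "M = measure lborel (ball (0::real^2) (2 * r))"
  have em: "emeasure lborel ?B = ennreal m" and eM: "emeasure lborel (ball (0::real^2) (2 * r)) = ennreal M"
    unfolding m_def M_def by (auto intro!: emeasure_lborel_bounded_eq_measure)
  have m: "m > 0" using content_ball_pos[OF r, of z] by (simp add: m_def)
  have M: "M \<ge> 0" by (simp add: M_def)
  \<comment> \<open>The summand 1 makes C m strictly larger than 4 r^2 M, the constant of the upper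
    bound.\<close>
  define C where "C = (4 * r\<^sup>2 * M + 1) / m"
  have C: "C > 0" unfolding C_def using M m by (auto intro!: divide_pos_pos add_nonneg_pos)
  have "\<exists>c. (\<integral>\<^sup>+x. indicator ?B x * ennreal ((norm (f x - c))\<^sup>2) \<partial>lborel) \<le> ennreal C * grad_energy g"
    if fg: "borel_sobolev U f g" for f :: "real^2 \<Rightarrow> real^3" and g
  proof (rule ccontr)
    assume no: "\<not> ?thesis"
    have [measurable]: "f \<in> borel_measurable borel" "?B \<in> sets borel" using fg by (auto simp: borel_sobolev_def)
    define I where "I c = (\<integral>\<^sup>+x. indicator ?B x * ennreal ((norm (f x - c))\<^sup>2) \<partial>lborel)" for c
    have big: "ennreal C * grad_energy g < I c" for c using no by (auto simp: I_def not_le)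
    \<comment> \<open>An infinite energy would leave no room for the strict inequality
      \<open>big\<close>.\<close>
    have E: "grad_energy g < \<infinity>"
      using big[of 0] C by (cases "grad_energy g") (auto simp: ennreal_mult_top)
    have inner: "(\<integral>\<^sup>+y. indicator ?B y * (indicator ?B (y + v) * ennreal ((norm (f (y + v) - f y))\<^sup>2)) \<partial>lborel)
        \<le> ennreal (4 * r\<^sup>2) * grad_energy g * indicator (ball 0 (2 * r)) v" for v
    proof -
      \<comment> \<open>Both end points of the segment are kept in the ball, so convexity keeps the
        segment there.\<close>
      let ?V = "?B \<inter> {y. y + v \<in> ?B}"
      have "open {y. y + v \<in> ?B}"
        using open_vimage[OF open_ball[of z r], of "\<lambda>y. y + v"] by (simp add: vimage_def continuous_intros)
      then have V: "open ?V" by auto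
      have seg: "y + t *\<^sub>R v \<in> U" if "y \<in> ?V" "t \<in> {0..1}" for y t
      proof -
        have "(1 - t) *\<^sub>R y + t *\<^sub>R (y + v) \<in> ?B"
          using that convex_ball[of z r] by (intro convexD) auto
        moreover have "(1 - t) *\<^sub>R y + t *\<^sub>R (y + v) = y + t *\<^sub>R v" by (simp add: algebra_simps)
        ultimately show ?thesis using sub by auto
      qed
      show ?thesis
      proof (cases "norm v < 2 * r")
        case True
        have "(\<integral>\<^sup>+y. indicator ?B y * (indicator ?B (y + v) * ennreal ((norm (f (y + v) - f y))\<^sup>2)) \<partial>lborel)
          = (\<integral>\<^sup>+y. indicator ?V y * ennreal ((norm (f (y + v) - f y))\<^sup>2) \<partial>lborel)"
          by (intro nn_integral_cong) (auto simp: indicator_def)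
        also have "\<dots> \<le> ennreal ((norm v)\<^sup>2) * grad_energy g"
          by (rule increment_energy_le[OF V seg fg])
        also have "\<dots> \<le> ennreal (4 * r\<^sup>2) * grad_energy g"
          using power_mono[of "norm v" "2 * r" 2] True by (intro mult_right_mono ennreal_leI) (auto simp: power_mult_distrib)
        finally show ?thesis using True by simp
      next
        case False
        have "\<not> (y \<in> ?B \<and> y + v \<in> ?B)" for y
          using False norm_triangle_ineq4[of "y + v - z" "y - z"] by (auto simp: dist_norm norm_minus_commute)
        then have "indicator ?B y * (indicator ?B (y + v) * ennreal ((norm (f (y + v) - f y))\<^sup>2)) = 0" for y
          by (auto simp: indicator_def)
        then show ?thesis by (simp only: nn_integral_const mult_zero_left zero_le)
      qed
    qed
    have "(\<integral>\<^sup>+y. indicator ?B y * I (f y) \<partial>lborel)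
        = (\<integral>\<^sup>+y. (\<integral>\<^sup>+v. indicator ?B y * (indicator ?B (y + v) * ennreal ((norm (f (y + v) - f y))\<^sup>2)) \<partial>lborel) \<partial>lborel)"
    proof (intro nn_integral_cong)
      fix y
      have "I (f y) = (\<integral>\<^sup>+v. indicator ?B (v + y) * ennreal ((norm (f (v + y) - f y))\<^sup>2) \<partial>lborel)"
        unfolding I_def
        by (rule nn_integral_lborel_translate[of "\<lambda>x. indicator ?B x * ennreal ((norm (f x - f y))\<^sup>2)" y, symmetric]) measurable
      then show "indicator ?B y * I (f y)
        = (\<integral>\<^sup>+v. indicator ?B y * (indicator ?B (y + v) * ennreal ((norm (f (y + v) - f y))\<^sup>2)) \<partial>lborel)"
        by (simp add: nn_integral_cmult add.commute)
    qed
    also have "\<dots> = (\<integral>\<^sup>+v. (\<integral>\<^sup>+y. indicator ?B y * (indicator ?B (y + v) * ennreal ((norm (f (y + v) - f y))\<^sup>2)) \<partial>lborel) \<partial>lborel)"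
      by (rule lborel_pair.Fubini') measurable
    also have "\<dots> \<le> (\<integral>\<^sup>+v. ennreal (4 * r\<^sup>2) * grad_energy g * indicator (ball 0 (2 * r)) (v::real^2) \<partial>lborel)"
      by (intro nn_integral_mono inner)
    also have "\<dots> = ennreal (4 * r\<^sup>2) * grad_energy g * ennreal M"
      by (simp add: nn_integral_cmult_indicator eM)
    finally have T: "(\<integral>\<^sup>+y. indicator ?B y * I (f y) \<partial>lborel) \<le> ennreal (4 * r\<^sup>2) * grad_energy g * ennreal M" .
    have Im: "(\<lambda>y. indicator ?B y * I (f y)) \<in> borel_measurable lborel"
      unfolding I_def by measurable
    show False
    \<comment> \<open>With zero energy the two bounds do not contradict each other; there the
      strictness of \<open>big\<close> does, since it makes the inner integral positive at every
      point of the ball.\<close>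
    proof (cases "grad_energy g = 0")
      case True
      then have "(\<integral>\<^sup>+y. indicator ?B y * I (f y) \<partial>lborel) = 0" using T by simp
      then have "AE y in lborel. indicator ?B y * I (f y) = 0"
        using nn_integral_0_iff_AE[OF Im] by simp
      then have "AE y in lborel. y \<notin> ?B"
      proof eventually_elim
        fix y assume "indicator ?B y * I (f y) = 0"
        moreover have "I (f y) \<noteq> 0" using big[of "f y"] by auto
        ultimately show "y \<notin> ?B" by auto
      qed
      then have "emeasure lborel ?B = 0"
        by (subst (asm) AE_iff_measurable[OF _ refl]) (auto simp: ball_def)
      then show False using em m by simp
    next
      case False
      obtain E where E': "grad_energy g = ennreal E" "E > 0"
        using E False by (cases "grad_energy g") (auto simp: less_le)
      have "(\<integral>\<^sup>+y. ennreal C * grad_energy g * indicator ?B y \<partial>lborel) \<le> (\<integral>\<^sup>+y. indicator ?B y * I (f y) \<partial>lborel)"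
        using big by (intro nn_integral_mono) (auto simp: indicator_def less_imp_le)
      then have "ennreal C * grad_energy g * ennreal m \<le> ennreal (4 * r\<^sup>2) * grad_energy g * ennreal M"
        using T by (simp add: nn_integral_cmult_indicator em)
      then have "ennreal (C * E * m) \<le> ennreal (4 * r\<^sup>2 * E * M)"
        using E' C m M by (simp add: ennreal_mult)
      then have "C * E * m \<le> 4 * r\<^sup>2 * E * M"
        using E' M r by (subst (asm) ennreal_le_iff) (auto intro!: mult_nonneg_nonneg)
      then have "E * (C * m) \<le> E * (4 * r\<^sup>2 * M)" by (simp only: mult_ac)
      then have "C * m \<le> 4 * r\<^sup>2 * M" using E'(2) by simp
      moreover have "C * m = 4 * r\<^sup>2 * M + 1" using m by (simp add: C_def)
      ultimately show False by simp
    qed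
  qed
  then show ?thesis unfolding rel_poincare_def using C by (intro exI[of _ C]) auto
qed

text \<open>On \<open>A\<close> the function is compared with its translate by \<open>e\<close>: the
  difference is an increment along segments inside \<open>U\<close>, and the translate is a function
  on \<open>B\<close>, where a constant is available.\<close>

lemma rel_poincare_translate:
  assumes A: "open A" and seg: "\<And>y t. y \<in> A \<Longrightarrow> t \<in> {0..1} \<Longrightarrow> y + t *\<^sub>R e \<in> U"
    and B: "rel_poincare U B" "open B" and AB: "\<And>y. y \<in> A \<Longrightarrow> y + e \<in> B"
  shows "rel_poincare U A"
proof -
  obtain C where C: "C \<ge> 0" "\<And>(f::real^2 \<Rightarrow> real^3) g. borel_sobolev U f g \<Longrightarrow>
     (\<exists>c. (\<integral>\<^sup>+x. indicator B x * ennreal ((norm (f x - c))\<^sup>2) \<partial>lborel) \<le> ennreal C * grad_energy g)"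
    using B unfolding rel_poincare_def by blast
  have "\<exists>c. (\<integral>\<^sup>+x. indicator A x * ennreal ((norm (f x - c))\<^sup>2) \<partial>lborel) \<le> ennreal (2 * (norm e)\<^sup>2 + 2 * C) * grad_energy g"
    if fg: "borel_sobolev U f g" for f :: "real^2 \<Rightarrow> real^3" and g
  proof -
    have [measurable]: "f \<in> borel_measurable borel" "A \<in> sets borel" "B \<in> sets borel"
      using fg A B by (auto simp: borel_sobolev_def)
    obtain c where c: "(\<integral>\<^sup>+x. indicator B x * ennreal ((norm (f x - c))\<^sup>2) \<partial>lborel) \<le> ennreal C * grad_energy g"
      using C(2)[OF fg] by blast
    have "(\<integral>\<^sup>+x. indicator A x * ennreal ((norm (f x - c))\<^sup>2) \<partial>lborel)
      \<le> (\<integral>\<^sup>+x. 2 * (indicator A x * ennreal ((norm (f (x + e) - f x))\<^sup>2)) + 2 * (indicator B (x + e) * ennreal ((norm (f (x + e) - c))\<^sup>2)) \<partial>lborel)"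
    proof (intro nn_integral_mono)
      fix x
      show "indicator A x * ennreal ((norm (f x - c))\<^sup>2) \<le> 2 * (indicator A x * ennreal ((norm (f (x + e) - f x))\<^sup>2)) + 2 * (indicator B (x + e) * ennreal ((norm (f (x + e) - c))\<^sup>2))"
        using ennreal_norm_diff_sq_le[of "f x" c "f (x + e)"] AB[of x] by (cases "x \<in> A") (auto simp: norm_minus_commute)
    qed
    also have "\<dots> = 2 * (\<integral>\<^sup>+x. indicator A x * ennreal ((norm (f (x + e) - f x))\<^sup>2) \<partial>lborel)
       + 2 * (\<integral>\<^sup>+x. indicator B (x + e) * ennreal ((norm (f (x + e) - c))\<^sup>2) \<partial>lborel)"
      by (subst nn_integral_add) (auto simp: nn_integral_cmult)
    also have "(\<integral>\<^sup>+x. indicator B (x + e) * ennreal ((norm (f (x + e) - c))\<^sup>2) \<partial>lborel)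
      = (\<integral>\<^sup>+x. indicator B x * ennreal ((norm (f x - c))\<^sup>2) \<partial>lborel)"
      by (rule nn_integral_lborel_translate[of "\<lambda>x. indicator B x * ennreal ((norm (f x - c))\<^sup>2)"]) measurable
    also have "2 * (\<integral>\<^sup>+x. indicator A x * ennreal ((norm (f (x + e) - f x))\<^sup>2) \<partial>lborel)
       + 2 * (\<integral>\<^sup>+x. indicator B x * ennreal ((norm (f x - c))\<^sup>2) \<partial>lborel)
       \<le> 2 * (ennreal ((norm e)\<^sup>2) * grad_energy g) + 2 * (ennreal C * grad_energy g)"
      by (intro add_mono mult_left_mono c increment_energy_le[OF A seg fg]) auto
    also have "\<dots> = ennreal (2 * (norm e)\<^sup>2 + 2 * C) * grad_energy g"
      using C(1) by (simp add: ennreal_mult distrib_right mult.assoc)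
    finally show ?thesis by blast
  qed
  then show ?thesis unfolding rel_poincare_def using C(1) by (intro exI[of _ "2 * (norm e)\<^sup>2 + 2 * C"]) auto
qed

text \<open>The overlap is open and nonempty, hence of positive measure m. There \<open>f\<close> is
  close to both constants a and b, which bounds |a - b|^2 by the energy, so that a serves on
  \<open>B\<close> as well.\<close>

lemma rel_poincare_Un:
  assumes A: "rel_poincare U A" "open A" and B: "rel_poincare U B" "open B" "bounded B"
    and AB: "A \<inter> B \<noteq> {}"
  shows "rel_poincare U (A \<union> B)"
proof -
  obtain CA where CA: "CA \<ge> 0" "\<And>(f::real^2 \<Rightarrow> real^3) g. borel_sobolev U f g \<Longrightarrow>
     (\<exists>c. (\<integral>\<^sup>+x. indicator A x * ennreal ((norm (f x - c))\<^sup>2) \<partial>lborel) \<le> ennreal CA * grad_energy g)"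
    using A unfolding rel_poincare_def by blast
  obtain CB where CB: "CB \<ge> 0" "\<And>(f::real^2 \<Rightarrow> real^3) g. borel_sobolev U f g \<Longrightarrow>
     (\<exists>c. (\<integral>\<^sup>+x. indicator B x * ennreal ((norm (f x - c))\<^sup>2) \<partial>lborel) \<le> ennreal CB * grad_energy g)"
    using B unfolding rel_poincare_def by blast
  define m where "m = measure lborel (A \<inter> B)"
  define M where "M = measure lborel B"
  have [measurable]: "A \<in> sets borel" "B \<in> sets borel" using A B by auto
  have bd: "bounded (A \<inter> B)" using B(3) by (rule bounded_subset) auto
  have em: "emeasure lborel (A \<inter> B) = ennreal m" and eM: "emeasure lborel B = ennreal M"
    unfolding m_def M_def using emeasure_lborel_bounded_eq_measure bd B(3) by blast+
  have m: "m > 0"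
  proof -
    obtain x r where "r > 0" "ball x r \<subseteq> A \<inter> B" using AB A(2) B(2) open_contains_ball[of "A \<inter> B"] by blast
    then have "emeasure lborel (ball x r) \<le> emeasure lborel (A \<inter> B)" by (intro emeasure_mono) auto
    moreover have "emeasure lborel (ball x r) = ennreal (measure lborel (ball x r))"
      by (intro emeasure_lborel_bounded_eq_measure) auto
    moreover have "measure lborel (ball x r) > 0" using content_ball_pos[OF \<open>r > 0\<close>, of x] by simp
    ultimately show ?thesis using em by (metis ennreal_le_iff2 ennreal_eq_0_iff le_zero_eq linorder_not_le)
  qed
  have M: "M \<ge> 0" by (simp add: M_def)
  \<comment> \<open>On \<open>B\<close>, |f - a|^2 <= 2 |f - b|^2 + 2 |a - b|^2, and |a - b|^2 M is
    at most (M/m)(2 CA + 2 CB) times the energy.\<close>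
  define K where "K = CA + 2 * CB + 2 * (M / m) * (2 * CA + 2 * CB)"
  have K: "K \<ge> 0" unfolding K_def using CA CB m M by auto
  have "\<exists>c. (\<integral>\<^sup>+x. indicator (A \<union> B) x * ennreal ((norm (f x - c))\<^sup>2) \<partial>lborel) \<le> ennreal K * grad_energy g"
    if fg: "borel_sobolev U f g" for f :: "real^2 \<Rightarrow> real^3" and g
  proof -
    have [measurable]: "f \<in> borel_measurable borel" using fg by (auto simp: borel_sobolev_def)
    obtain a where a: "(\<integral>\<^sup>+x. indicator A x * ennreal ((norm (f x - a))\<^sup>2) \<partial>lborel) \<le> ennreal CA * grad_energy g"
      using CA(2)[OF fg] by blast
    obtain b where b: "(\<integral>\<^sup>+x. indicator B x * ennreal ((norm (f x - b))\<^sup>2) \<partial>lborel) \<le> ennreal CB * grad_energy g"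
      using CB(2)[OF fg] by blast
    let ?d = "ennreal ((norm (a - b))\<^sup>2)"
    have "?d * ennreal m = (\<integral>\<^sup>+x. ?d * indicator (A \<inter> B) x \<partial>lborel)"
      by (subst nn_integral_cmult_indicator) (auto simp: em)
    also have "\<dots> \<le> (\<integral>\<^sup>+x. 2 * (indicator A x * ennreal ((norm (f x - a))\<^sup>2)) + 2 * (indicator B x * ennreal ((norm (f x - b))\<^sup>2)) \<partial>lborel)"
    proof (intro nn_integral_mono)
      fix x
      show "?d * indicator (A \<inter> B) x \<le> 2 * (indicator A x * ennreal ((norm (f x - a))\<^sup>2)) + 2 * (indicator B x * ennreal ((norm (f x - b))\<^sup>2))"
        using ennreal_norm_diff_sq_le[of a b "f x"] by (auto simp: indicator_def norm_minus_commute)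
    qed
    also have "\<dots> = 2 * (\<integral>\<^sup>+x. indicator A x * ennreal ((norm (f x - a))\<^sup>2) \<partial>lborel)
       + 2 * (\<integral>\<^sup>+x. indicator B x * ennreal ((norm (f x - b))\<^sup>2) \<partial>lborel)"
      by (subst nn_integral_add) (auto simp: nn_integral_cmult)
    also have "\<dots> \<le> 2 * (ennreal CA * grad_energy g) + 2 * (ennreal CB * grad_energy g)"
      by (intro add_mono mult_left_mono a b) auto
    finally have d: "?d * ennreal m \<le> 2 * (ennreal CA * grad_energy g) + 2 * (ennreal CB * grad_energy g)" .
    have "?d * ennreal M = ennreal (M / m) * (?d * ennreal m)"
    proof -
      have "ennreal (M / m) * ennreal m = ennreal M" using m M by (simp add: ennreal_mult[symmetric])
      then show ?thesis by (metis mult.commute mult.left_commute)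
    qed
    also have "\<dots> \<le> ennreal (M / m) * (2 * (ennreal CA * grad_energy g) + 2 * (ennreal CB * grad_energy g))"
      by (intro mult_left_mono d) auto
    finally have dM: "?d * ennreal M \<le> ennreal (M / m) * (2 * (ennreal CA * grad_energy g) + 2 * (ennreal CB * grad_energy g))" .
    have "(\<integral>\<^sup>+x. indicator (A \<union> B) x * ennreal ((norm (f x - a))\<^sup>2) \<partial>lborel)
      \<le> (\<integral>\<^sup>+x. indicator A x * ennreal ((norm (f x - a))\<^sup>2) + (2 * (indicator B x * ennreal ((norm (f x - b))\<^sup>2)) + 2 * ?d * indicator B x) \<partial>lborel)"
    proof (intro nn_integral_mono)
      fix x
      show "indicator (A \<union> B) x * ennreal ((norm (f x - a))\<^sup>2)
        \<le> indicator A x * ennreal ((norm (f x - a))\<^sup>2) + (2 * (indicator B x * ennreal ((norm (f x - b))\<^sup>2)) + 2 * ?d * indicator B x)"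
        using ennreal_norm_diff_sq_le[of "f x" a b] by (cases "x \<in> A") (auto simp: indicator_def norm_minus_commute)
    qed
    also have "\<dots> = (\<integral>\<^sup>+x. indicator A x * ennreal ((norm (f x - a))\<^sup>2) \<partial>lborel)
      + (2 * (\<integral>\<^sup>+x. indicator B x * ennreal ((norm (f x - b))\<^sup>2) \<partial>lborel) + 2 * (?d * ennreal M))"
      by (subst nn_integral_add, simp, simp, subst nn_integral_add, simp, simp)
        (simp add: nn_integral_cmult nn_integral_cmult_indicator eM mult.assoc)
    also have "\<dots> \<le> ennreal CA * grad_energy g + (2 * (ennreal CB * grad_energy g)
       + 2 * (ennreal (M / m) * (2 * (ennreal CA * grad_energy g) + 2 * (ennreal CB * grad_energy g))))"
      by (intro add_mono mult_left_mono a b dM) auto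
    also have "\<dots> = ennreal K * grad_energy g"
    proof -
      have "M / m \<ge> 0" using m M by simp
      then have "ennreal K = ennreal CA + (2 * ennreal CB + 2 * (ennreal (M / m) * (2 * ennreal CA + 2 * ennreal CB)))"
        unfolding K_def using CA(1) CB(1) by (simp add: ennreal_mult add.assoc mult.assoc del: times_divide_eq_left times_divide_eq_right)
      then show ?thesis by (simp add: distrib_right distrib_left mult.assoc)
    qed
    finally show ?thesis by blast
  qed
  then show ?thesis unfolding rel_poincare_def using K by blast
qed

text \<open>In the rotated coordinates \<open>U\<close> is locally the region below a graph. Moving
  straight down keeps points in \<open>U\<close> and carries a neighbourhood of \<open>z\<close>
  into a ball contained in \<open>U\<close>.\<close>

lemma rel_poincare_frontier:
  assumes U: "lipschitz_domain U" and z: "z \<in> frontier U"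
  obtains N where "open N" "z \<in> N" "rel_poincare U (N \<inter> U)"
proof -
  have oU: "open U" using U by (simp add: lipschitz_domain_def)
  obtain r and Q :: "real^2^2" and g L where r: "r > 0" and Q: "orthogonal_matrix Q"
    and g: "L-lipschitz_on UNIV g"
    and eq: "ball z r \<inter> U = {x\<in>ball z r. (Q *v (x - z)) $ 2 < g ((Q *v (x - z)) $ 1)}"
    using U z unfolding lipschitz_domain_def by blast
  have cg: "continuous_on UNIV g" using g by (rule lipschitz_on_continuous_on)
  \<comment> \<open>Otherwise, by continuity, no point near \<open>z\<close> would satisfy the graph
    condition, although \<open>z\<close> is a limit of points of \<open>U\<close>.\<close>
  have g0: "g 0 \<ge> 0"
  proof (rule ccontr)
    assume "\<not> g 0 \<ge> 0"
    let ?F = "\<lambda>x. g ((Q *v (x - z)) $ 1) - (Q *v (x - z)) $ 2"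
    have "continuous_on UNIV ?F"
      by (intro continuous_intros continuous_on_compose2[OF cg] matrix_vector_mult_linear_continuous_on
          continuous_on_compose2[OF matrix_vector_mult_linear_continuous_on[of UNIV Q]]) auto
    then have "open (?F -` {..<0})" by (intro open_vimage) auto
    moreover have "z \<in> ?F -` {..<0}" using \<open>\<not> g 0 \<ge> 0\<close> by simp
    ultimately have "open (ball z r \<inter> ?F -` {..<0})" "z \<in> ball z r \<inter> ?F -` {..<0}" using r by auto
    moreover have "z \<in> closure U" using z by (simp add: frontier_def)
    ultimately have "(ball z r \<inter> ?F -` {..<0}) \<inter> U \<noteq> {}"
      using open_Int_closure_eq_empty[of "ball z r \<inter> ?F -` {..<0}" U] by blast
    then obtain x where "x \<in> U" "x \<in> ball z r" "?F x < 0" by blast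
    moreover from this have "x \<in> {x\<in>ball z r. (Q *v (x - z)) $ 2 < g ((Q *v (x - z)) $ 1)}"
      unfolding eq[symmetric] by blast
    ultimately show False by simp
  qed
  \<comment> \<open>The downward direction; its length r/2 keeps segments that start in
    \<open>ball z (r/2)\<close> inside \<open>ball z r\<close>, where the graph condition describes
    \<open>U\<close>.\<close>
  define e where "e = - (r / 2) *\<^sub>R (transpose Q *v axis 2 1)"
  have Qe: "Q *v e = - (r / 2) *\<^sub>R axis 2 1"
  proof -
    have "Q *v (transpose Q *v axis 2 1) = axis 2 1"
      using Q by (simp only: matrix_vector_mul_assoc orthogonal_matrix_def matrix_vector_mul_lid)
    then show ?thesis unfolding e_def by (simp only: matrix_vector_mult_scaleR)
  qed
  have ne: "norm e = r / 2"
  proof -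
    have "norm (transpose Q *v axis 2 (1::real)) = norm (axis 2 (1::real) :: real^2)"
    proof (rule orthogonal_transformation_norm)
      show "orthogonal_transformation ((*v) (transpose Q))"
        using Q by (simp only: orthogonal_transformation_matrix matrix_of_matrix_vector_mul
            matrix_vector_mul_linear orthogonal_matrix_transpose simp_thms)
    qed
    then show ?thesis using r by (simp add: e_def norm_axis_1)
  qed
  have seg: "x + t *\<^sub>R e \<in> U" if "x \<in> U" "x \<in> ball z (r / 2)" "t \<in> {0..1}" for x t
  proof -
    have "norm (t *\<^sub>R e) \<le> r / 2" using that(3) r mult_left_le_one_le[of "r / 2" t] by (simp add: ne)
    moreover have "norm (x + t *\<^sub>R e - z) \<le> norm (x - z) + norm (t *\<^sub>R e)"
      using norm_triangle_ineq[of "x - z" "t *\<^sub>R e"] by (simp add: algebra_simps)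
    ultimately have b: "x + t *\<^sub>R e \<in> ball z r" using that(2) by (auto simp: dist_norm norm_minus_commute)
    have "x \<in> ball z r" using that(2) r by auto
    then have "x \<in> ball z r \<inter> U" using that(1) by simp
    then have x: "(Q *v (x - z)) $ 2 < g ((Q *v (x - z)) $ 1)" unfolding eq by simp
    have q: "Q *v (x + t *\<^sub>R e - z) = Q *v (x - z) - (t * (r / 2)) *\<^sub>R axis 2 1"
    proof -
      have "x + t *\<^sub>R e - z = (x - z) + t *\<^sub>R e" by simp
      then have "Q *v (x + t *\<^sub>R e - z) = Q *v (x - z) + t *\<^sub>R (Q *v e)"
        by (simp only: matrix_vector_right_distrib matrix_vector_mult_scaleR)
      then show ?thesis by (simp add: Qe)
    qed
    have "(Q *v (x + t *\<^sub>R e - z)) $ 1 = (Q *v (x - z)) $ 1" unfolding q by (simp add: axis_def)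
    moreover have "(Q *v (x + t *\<^sub>R e - z)) $ 2 \<le> (Q *v (x - z)) $ 2" unfolding q using that(3) r by (simp add: axis_def)
    ultimately have "x + t *\<^sub>R e \<in> ball z r \<inter> U" unfolding eq using b x by simp
    then show ?thesis by simp
  qed
  have "z + e \<in> U"
  proof -
    have "z + e \<in> ball z r" using ne r by (simp add: dist_norm)
    moreover have "(Q *v (z + e - z)) $ 2 < g ((Q *v (z + e - z)) $ 1)"
      using g0 r by (simp add: Qe axis_def)
    ultimately have "z + e \<in> ball z r \<inter> U" unfolding eq by simp
    then show ?thesis by simp
  qed
  then obtain \<rho> where \<rho>: "\<rho> > 0" "ball (z + e) \<rho> \<subseteq> U" using oU open_contains_ball by blast
  \<comment> \<open>One radius for two purposes: the segments remain in \<open>ball z r\<close>, and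
    the translate by \<open>e\<close> lands in the ball about \<open>z + e\<close>.\<close>
  let ?N = "ball z (min \<rho> (r / 2))"
  have "rel_poincare U (?N \<inter> U)"
  proof (rule rel_poincare_translate[OF _ _ rel_poincare_ball[OF \<rho>] open_ball])
    show "open (?N \<inter> U)" using oU by auto
    show "y + t *\<^sub>R e \<in> U" if "y \<in> ?N \<inter> U" "t \<in> {0..1}" for y t using seg[of y t] that by auto
    show "y + e \<in> ball (z + e) \<rho>" if "y \<in> ?N \<inter> U" for y using that by (auto simp: dist_norm)
  qed
  then show ?thesis using that[of ?N] \<rho>(1) r by auto
qed

text \<open>Among the subfamilies of a finite cover whose union inside \<open>U\<close> is nonempty
  and satisfies the inequality, a maximal one is taken. If a remaining member still met
  \<open>U\<close>, connectedness would make some remaining member overlap that union, and it could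
  be added.\<close>

theorem rel_poincare_lipschitz_domain:
  assumes bd: "bounded U" and conn: "connected U" and U: "lipschitz_domain U" and ne: "U \<noteq> {}"
  shows "rel_poincare U U"
proof -
  have oU: "open U" using U by (simp add: lipschitz_domain_def)
  let ?\<N> = "{N. open N \<and> rel_poincare U (N \<inter> U)}"
  have "\<exists>N\<in>?\<N>. z \<in> N" if "z \<in> closure U" for z
  proof (cases "z \<in> U")
    case True
    then obtain r where r: "r > 0" "ball z r \<subseteq> U" using oU open_contains_ball by blast
    then have "rel_poincare U (ball z r \<inter> U)" using rel_poincare_ball[OF r] by (simp add: Int_absorb2)
    then show ?thesis using r by (intro bexI[of _ "ball z r"]) auto
  next
    case False
    then have "z \<in> frontier U" using that oU by (simp add: frontier_def interior_open)
    then show ?thesis using rel_poincare_frontier[OF U] by blast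
  qed
  then have cov: "closure U \<subseteq> \<Union>?\<N>" by blast
  have cpt: "compact (closure U)" using bd by (simp add: compact_closure)
  obtain F where F: "F \<subseteq> ?\<N>" "finite F" "closure U \<subseteq> \<Union>F"
    by (rule compactE[OF cpt cov]) auto
  have UF: "U \<subseteq> \<Union>F" using F(3) closure_subset by blast
  define S where "S = {H \<in> Pow F. rel_poincare U (\<Union>H \<inter> U) \<and> \<Union>H \<inter> U \<noteq> {}}"
  obtain x N where "x \<in> U" "N \<in> F" "x \<in> N" using ne UF by blast
  then have "{N} \<in> S" using F(1) by (auto simp: S_def)
  moreover have "finite S" using F(2) by (simp add: S_def)
  ultimately obtain H where H: "H \<in> S" "\<And>H'. H' \<in> S \<Longrightarrow> H \<subseteq> H' \<Longrightarrow> H = H'"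
    using finite_has_maximal[of S] by blast
  let ?A = "\<Union>H \<inter> U" and ?B = "\<Union>(F - H) \<inter> U"
  have HF: "H \<subseteq> F" "rel_poincare U ?A" "?A \<noteq> {}" using H(1) by (auto simp: S_def)
  have "open N" if "N \<in> F" for N using F(1) that by blast
  then have oA: "open ?A" "open ?B" using HF(1) oU by (auto intro!: open_Int open_Union)
  have AB: "?A \<union> ?B = U" using UF HF by blast
  have "?B = {}"
  proof (rule ccontr)
    assume "?B \<noteq> {}"
    moreover have "?A \<inter> ?B \<inter> U = {} \<Longrightarrow> ?A \<inter> U = {} \<or> ?B \<inter> U = {}"
      by (rule connectedD[OF conn oA]) (simp_all only: AB order_refl)
    moreover have "?A \<inter> U = ?A" "?B \<inter> U = ?B" by (simp_all add: Int_assoc)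
    ultimately have "?A \<inter> ?B \<inter> U \<noteq> {}" using HF(3) by metis
    then obtain x where x: "x \<in> ?A" "x \<in> ?B" by auto
    then obtain N where N: "N \<in> F" "N \<notin> H" "x \<in> N" by auto
    then have N3: "?A \<inter> (N \<inter> U) \<noteq> {}" using x by auto
    have oN: "open N" "rel_poincare U (N \<inter> U)" using F(1) N(1) by auto
    have "bounded (N \<inter> U)" using bd by (rule bounded_subset) auto
    then have "rel_poincare U (?A \<union> (N \<inter> U))"
      using rel_poincare_Un[OF HF(2) oA(1) oN(2) open_Int[OF oN(1) oU] _ N3] by simp
    moreover have "?A \<union> (N \<inter> U) = \<Union>(insert N H) \<inter> U" by auto
    ultimately have "insert N H \<in> S" using N(1) HF by (auto simp: S_def)
    then have "H = insert N H" by (rule H(2)) auto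
    then show False using N(2) by auto
  qed
  then show ?thesis using AB HF(2) by auto
qed

section \<open>From Borel representatives to Lebesgue measurable functions\<close>

definition sobolev :: "(real^'n) set \<Rightarrow> (real^'n \<Rightarrow> real^'m) \<Rightarrow> ('n \<Rightarrow> real^'n \<Rightarrow> real^'m) \<Rightarrow> bool" where
  "sobolev U f g \<longleftrightarrow> L2 U f \<and> (\<forall>i. L2 U (g i) \<and> weak_partial U f i (g i))"

lemma L2_set_integrable:
  fixes f :: "real^'n \<Rightarrow> real^'m"
  assumes U: "open U" "bounded U" and f: "L2 U f"
  shows "set_integrable lebesgue U f"
  unfolding set_integrable_def
proof (rule Bochner_Integration.integrable_bound)
  have "integrable lebesgue (indicator U :: _ \<Rightarrow> real)"
    using U emeasure_bounded_finite[OF U(2)] by (simp add: integrable_indicator_iff)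
  moreover have "integrable lebesgue (\<lambda>x. indicator U x *\<^sub>R (norm (f x))\<^sup>2)"
    using f by (simp add: L2_def set_integrable_def)
  ultimately show "integrable lebesgue (\<lambda>x. indicator U x + indicator U x *\<^sub>R (norm (f x))\<^sup>2)"
    by (rule Bochner_Integration.integrable_add)
  show "(\<lambda>x. indicator U x *\<^sub>R f x) \<in> borel_measurable lebesgue"
    using f by (simp add: L2_def set_borel_measurable_def)
  have "a \<le> 1 + a\<^sup>2" for a :: real using zero_le_power2[of "a - 1/2"] by (simp add: power2_diff power2_eq_square algebra_simps)
  then show "AE x in lebesgue. norm (indicator U x *\<^sub>R f x) \<le> norm (indicator U x + indicator U x *\<^sub>R (norm (f x))\<^sup>2)"
    by (intro AE_I2) (auto simp: indicator_def)
qed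

lemma borel_representative:
  fixes h :: "real^'n \<Rightarrow> real^'m"
  assumes "set_borel_measurable lebesgue U h" and U: "open U"
  obtains h' where "h' \<in> borel_measurable borel" "AE x in lebesgue. h' x = indicator U x *\<^sub>R h x"
proof -
  have m: "(\<lambda>x. indicator U x *\<^sub>R h x) \<in> borel_measurable lebesgue"
    using assms by (simp add: set_borel_measurable_def)
  have "\<exists>k\<in>borel_measurable lborel. AE x in lborel. (indicator U x *\<^sub>R h x) $ i = k x" for i
    using measurable_compose[OF m borel_measurable_nth] by (intro completion_ex_borel_measurable_real) simp
  then have "\<forall>i. \<exists>k. k \<in> borel_measurable lborel \<and> (AE x in lborel. (indicator U x *\<^sub>R h x) $ i = k x)" by blast
  from choice[OF this] obtain k where k: "\<And>i. k i \<in> borel_measurable lborel"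
    "\<And>i. AE x in lborel. (indicator U x *\<^sub>R h x) $ i = k i x" by blast
  have "AE x in lborel. \<forall>i. (indicator U x *\<^sub>R h x) $ i = k i x"
    using k(2) by (subst AE_all_countable) blast
  then have "AE x in lebesgue. (\<chi> i. k i x) = indicator U x *\<^sub>R h x"
    unfolding AE_completion_iff by eventually_elim (simp add: vec_eq_iff)
  moreover have "(\<lambda>x. \<chi> i. k i x) \<in> borel_measurable borel"
    using k(1) by (subst borel_measurable_euclidean_space) (auto simp: Basis_vec_def inner_axis)
  ultimately show ?thesis using that by blast
qed

text \<open>The representatives are extended by zero outside \<open>U\<close> and changed on a null
  set. Test functions supported in \<open>U\<close> notice neither, so the integration by parts
  formula survives.\<close>

lemma sobolev_borel_representative:
  fixes f :: "real^'n \<Rightarrow> real^'m"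
  assumes U: "open U" "bounded U" and fg: "sobolev U f g"
  obtains f' g' where "borel_sobolev U f' g'" "AE x in lebesgue. f' x = indicator U x *\<^sub>R f x"
    "\<And>i. AE x in lebesgue. g' i x = indicator U x *\<^sub>R g i x"
proof -
  have L: "L2 U f" "L2 U (g i)" "weak_partial U f i (g i)" for i using fg by (auto simp: sobolev_def)
  obtain f' where f': "f' \<in> borel_measurable borel" "AE x in lebesgue. f' x = indicator U x *\<^sub>R f x"
    by (rule borel_representative[OF L(1)[unfolded L2_def, THEN conjunct1] U(1)])
  have "\<forall>i. \<exists>h. h \<in> borel_measurable borel \<and> (AE x in lebesgue. h x = indicator U x *\<^sub>R g i x)"
  proof
    show "\<exists>h. h \<in> borel_measurable borel \<and> (AE x in lebesgue. h x = indicator U x *\<^sub>R g i x)" for i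
    by (rule borel_representative[OF L(2)[of i, unfolded L2_def, THEN conjunct1] U(1)]) blast
  qed
  from choice[OF this] obtain g' where g': "\<And>i. g' i \<in> borel_measurable borel"
    "\<And>i. AE x in lebesgue. g' i x = indicator U x *\<^sub>R g i x" by blast
  have int: "integrable lborel h'" if "L2 U h" "h' \<in> borel_measurable borel" "AE x in lebesgue. h' x = indicator U x *\<^sub>R h x"
    for h h' :: "real^'n \<Rightarrow> real^'m"
  proof -
    have i: "integrable lebesgue (\<lambda>x. indicator U x *\<^sub>R h x)"
      using L2_set_integrable[OF U that(1)] by (simp add: set_integrable_def)
    have "integrable lebesgue h'"
      by (rule integrable_cong_AE_imp[OF i _ AE_symmetric[OF that(3)]]) (use that(2) in \<open>auto intro!: measurable_completion\<close>)
    then show ?thesis using that(2) by (simp add: integrable_completion)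
  qed
  have eq: "(LINT x|lborel. \<phi> x *\<^sub>R h' x) = (LINT x:U|lebesgue. \<phi> x *\<^sub>R h x)"
    if \<phi>: "test_fun U \<phi>" and "L2 U h" and h': "h' \<in> borel_measurable borel" "AE x in lebesgue. h' x = indicator U x *\<^sub>R h x"
    for \<phi> and h h' :: "real^'n \<Rightarrow> real^'m"
  proof -
    have [measurable]: "(\<lambda>x. \<phi> x *\<^sub>R h' x) \<in> borel_measurable borel" using test_fun_borel[OF \<phi>] h'(1) by simp
    have "(LINT x|lborel. \<phi> x *\<^sub>R h' x) = (LINT x|lebesgue. \<phi> x *\<^sub>R h' x)"
      by (rule integral_completion[symmetric]) simp
    also have "\<dots> = (LINT x|lebesgue. \<phi> x *\<^sub>R indicator U x *\<^sub>R h x)"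
    proof (rule integral_cong_AE)
      show "(\<lambda>x. \<phi> x *\<^sub>R h' x) \<in> borel_measurable lebesgue" by (intro measurable_completion) simp
      show "(\<lambda>x. \<phi> x *\<^sub>R indicator U x *\<^sub>R h x) \<in> borel_measurable lebesgue"
        using that(2) test_fun_measurable[OF \<phi>]
        by (intro borel_measurable_scaleR[of _ _ "\<lambda>x. indicator U x *\<^sub>R h x"]) (auto simp: L2_def set_borel_measurable_def)
      show "AE x in lebesgue. \<phi> x *\<^sub>R h' x = \<phi> x *\<^sub>R indicator U x *\<^sub>R h x"
        using h'(2) by eventually_elim simp
    qed
    also have "\<dots> = (LINT x:U|lebesgue. \<phi> x *\<^sub>R h x)"
      unfolding set_lebesgue_integral_def by (simp add: scaleR_left_commute mult.commute)
    finally show ?thesis .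
  qed
  have "borel_sobolev U f' g'"
    unfolding borel_sobolev_def
  proof (intro conjI allI impI)
    show "integrable lborel f'" by (rule int[OF L(1) f'])
    show gi: "integrable lborel (g' i)" for i by (rule int[OF L(2) g'])
    fix \<phi> and e :: "real^'n" assume \<phi>: "test_fun U \<phi>"
    have ax: "(LINT x|lborel. pd \<phi> (axis i 1) x *\<^sub>R f' x) = - (LINT x|lborel. \<phi> x *\<^sub>R g' i x)" for i
      unfolding eq[OF test_fun_pd[OF \<phi>] L(1) f'] eq[OF \<phi> L(2) g'] using L(3)[of i] \<phi> by (simp add: weak_partial_def)
    have i1: "integrable lborel (\<lambda>x. pd \<phi> v x *\<^sub>R f' x)" for v
      by (rule test_fun_lborel_integrable[OF test_fun_pd[OF \<phi>] int[OF L(1) f']])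
    have i2: "integrable lborel (\<lambda>x. \<phi> x *\<^sub>R g' i x)" for i
      by (rule test_fun_lborel_integrable[OF \<phi> gi])
    \<comment> \<open>Linearity in the direction passes from the coordinate derivatives of
      \<open>weak_partial\<close> to the arbitrary directions in
      \<open>borel_sobolev\<close>.\<close>
    have "pd \<phi> e x = (\<Sum>i\<in>UNIV. e $ i * pd \<phi> (axis i 1) x)" for x
    proof -
      have lin: "linear (\<lambda>v. pd \<phi> v x)"
        using test_fun_has_derivative[OF \<phi>] has_derivative_linear by blast
      have "pd \<phi> e x = pd \<phi> (\<Sum>i\<in>UNIV. e $ i *\<^sub>R axis i 1) x" by (simp add: basis_expansion scalar_mult_eq_scaleR[symmetric])
      also have "\<dots> = (\<Sum>i\<in>UNIV. e $ i * pd \<phi> (axis i 1) x)"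
        by (simp only: linear_sum[OF lin] linear_cmul[OF lin] real_scaleR_def)
      finally show ?thesis .
    qed
    then have "(LINT x|lborel. pd \<phi> e x *\<^sub>R f' x) = (LINT x|lborel. (\<Sum>i\<in>UNIV. e $ i *\<^sub>R pd \<phi> (axis i 1) x *\<^sub>R f' x))"
      by (simp add: scaleR_sum_left)
    also have "\<dots> = (\<Sum>i\<in>UNIV. e $ i *\<^sub>R (LINT x|lborel. pd \<phi> (axis i 1) x *\<^sub>R f' x))"
      using i1 by (simp del: scaleR_scaleR add: Bochner_Integration.integral_sum)
    also have "\<dots> = - (\<Sum>i\<in>UNIV. e $ i *\<^sub>R (LINT x|lborel. \<phi> x *\<^sub>R g' i x))"
      by (simp add: ax sum_negf)
    also have "(\<Sum>i\<in>UNIV. e $ i *\<^sub>R (LINT x|lborel. \<phi> x *\<^sub>R g' i x)) = (LINT x|lborel. (\<Sum>i\<in>UNIV. e $ i *\<^sub>R \<phi> x *\<^sub>R g' i x))"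
      using i2 by (simp del: scaleR_scaleR add: Bochner_Integration.integral_sum)
    also have "\<dots> = (LINT x|lborel. \<phi> x *\<^sub>R (\<Sum>i\<in>UNIV. e $ i *\<^sub>R g' i x))"
      by (simp add: scaleR_sum_right mult.commute)
    finally show "(LINT x|lborel. pd \<phi> e x *\<^sub>R f' x) = - (LINT x|lborel. \<phi> x *\<^sub>R (\<Sum>i\<in>UNIV. e $ i *\<^sub>R g' i x))" .
  qed
  then show ?thesis using that f'(2) g'(2) by blast
qed

theorem poincare_inequality:
  assumes bd: "bounded U" and conn: "connected U" and U: "lipschitz_domain U"
  obtains C :: real where "C \<ge> 0" "\<And>(f::real^2 \<Rightarrow> real^3) g. sobolev U f g \<Longrightarrow>
    \<exists>c. (\<integral>\<^sup>+x\<in>U. ennreal ((norm (f x - c))\<^sup>2) \<partial>lebesgue)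
       \<le> ennreal C * (\<integral>\<^sup>+x\<in>U. ennreal (\<Sum>i\<in>UNIV. (norm (g i x))\<^sup>2) \<partial>lebesgue)"
proof (cases "U = {}")
  case True
  then show ?thesis using that[of 0] by simp
next
  case False
  have oU: "open U" using U by (simp add: lipschitz_domain_def)
  obtain C where C: "C \<ge> 0" "\<And>(f::real^2 \<Rightarrow> real^3) g. borel_sobolev U f g \<Longrightarrow>
     (\<exists>c. (\<integral>\<^sup>+x. indicator U x * ennreal ((norm (f x - c))\<^sup>2) \<partial>lborel) \<le> ennreal C * grad_energy g)"
    using rel_poincare_lipschitz_domain[OF bd conn U False] unfolding rel_poincare_def by blast
  have "\<exists>c. (\<integral>\<^sup>+x\<in>U. ennreal ((norm (f x - c))\<^sup>2) \<partial>lebesgue)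
       \<le> ennreal C * (\<integral>\<^sup>+x\<in>U. ennreal (\<Sum>i\<in>UNIV. (norm (g i x))\<^sup>2) \<partial>lebesgue)"
    if fg: "sobolev U f g" for f :: "real^2 \<Rightarrow> real^3" and g
  proof -
    obtain f' g' where b: "borel_sobolev U f' g'" and f': "AE x in lebesgue. f' x = indicator U x *\<^sub>R f x"
      and g': "\<And>i. AE x in lebesgue. g' i x = indicator U x *\<^sub>R g i x"
      using sobolev_borel_representative[OF oU bd fg] by blast
    obtain c where c: "(\<integral>\<^sup>+x. indicator U x * ennreal ((norm (f' x - c))\<^sup>2) \<partial>lborel) \<le> ennreal C * grad_energy g'"
      using C(2)[OF b] by blast
    have "(\<integral>\<^sup>+x\<in>U. ennreal ((norm (f x - c))\<^sup>2) \<partial>lebesgue) = (\<integral>\<^sup>+x. indicator U x * ennreal ((norm (f' x - c))\<^sup>2) \<partial>lebesgue)"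
      using f' by (intro nn_integral_cong_AE, eventually_elim) (auto simp: indicator_def)
    also have "\<dots> \<le> ennreal C * grad_energy g'" using c by (simp add: nn_integral_completion)
    also have "grad_energy g' = (\<integral>\<^sup>+x\<in>U. ennreal (\<Sum>i\<in>UNIV. (norm (g i x))\<^sup>2) \<partial>lebesgue)"
    proof -
      have "AE x in lebesgue. \<forall>i. g' i x = indicator U x *\<^sub>R g i x"
        using g' by (subst AE_all_countable) blast
      then show ?thesis unfolding grad_energy_def nn_integral_completion[symmetric, of lborel]
        by (intro nn_integral_cong_AE, eventually_elim) (auto simp: indicator_def)
    qed
    finally show ?thesis by blast
  qed
  then show ?thesis using that C(1) by blast
qed

section \<open>Coercivity of the quadratic forms\<close>

lemma matrix_norm_sq: "(norm (A::real^'n^'m))\<^sup>2 = (\<Sum>i\<in>UNIV. \<Sum>j\<in>UNIV. (A $ i $ j)\<^sup>2)"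
  unfolding power2_norm_eq_inner inner_vec_def by (simp add: power2_eq_square)

lemma norm_transpose: "norm (transpose (A::real^'n^'m)) = norm A"
proof -
  have "(norm (transpose A))\<^sup>2 = (norm A)\<^sup>2"
    unfolding matrix_norm_sq transpose_def by (simp, rule sum.swap)
  then show ?thesis by (simp add: power2_eq_iff_nonneg)
qed

lemma norm_matrix_mult_le:
  fixes A :: "real^'n^'m" and B :: "real^'k^'n"
  shows "norm (A ** B) \<le> norm A * norm B"
proof -
  have "(norm (A ** B))\<^sup>2 = (\<Sum>i\<in>UNIV. \<Sum>j\<in>UNIV. (\<Sum>k\<in>UNIV. A $ i $ k * B $ k $ j)\<^sup>2)"
    by (simp add: matrix_norm_sq matrix_matrix_mult_def)
  also have "\<dots> \<le> (\<Sum>i\<in>UNIV. \<Sum>j\<in>UNIV. (\<Sum>k\<in>UNIV. (A $ i $ k)\<^sup>2) * (\<Sum>k\<in>UNIV. (B $ k $ j)\<^sup>2))"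
    by (intro sum_mono Cauchy_Schwarz_ineq_sum)
  also have "\<dots> = (\<Sum>i\<in>UNIV. \<Sum>k\<in>UNIV. (A $ i $ k)\<^sup>2) * (\<Sum>j\<in>UNIV. \<Sum>k\<in>UNIV. (B $ k $ j)\<^sup>2)"
    by (simp add: sum_product)
  also have "(\<Sum>j\<in>UNIV. \<Sum>k\<in>UNIV. (B $ k $ j)\<^sup>2) = (norm B)\<^sup>2"
    unfolding matrix_norm_sq by (rule sum.swap)
  finally have "(norm (A ** B))\<^sup>2 \<le> (norm A * norm B)\<^sup>2" by (simp add: matrix_norm_sq power_mult_distrib)
  then show ?thesis by (rule power2_le_imp_le) simp
qed

lemma transpose_add: "transpose (A + B) = transpose A + transpose (B::real^'n^'m)"
  and transpose_diff: "transpose (A - B) = transpose A - transpose (B::real^'n^'m)"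
  and transpose_scaleR: "transpose (c *\<^sub>R A) = c *\<^sub>R transpose (A::real^'n^'m)"
  by (simp_all add: transpose_def vec_eq_iff)

lemma matrix_mult_diff_left: "((A::real^'n^'m) - B) ** C = A ** C - B ** (C::real^'k^'n)"
  by (simp add: matrix_matrix_mult_def vec_eq_iff left_diff_distrib sum_subtractf)

lemma matrix_mult_diff_right: "(D::real^'n^'m) ** (E - F) = D ** E - D ** (F::real^'k^'n)"
  by (simp add: matrix_matrix_mult_def vec_eq_iff right_diff_distrib sum_subtractf)

lemma matrix_mult_add_left: "((A::real^'n^'m) + B) ** C = A ** C + B ** (C::real^'k^'n)"
  by (simp add: matrix_matrix_mult_def vec_eq_iff distrib_right sum.distrib)

lemma matrix_mult_add_right: "(D::real^'n^'m) ** (E + F) = D ** E + D ** (F::real^'k^'n)"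
  by (simp add: matrix_matrix_mult_def vec_eq_iff distrib_left sum.distrib)

lemma matrix_mult_scaleR: "(c *\<^sub>R A) ** B = c *\<^sub>R (A ** B)" "A ** (c *\<^sub>R B) = c *\<^sub>R ((A::real^'n^'m) ** (B::real^'k^'n))"
  by (simp_all add: matrix_matrix_mult_def vec_eq_iff sum_distrib_left mult_ac)

lemma linear_symm: "linear (symm :: real^'n^'n \<Rightarrow> _)"
  by (rule linearI) (simp_all add: symm_def transpose_add transpose_scaleR algebra_simps)

lemma norm_symm_le: "norm (symm A) \<le> norm (A::real^'n^'n)"
  using norm_triangle_ineq[of A "transpose A"] by (simp add: symm_def norm_transpose)

text \<open>For a rotation, orthogonality reads (R - 1)^T (R - 1) = -((R - 1) + (R - 1)^T), so the
  symmetric part of R - 1 is of second order: the tangent directions of SO(3) at the identity are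
  skew.\<close>

lemma norm_symm_rotation_le:
  assumes "R \<in> SO3"
  shows "norm (symm (R - mat 1)) \<le> (norm (R - mat 1))\<^sup>2 / 2"
proof -
  have "transpose (R - mat 1) ** (R - mat 1) = - ((R - mat 1) + transpose (R - mat 1))"
    using assms by (simp add: SO3_def transpose_diff matrix_mult_diff_left matrix_mult_diff_right transpose_mat)
  then have "symm (R - mat 1) = - (1/2) *\<^sub>R (transpose (R - mat 1) ** (R - mat 1))"
    by (simp only: symm_def scaleR_minus_left scaleR_minus_right minus_minus)
  then have "norm (symm (R - mat 1)) = norm (transpose (R - mat 1) ** (R - mat 1)) / 2" by simp
  also have "\<dots> \<le> norm (transpose (R - mat 1)) * norm (R - mat 1) / 2"
    by (intro divide_right_mono norm_matrix_mult_le) simp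
  finally show ?thesis by (simp add: norm_transpose power2_eq_square)
qed

lemma mat_1_in_SO3: "mat 1 \<in> SO3"
  by (simp add: SO3_def transpose_mat)

text \<open>A rotation farther than t|F| from 1 + tF satisfies the bound trivially, because |sym F|
  <= |F|. A nearer one has |R - 1| <= 2t|F|, hence a symmetric part of size at most 2 t^2 |F|^2,
  which is the error term.\<close>

lemma infdist_SO3_ge:
  assumes t: "t \<ge> 0"
  shows "t * norm (symm F) - 2 * t\<^sup>2 * (norm F)\<^sup>2 \<le> infdist (mat 1 + t *\<^sub>R F) SO3"
proof -
  have "t * norm (symm F) - 2 * t\<^sup>2 * (norm F)\<^sup>2 \<le> dist (mat 1 + t *\<^sub>R F) R" if R: "R \<in> SO3" for R
  proof -
    define d where "d = norm (mat 1 + t *\<^sub>R F - R)"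
    show ?thesis
    proof (cases "d \<le> t * norm F")
      case False
      have "t * norm (symm F) \<le> t * norm F" using t norm_symm_le by (rule mult_left_mono[rotated])
      then show ?thesis using False by (simp add: d_def dist_norm)
        (smt (verit) mult_nonneg_nonneg zero_le_power2)
    next
      case True
      have "R - mat 1 = t *\<^sub>R F - (mat 1 + t *\<^sub>R F - R)" by simp
      then have "norm (R - mat 1) \<le> norm (t *\<^sub>R F) + d" unfolding d_def by (metis norm_triangle_ineq4)
      then have "norm (R - mat 1) \<le> 2 * t * norm F" using True t by simp
      then have "(norm (R - mat 1))\<^sup>2 \<le> (2 * t * norm F)\<^sup>2" by (rule power_mono) simp
      then have r: "norm (symm (R - mat 1)) \<le> 2 * t\<^sup>2 * (norm F)\<^sup>2"
        using norm_symm_rotation_le[OF R] by (simp add: power_mult_distrib)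
      have "t *\<^sub>R symm F = symm (mat 1 + t *\<^sub>R F - R) + symm (R - mat 1)"
        using linear_add[OF linear_symm, of "mat 1 + t *\<^sub>R F - R" "R - mat 1"] linear_cmul[OF linear_symm, of t F] by simp
      then have "norm (t *\<^sub>R symm F) \<le> norm (symm (mat 1 + t *\<^sub>R F - R)) + norm (symm (R - mat 1))"
        by (metis norm_triangle_ineq)
      then show ?thesis using t r norm_symm_le[of "mat 1 + t *\<^sub>R F - R"] by (simp add: dist_norm)
    qed
  qed
  then show ?thesis using mat_1_in_SO3 unfolding infdist_def by (auto intro!: cINF_greatest)
qed

text \<open>One mean value step replaces a Taylor expansion. As the derivative at the minimum 0
  vanishes, the value at t is t times the derivative at some xi < t, hence below q xi t <= q t^2 for
  q slightly above Q. Compared with the Taylor expansion this loses a factor 2, which is harmless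
  here.\<close>

lemma second_derivative_ge_of_quadratic_lower_bound:
  fixes \<gamma> \<gamma>' :: "real \<Rightarrow> real"
  assumes \<delta>: "\<delta> > 0" and D: "\<And>t. \<bar>t\<bar> < \<delta> \<Longrightarrow> (\<gamma> has_real_derivative \<gamma>' t) (at t)"
    and D2: "(\<gamma>' has_real_derivative Q) (at 0)" and \<gamma>0: "\<gamma> 0 = 0"
    and nonneg: "\<And>t. \<bar>t\<bar> < \<delta> \<Longrightarrow> \<gamma> t \<ge> 0"
    and low: "\<And>t. 0 \<le> t \<Longrightarrow> t < \<delta> \<Longrightarrow> t * s - t\<^sup>2 * k \<ge> 0 \<Longrightarrow> \<gamma> t \<ge> c * (t * s - t\<^sup>2 * k)\<^sup>2"
    and c: "c > 0" and s: "s \<ge> 0"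
  shows "c * s\<^sup>2 \<le> Q"
proof (rule ccontr)
  assume "\<not> ?thesis"
  then obtain q where q: "Q < q" "q < c * s\<^sup>2" using dense[of Q "c * s\<^sup>2"] by auto
  have \<gamma>'0: "\<gamma>' 0 = 0"
    using D[of 0] \<delta> nonneg \<gamma>0 by (intro DERIV_local_min[of \<gamma> _ 0 \<delta>]) auto
  have "((\<lambda>h. (\<gamma>' (0 + h) - \<gamma>' 0) / h) \<longlongrightarrow> Q) (at 0)" using D2 by (simp add: has_field_derivative_iff)
  then have "((\<lambda>h. \<gamma>' h / h) \<longlongrightarrow> Q) (at_right 0)"
    using \<gamma>'0 by (simp add: filterlim_at_split)
  then have "eventually (\<lambda>h. \<gamma>' h / h < q) (at_right 0)" using q(1) by (rule order_tendstoD)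
  then obtain \<eta> where \<eta>: "\<eta> > 0" "\<And>h. 0 < h \<Longrightarrow> h < \<eta> \<Longrightarrow> \<gamma>' h < q * h"
    by (auto simp: eventually_at_right_field pos_divide_less_eq)
  have mvt: "\<exists>\<xi>. \<gamma> t < q * \<xi> * t \<and> 0 < \<xi> \<and> \<xi> < t" if t: "0 < t" "t < min \<delta> \<eta>" for t
  proof -
    have "\<exists>z>0. z < t \<and> \<gamma> t - \<gamma> 0 = (t - 0) * \<gamma>' z"
      using t by (intro MVT2) (auto intro!: D)
    then obtain z where "0 < z" "z < t" "\<gamma> t - \<gamma> 0 = (t - 0) * \<gamma>' z" by blast
    then show ?thesis
      using t \<eta>(2)[of z] \<gamma>0 mult_strict_left_mono[of "\<gamma>' z" "q * z" t] by (intro exI[of _ z]) (simp add: mult.commute)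
  qed
  \<comment> \<open>Positivity of q is what allows q xi t to be enlarged to q t^2.\<close>
  have qpos: "q > 0"
  proof (rule ccontr)
    assume "\<not> q > 0"
    let ?t = "min \<delta> \<eta> / 2"
    have t: "0 < ?t" "?t < min \<delta> \<eta>" using \<delta> \<eta>(1) by (auto simp: min_def)
    obtain \<xi> where \<xi>: "\<gamma> ?t < q * \<xi> * ?t" "0 < \<xi>" using mvt[OF t] by blast
    have "q * \<xi> * ?t \<le> 0" using \<open>\<not> q > 0\<close> \<xi>(2) t(1) by (intro mult_nonpos_nonneg) auto
    moreover have "\<gamma> ?t \<ge> 0" using t by (intro nonneg) auto
    ultimately show False using \<xi>(1) by simp
  qed
  then have "s > 0" using q(2) s c by (cases "s = 0") auto
  have "((\<lambda>t. c * (s - t * k)\<^sup>2) \<longlongrightarrow> c * (s - 0 * k)\<^sup>2) (at_right 0)" by (intro tendsto_intros)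
  then have e1: "eventually (\<lambda>t. q < c * (s - t * k)\<^sup>2) (at_right 0)" using q(2) by (intro order_tendstoD) auto
  have "((\<lambda>t. s - t * k) \<longlongrightarrow> s - 0 * k) (at_right 0)" by (intro tendsto_intros)
  then have e2: "eventually (\<lambda>t. 0 < s - t * k) (at_right 0)" using \<open>s > 0\<close> by (intro order_tendstoD) auto
  have e3: "eventually (\<lambda>t. 0 < t \<and> t < min \<delta> \<eta>) (at_right 0)"
    using \<delta> \<eta>(1) by (auto simp: eventually_at_right_field intro!: exI[of _ "min \<delta> \<eta>"])
  obtain t where t: "q < c * (s - t * k)\<^sup>2" "0 < s - t * k" "0 < t" "t < min \<delta> \<eta>"
    using eventually_happens[OF eventually_conj[OF e1 eventually_conj[OF e2 e3]]] by auto
  obtain \<xi> where \<xi>: "\<gamma> t < q * \<xi> * t" "0 < \<xi>" "\<xi> < t" using mvt[OF t(3,4)] by blast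
  have eq: "t * s - t\<^sup>2 * k = t * (s - t * k)" by (simp add: power2_eq_square algebra_simps)
  have "c * (t * s - t\<^sup>2 * k)\<^sup>2 \<le> \<gamma> t" using t by (intro low) (auto simp: eq)
  also have "\<dots> < q * \<xi> * t" by (rule \<xi>)
  also have "\<dots> \<le> q * t * t" using qpos \<xi> t(3) by (intro mult_right_mono mult_left_mono) auto
  finally have "(c * (s - t * k)\<^sup>2) * t\<^sup>2 < q * t\<^sup>2" unfolding eq by (simp add: power_mult_distrib power2_eq_square mult_ac)
  then show False using t(1,3) by simp
qed

lemma Q3_coercive:
  assumes "admissible_W W"
  obtains c where "c > 0" "\<And>F. c * (norm (symm F))\<^sup>2 \<le> Q3 W F"
proof -
  obtain c where c: "c > 0" "\<And>F. W F \<ge> ennreal (c * (infdist F SO3)\<^sup>2)"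
    using assms unfolding admissible_W_def by blast
  obtain U where U: "open U" "SO3 \<subseteq> U" "\<And>F. F \<in> U \<Longrightarrow> W F < \<infinity>" "Ck_on 2 U (\<lambda>F. enn2real (W F))"
    using assms unfolding admissible_W_def by blast
  define w where "w F = enn2real (W F)" for F
  have w2: "Ck_on (Suc (Suc 0)) U w" using U(4) by (simp add: w_def[abs_def] numeral_2_eq_2)
  have w1: "w differentiable (at X)" if "X \<in> U" for X by (rule Ck_on_Suc_differentiable[OF w2 U(1) that])
  \<comment> \<open>\<open>enn2real\<close> sends infinity to 0, so the lower bound passes to
    \<open>w\<close> only where \<open>W\<close> is finite.\<close>
  have low: "c * (infdist F SO3)\<^sup>2 \<le> w F" if "F \<in> U" for F
    using c(2)[of F] U(3)[OF that] c(1) by (cases "W F") (auto simp: w_def)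
  have "c * (norm (symm F))\<^sup>2 \<le> Q3 W F" for F
  proof -
    have 1: "mat 1 \<in> U" using U(2) mat_1_in_SO3 by blast
    have "continuous_on UNIV (\<lambda>t. mat 1 + t *\<^sub>R F)" by (intro continuous_intros)
    then have "open ((\<lambda>t. mat 1 + t *\<^sub>R F) -` U)" by (rule open_vimage[OF U(1)])
    moreover have "0 \<in> (\<lambda>t. mat 1 + t *\<^sub>R F) -` U" using 1 by simp
    ultimately obtain \<delta> where \<delta>0: "\<delta> > 0" "ball 0 \<delta> \<subseteq> (\<lambda>t. mat 1 + t *\<^sub>R F) -` U"
      using open_contains_ball by blast
    have \<delta>: "\<delta> > 0" "\<And>t. \<bar>t\<bar> < \<delta> \<Longrightarrow> mat 1 + t *\<^sub>R F \<in> U"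
    proof -
      fix t :: real assume "\<bar>t\<bar> < \<delta>"
      then have "t \<in> ball 0 \<delta>" by (simp add: dist_real_def)
      then show "mat 1 + t *\<^sub>R F \<in> U" using \<delta>0(2) by blast
    qed (rule \<delta>0(1))
    have path: "((\<lambda>t. mat 1 + t *\<^sub>R F) has_derivative (\<lambda>s. s *\<^sub>R F)) (at t)" for t
      by (auto intro!: derivative_eq_intros)
    have chain: "((\<lambda>t. v (mat 1 + t *\<^sub>R F)) has_real_derivative pd v F (mat 1 + t *\<^sub>R F)) (at t)"
      if "v differentiable (at (mat 1 + t *\<^sub>R F))" for v :: "real^3^3 \<Rightarrow> real" and t
    proof -
      have "((\<lambda>t. v (mat 1 + t *\<^sub>R F)) has_derivative (\<lambda>s. pd v (s *\<^sub>R F) (mat 1 + t *\<^sub>R F))) (at t)"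
        by (rule has_derivative_compose[OF path differentiable_imp_has_derivative_pd[OF that]])
      moreover have "(\<lambda>s. pd v (s *\<^sub>R F) (mat 1 + t *\<^sub>R F)) = (\<lambda>s. pd v F (mat 1 + t *\<^sub>R F) * s)"
        using linear_cmul[OF linear_pd[OF that]] by (simp add: mult.commute)
      ultimately show ?thesis by (simp only: has_field_derivative_def)
    qed
    have dF: "(\<lambda>X. pd w F X) differentiable (at (mat 1))"
    proof -
      have "Ck_on (Suc 0) U (\<lambda>X. \<Sum>i\<in>Basis. (F \<bullet> i) *\<^sub>R pd w i X)"
        using w2 by (intro Ck_on_sum U(1) Ck_on_scaleR Ck_on_const) auto
      then have "Ck_on (Suc 0) U (\<lambda>X. pd w F X)"
        by (rule Ck_on_cong[OF U(1), rotated]) (use w1 in \<open>simp add: pd_expand[of w _ F]\<close>)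
      then show ?thesis by (rule Ck_on_Suc_differentiable[OF _ U(1) 1])
    qed
    show ?thesis
    proof (rule second_derivative_ge_of_quadratic_lower_bound[of \<delta> "\<lambda>t. w (mat 1 + t *\<^sub>R F)" "\<lambda>t. pd w F (mat 1 + t *\<^sub>R F)" _
          "norm (symm F)" "2 * (norm F)\<^sup>2"])
      show "((\<lambda>t. pd w F (mat 1 + t *\<^sub>R F)) has_real_derivative Q3 W F) (at 0)"
        using chain[of "\<lambda>X. pd w F X" 0] dF by (simp add: Q3_def w_def[abs_def])
      show "w (mat 1 + 0 *\<^sub>R F) = 0"
        using assms mat_1_in_SO3 by (simp add: w_def admissible_W_def)
      fix t assume t: "0 \<le> t" "t < \<delta>" "t * norm (symm F) - t\<^sup>2 * (2 * (norm F)\<^sup>2) \<ge> 0"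
      have "c * (t * norm (symm F) - t\<^sup>2 * (2 * (norm F)\<^sup>2))\<^sup>2 \<le> c * (infdist (mat 1 + t *\<^sub>R F) SO3)\<^sup>2"
        using infdist_SO3_ge[OF t(1), of F] t(3) c(1) by (intro mult_left_mono power_mono) (auto simp: mult_ac)
      also have "\<dots> \<le> w (mat 1 + t *\<^sub>R F)" using t by (intro low \<delta>(2)) auto
      finally show "c * (t * norm (symm F) - t\<^sup>2 * (2 * (norm F)\<^sup>2))\<^sup>2 \<le> w (mat 1 + t *\<^sub>R F)" .
    next
      fix t :: real assume t: "\<bar>t\<bar> < \<delta>"
      show "((\<lambda>t. w (mat 1 + t *\<^sub>R F)) has_real_derivative pd w F (mat 1 + t *\<^sub>R F)) (at t)"
        by (rule chain[OF w1[OF \<delta>(2)[OF t]]])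
    qed (use \<delta> c in \<open>auto simp: w_def\<close>)
  qed
  then show ?thesis using that c(1) by blast
qed

section \<open>Square roots of symmetric positive definite matrices\<close>

lemma symmetric_matrix_inner:
  fixes A :: "real^'n^'n"
  assumes "transpose A = A"
  shows "(A *v u) \<bullet> v = u \<bullet> (A *v v)"
  using assms by (metis dot_lmul_matrix vector_transpose_matrix)

lemma symmetric_matrix_nth: "transpose A = A \<Longrightarrow> A $ i $ j = A $ j $ i" for A :: "real^'n^'n"
proof -
  assume "transpose A = A"
  moreover have "transpose A $ j $ i = A $ i $ j" by (simp add: transpose_def)
  ultimately show ?thesis by simp
qed

text \<open>With D = B - C the equality of squares reads D B + C D = 0. Multiplying by D and taking
  the trace gives a vanishing sum of the nonnegative forms of B and C on the rows of D, so every row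
  is zero.\<close>

lemma sym_posdef_sqrt_unique:
  fixes B C :: "real^'n^'n"
  assumes B: "sym_posdef B" and C: "sym_posdef C" and eq: "B ** B = C ** C"
  shows "B = C"
proof -
  define D where "D = B - C"
  have sD: "transpose D = D" using B C by (simp add: D_def sym_posdef_def transpose_diff)
  have row: "(D ** M ** D) $ i $ i = (D $ i) \<bullet> (M *v (D $ i))" for M i
  proof -
    have "D $ j $ i = D $ i $ j" for i j by (rule symmetric_matrix_nth[OF sD])
    then show ?thesis
      by (simp add: matrix_matrix_mult_def matrix_vector_mult_def inner_vec_def sum_distrib_left sum_distrib_right mult.assoc)
        (rule sum.swap)
  qed
  have "D ** B + C ** D = 0" by (simp add: D_def matrix_mult_diff_left matrix_mult_diff_right eq)
  then have "(D ** B + C ** D) ** D = 0" by simp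
  then have "trace (D ** B ** D) + trace (C ** D ** D) = 0"
    by (simp add: matrix_mult_add_left trace_add[symmetric] trace_0[unfolded mat_0])
  moreover have "trace (C ** D ** D) = trace (D ** C ** D)"
    using trace_mul_sym[of "C ** D" D] by (simp add: matrix_mul_assoc)
  ultimately have "(\<Sum>i\<in>UNIV. (D $ i) \<bullet> (B *v (D $ i)) + (D $ i) \<bullet> (C *v (D $ i))) = 0"
    by (simp add: trace_def row sum.distrib)
  moreover have pos: "(D $ i) \<bullet> (M *v (D $ i)) \<ge> 0" if "sym_posdef M" for i M
    using that by (cases "D $ i = 0") (auto simp: sym_posdef_def less_imp_le)
  ultimately have z: "(D $ i) \<bullet> (B *v (D $ i)) + (D $ i) \<bullet> (C *v (D $ i)) = 0" for i
    using B C by (subst (asm) sum_nonneg_eq_0_iff) auto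
  have "D $ i = 0" for i
  proof (rule ccontr)
    assume "D $ i \<noteq> 0"
    then have "(D $ i) \<bullet> (B *v (D $ i)) > 0" using B by (auto simp: sym_posdef_def)
    then show False using z[of i] pos[OF C, of i] by simp
  qed
  then show ?thesis by (simp add: D_def vec_eq_iff)
qed

text \<open>Writing \<open>A = \<lambda> (1 - X)\<close> with \<open>\<parallel>X\<parallel> < 1\<close>, the square root is \<open>\<surd>\<lambda> (1 - Y)\<close>, where \<open>Y\<close> is the fixed
  point of the contraction \<open>Y \<mapsto> (X + Y\<^sup>2) / 2\<close>.\<close>

lemma sym_posdef_sqrt_exists:
  fixes A :: "real^'n^'n"
  assumes A: "sym_posdef A"
  obtains B where "sym_posdef B" "B ** B = A"
proof -
  have sA: "transpose A = A" using A by (simp add: sym_posdef_def)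
  have cont: "continuous_on (sphere 0 1) (\<lambda>v. v \<bullet> (A *v v))"
    by (intro continuous_intros matrix_vector_mult_linear_continuous_on)
  have "sphere (0::real^'n) 1 \<noteq> {}" by simp
  then obtain v0 where v0: "v0 \<in> sphere 0 1" "\<And>v. v \<in> sphere 0 1 \<Longrightarrow> v0 \<bullet> (A *v v0) \<le> v \<bullet> (A *v v)"
    using continuous_attains_inf[OF compact_sphere _ cont] by blast
  define \<mu> where "\<mu> = v0 \<bullet> (A *v v0)"
  have "v0 \<noteq> 0" using v0(1) by auto
  then have \<mu>: "\<mu> > 0" using A by (auto simp: \<mu>_def sym_posdef_def)
  have low: "\<mu> * (norm v)\<^sup>2 \<le> v \<bullet> (A *v v)" for v
  proof (cases "v = 0")
    case False
    let ?u = "(1 / norm v) *\<^sub>R v"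
    have "\<mu> \<le> ?u \<bullet> (A *v ?u)" unfolding \<mu>_def using False by (intro v0) auto
    also have "\<dots> = (v \<bullet> (A *v v)) / (norm v)\<^sup>2"
      by (simp add: matrix_vector_mult_scaleR power2_eq_square)
    finally show ?thesis using False by (simp add: pos_le_divide_eq)
  qed simp
  \<comment> \<open>The maximum guarantees \<open>\<mu> \<le> \<Lambda>\<close>, so that the number
    under the root in \<open>q\<close> is nonnegative.\<close>
  define \<Lambda> where "\<Lambda> = max \<mu> (onorm ((*v) A))"
  have up: "norm (A *v v) \<le> \<Lambda> * norm v" for v
  proof -
    have "norm (A *v v) \<le> onorm ((*v) A) * norm v" by (rule onorm[OF matrix_vector_mul_bounded_linear])
    also have "\<dots> \<le> \<Lambda> * norm v" by (rule mult_right_mono) (auto simp: \<Lambda>_def)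
    finally show ?thesis .
  qed
  have \<Lambda>: "\<Lambda> > 0" "\<mu> \<le> \<Lambda>" using \<mu> by (auto simp: \<Lambda>_def)
  \<comment> \<open>This scale minimises the bound 1 - 2 mu / l + Lambda^2 / l^2 for the squared
    norm of 1 - A / l; the minimum 1 - mu^2 / Lambda^2 is the square of \<open>q\<close>.\<close>
  define l where "l = \<Lambda>\<^sup>2 / \<mu>"
  have l: "l > 0" using \<mu> \<Lambda> by (simp add: l_def)
  define q where "q = sqrt (1 - \<mu>\<^sup>2 / \<Lambda>\<^sup>2)"
  have rat: "0 < \<mu>\<^sup>2 / \<Lambda>\<^sup>2" "\<mu>\<^sup>2 / \<Lambda>\<^sup>2 \<le> 1"
    using \<mu> \<Lambda> by (auto simp: divide_le_eq_1 intro: power_mono)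
  then have q: "0 \<le> q" "q < 1" "q\<^sup>2 = 1 - \<mu>\<^sup>2 / \<Lambda>\<^sup>2" by (auto simp: q_def)
  define X :: "(real^'n) \<Rightarrow>\<^sub>L (real^'n)" where "X = Blinfun (\<lambda>v. v - (1 / l) *\<^sub>R (A *v v))"
  have X: "blinfun_apply X v = v - (1 / l) *\<^sub>R (A *v v)" for v
    unfolding X_def by (subst bounded_linear_Blinfun_apply)
      (intro bounded_linear_sub bounded_linear_ident bounded_linear_scaleR_right[THEN bounded_linear_compose] matrix_vector_mul_bounded_linear, simp)
  have nX: "norm X \<le> q"
  proof (rule norm_blinfun_bound[OF q(1)])
    fix v
    have "(norm (X v))\<^sup>2 = (norm v)\<^sup>2 - 2 / l * (v \<bullet> (A *v v)) + (norm (A *v v))\<^sup>2 / l\<^sup>2"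
      unfolding X power2_norm_eq_inner
      by (simp add: inner_diff_left inner_diff_right inner_commute power2_eq_square algebra_simps)
    also have "\<dots> \<le> (norm v)\<^sup>2 - 2 / l * (\<mu> * (norm v)\<^sup>2) + (\<Lambda> * norm v)\<^sup>2 / l\<^sup>2"
      using low[of v] l power_mono[OF up[of v], of 2]
      by (intro add_mono diff_mono mult_left_mono divide_right_mono) auto
    also have "\<dots> = (q * norm v)\<^sup>2"
      unfolding power_mult_distrib q(3) l_def using \<mu> \<Lambda>(1) by (simp add: field_simps power2_eq_square)
    finally have "(norm (X v))\<^sup>2 \<le> (q * norm v)\<^sup>2" .
    then show "norm (X v) \<le> q * norm v" by (rule power2_le_imp_le) (simp add: q(1))
  qed
  have sX: "X u \<bullet> v = u \<bullet> X v" for u v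
    unfolding X by (simp add: inner_diff_left inner_diff_right symmetric_matrix_inner[OF sA])
  \<comment> \<open>The ball of radius q is invariant because (q + q^2) / 2 <= q, and q is also the
    contraction factor on it. Self-adjointness is built in so that the fixed point inherits
    it.\<close>
  define S where "S = {Y. norm (Y :: (real^'n) \<Rightarrow>\<^sub>L (real^'n)) \<le> q \<and> (\<forall>u v. blinfun_apply Y u \<bullet> v = u \<bullet> blinfun_apply Y v)}"
  define T where "T Y = (1/2) *\<^sub>R (X + (Y o\<^sub>L Y))" for Y
  have "closed S"
  proof -
    have "S = {Y. norm Y \<le> q} \<inter> (\<Inter>u. \<Inter>v. {Y. blinfun_apply Y u \<bullet> v = u \<bullet> blinfun_apply Y v})" by (auto simp: S_def)
    moreover have "closed {Y :: (real^'n) \<Rightarrow>\<^sub>L (real^'n). norm Y \<le> q}" by (intro closed_Collect_le continuous_intros)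
    moreover have "closed {Y :: (real^'n) \<Rightarrow>\<^sub>L (real^'n). blinfun_apply Y u \<bullet> v = u \<bullet> blinfun_apply Y v}" for u v
      by (intro closed_Collect_eq continuous_intros)
    ultimately show ?thesis by (auto intro!: closed_Int closed_INT)
  qed
  then have "complete S" by (simp add: complete_eq_closed)
  moreover have "S \<noteq> {}" using q(1) by (auto simp: S_def intro!: exI[of _ 0])
  moreover have "T Y \<in> S" if Y: "Y \<in> S" for Y
  proof -
    have nY: "norm Y \<le> q" and sY: "\<And>u v. Y u \<bullet> v = u \<bullet> Y v" using Y by (auto simp: S_def)
    have "norm (X + (Y o\<^sub>L Y)) \<le> norm X + norm (Y o\<^sub>L Y)" by (rule norm_triangle_ineq)
    also have "\<dots> \<le> q + q * q"
      using nX nY q norm_blinfun_compose[of Y Y] mult_mono[OF nY nY] by (intro add_mono) auto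
    also have "\<dots> \<le> 2 * q" using q mult_left_le[of q q] by simp
    finally have "norm (T Y) \<le> q" by (simp add: T_def)
    moreover have "T Y u \<bullet> v = u \<bullet> T Y v" for u v
      by (simp add: T_def scaleR_blinfun.rep_eq plus_blinfun.rep_eq inner_add_left inner_add_right sX sY)
    ultimately show ?thesis by (simp add: S_def)
  qed
  moreover have "dist (T Y) (T Z) \<le> q * dist Y Z" if Y: "Y \<in> S" and Z: "Z \<in> S" for Y Z
  proof -
    have nY: "norm Y \<le> q" "norm Z \<le> q" using Y Z by (auto simp: S_def)
    have "T Y - T Z = (1/2) *\<^sub>R ((Y o\<^sub>L (Y - Z)) + ((Y - Z) o\<^sub>L Z))"
      by (rule blinfun_eqI) (simp add: T_def scaleR_blinfun.rep_eq plus_blinfun.rep_eq minus_blinfun.rep_eq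
          blinfun.diff_right algebra_simps)
    then have "norm (T Y - T Z) = norm ((Y o\<^sub>L (Y - Z)) + ((Y - Z) o\<^sub>L Z)) / 2" by simp
    also have "\<dots> \<le> (norm Y * norm (Y - Z) + norm (Y - Z) * norm Z) / 2"
      by (intro divide_right_mono order_trans[OF norm_triangle_ineq] add_mono norm_blinfun_compose) simp
    also have "\<dots> \<le> (q * norm (Y - Z) + norm (Y - Z) * q) / 2"
      using nY by (intro divide_right_mono add_mono mult_right_mono mult_left_mono) auto
    finally show ?thesis by (simp add: dist_norm mult.commute)
  qed
  ultimately have "\<exists>!Y\<in>S. T Y = Y" using q by (intro Banach_fix[of S q T]) auto
  then obtain Y where Y: "Y \<in> S" "T Y = Y" by blast
  define B where "B = sqrt l *\<^sub>R (mat 1 - matrix (blinfun_apply Y))"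
  have Bv: "B *v v = sqrt l *\<^sub>R (v - Y v)" for v
  proof -
    have "linear (blinfun_apply Y)" by (rule bounded_linear.linear[OF blinfun.bounded_linear_right])
    then have "matrix (blinfun_apply Y) *v v = Y v" using matrix_vector_mul by metis
    then show ?thesis
      unfolding B_def by (simp add: scaleR_matrix_vector_assoc[symmetric] matrix_vector_mult_diff_rdistrib)
  qed
  have "sym_posdef B"
    unfolding sym_posdef_def
  proof (intro conjI allI impI)
    have sB: "(B *v u) \<bullet> v = u \<bullet> (B *v v)" for u v
      using Y(1) by (simp add: Bv S_def inner_diff_left inner_diff_right)
    show "transpose B = B"
    proof -
      have "(B *v axis j 1) \<bullet> axis i 1 = axis j 1 \<bullet> (B *v axis i 1)" for i j by (rule sB)
      then have "B $ i $ j = B $ j $ i" for i j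
        by (simp add: inner_axis inner_axis' matrix_vector_mult_basis column_def)
      then show ?thesis by (simp add: transpose_def vec_eq_iff)
    qed
    fix v :: "real^'n" assume v: "v \<noteq> 0"
    have "norm Y \<le> q" using Y(1) by (simp add: S_def)
    then have "norm (Y v) \<le> q * norm v" using norm_blinfun[of Y v] by (meson mult_right_mono norm_ge_zero order_trans)
    then have "v \<bullet> Y v \<le> q * (norm v)\<^sup>2"
      using norm_cauchy_schwarz[of v "Y v"] mult_left_mono[of "norm (Y v)" "q * norm v" "norm v"]
      by (simp add: power2_eq_square mult_ac)
    moreover have "q * (norm v)\<^sup>2 < (norm v)\<^sup>2" using q v by simp
    ultimately have "v \<bullet> v - v \<bullet> Y v > 0" by (simp add: power2_norm_eq_inner)
    then show "v \<bullet> (B *v v) > 0" using l by (simp add: Bv inner_diff_right)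
  qed
  moreover have "B ** B = A"
  proof -
    have "(B ** B) *v v = A *v v" for v
    proof -
      \<comment> \<open>The fixed point equation 2 Y = X + Y^2 says (1 - Y)^2 = 1 - X, which is A /
        l.\<close>
      have "Y v = (1/2) *\<^sub>R (X v + Y (Y v))"
      proof -
        have "Y v = T Y v" using Y(2) by simp
        then show ?thesis by (simp add: T_def scaleR_blinfun.rep_eq plus_blinfun.rep_eq)
      qed
      then have "2 *\<^sub>R Y v = X v + Y (Y v)" by (metis scaleR_half_double scaleR_2 scaleR_add_right)
      then have *: "Y v + Y v = v - (1 / l) *\<^sub>R (A *v v) + Y (Y v)" by (simp add: X scaleR_2)
      have "(B ** B) *v v = B *v (B *v v)" by (simp add: matrix_vector_mul_assoc)
      also have "\<dots> = l *\<^sub>R (v - (Y v + Y v) + Y (Y v))"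
        using l by (simp add: Bv blinfun.scaleR_right blinfun.diff_right algebra_simps)
      also have "\<dots> = A *v v" unfolding * using l by (simp add: algebra_simps)
      finally show ?thesis .
    qed
    then show ?thesis by (simp add: matrix_eq)
  qed
  ultimately show ?thesis using that by blast
qed

lemma msqrt:
  assumes "sym_posdef A"
  shows "sym_posdef (msqrt A)" "msqrt A ** msqrt A = A"
proof -
  obtain B where B: "sym_posdef B" "B ** B = A" using sym_posdef_sqrt_exists[OF assms] by blast
  have "\<exists>!B. sym_posdef B \<and> B ** B = A"
    using B sym_posdef_sqrt_unique by (intro ex1I[of _ B]) auto
  from theI'[OF this] show "sym_posdef (msqrt A)" "msqrt A ** msqrt A = A"
    unfolding msqrt_def by auto
qed

lemma sym_posdef_inv:
  fixes A :: "real^'n^'n"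
  assumes "sym_posdef A"
  shows "A ** matrix_inv A = mat 1" "matrix_inv A ** A = mat 1"
proof -
  have "v = 0" if "A *v v = 0" for v
    using assms that by (auto simp: sym_posdef_def)
  then have "invertible A" by (simp add: invertible_left_inverse matrix_left_invertible_ker)
  then have "A ** matrix_inv A = mat 1 \<and> matrix_inv A ** A = mat 1"
    unfolding invertible_def matrix_inv_def by (rule someI_ex)
  then show "A ** matrix_inv A = mat 1" "matrix_inv A ** A = mat 1" by auto
qed

text \<open>For a completion Ft and Y = sym(A^-1 Ft A^-1) one has sym Ft = A Y A, so |sym Ft| <=
  |A|^2 |Y|. As F is symmetric, it is the upper left block of sym Ft, whence |F| <= |sym Ft|. The
  constant depends on \<open>W\<close> only; the metric enters through
  \<open>\<tau>\<close>.\<close>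

lemma Q2_coercive:
  assumes "admissible_W W"
  obtains c where "c > 0" "\<And>G x F \<tau>. sym_posdef (G (pt3 x 0)) \<Longrightarrow> trace (G (pt3 x 0)) \<le> \<tau> \<Longrightarrow> transpose F = F
    \<Longrightarrow> c * (norm F)\<^sup>2 \<le> \<tau>\<^sup>2 * Q2 W G x F"
proof -
  obtain c where c: "c > 0" "\<And>F. c * (norm (symm F))\<^sup>2 \<le> Q3 W F" using Q3_coercive[OF assms] by blast
  have "c * (norm F)\<^sup>2 \<le> \<tau>\<^sup>2 * Q2 W G x F"
    if G: "sym_posdef (G (pt3 x 0))" and \<tau>: "trace (G (pt3 x 0)) \<le> \<tau>" and F: "transpose F = F" for G x F \<tau>
  proof -
    define A where "A = msqrt (G (pt3 x 0))"
    have A: "sym_posdef A" "A ** A = G (pt3 x 0)" using msqrt[OF G] by (auto simp: A_def)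
    have sA: "transpose A = A" using A(1) by (simp add: sym_posdef_def)
    define Ai where "Ai = matrix_inv A"
    have inv: "A ** Ai = mat 1" "Ai ** A = mat 1" using sym_posdef_inv[OF A(1)] by (auto simp: Ai_def)
    have sAi: "transpose Ai = Ai"
    proof -
      have "transpose Ai ** A = mat 1" using arg_cong[OF inv(1), of transpose] by (simp add: matrix_transpose_mul sA transpose_mat)
      then have "transpose Ai ** (A ** Ai) = Ai" by (simp add: matrix_mul_assoc)
      then show ?thesis by (simp add: inv)
    qed
    \<comment> \<open>The squared Frobenius norm of the symmetric root is the trace of the
      metric.\<close>
    have nA: "(norm A)\<^sup>2 \<le> \<tau>"
    proof -
      have "(norm A)\<^sup>2 = trace (transpose A ** A)"
        unfolding matrix_norm_sq trace_def matrix_matrix_mult_def transpose_def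
        by (simp add: power2_eq_square) (rule sum.swap)
      then have "(norm A)\<^sup>2 = trace (A ** A)" unfolding sA .
      then show ?thesis using A(2) \<tau> by simp
    qed
    have "A \<noteq> 0"
    proof
      assume "A = 0"
      then have "(mat 1 :: real^3^3) = 0" using norm_matrix_mult_le[of A Ai] inv(1) by simp
      then have "(mat 1 :: real^3^3) $ 1 $ 1 = 0" by (simp only: zero_index)
      then show False by (simp add: mat_def)
    qed
    then have \<tau>0: "\<tau> > 0" using nA by (meson less_le_trans zero_less_norm_iff zero_less_power)
    have key: "c * (norm F)\<^sup>2 / \<tau>\<^sup>2 \<le> Q3 W (Ai ** Ft ** Ai)" if Ft: "sub22 Ft = F" for Ft
    proof -
      define Y where "Y = symm (Ai ** Ft ** Ai)"
      have "symm Ft = A ** Y ** A"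
      proof -
        have "Y = Ai ** symm Ft ** Ai"
          by (simp add: Y_def symm_def matrix_transpose_mul sAi matrix_mul_assoc matrix_mult_add_left matrix_mult_add_right matrix_mult_scaleR)
        then have "A ** Y ** A = (A ** Ai) ** symm Ft ** (Ai ** A)" by (simp only: matrix_mul_assoc)
        then show ?thesis by (simp add: inv)
      qed
      then have "norm (symm Ft) \<le> norm (A ** Y) * norm A" by (simp only: norm_matrix_mult_le)
      also have "\<dots> \<le> norm A * norm Y * norm A" by (intro mult_right_mono norm_matrix_mult_le) simp
      also have "\<dots> = (norm A)\<^sup>2 * norm Y" by (simp add: power2_eq_square mult_ac)
      also have "\<dots> \<le> \<tau> * norm Y" using nA by (rule mult_right_mono) simp
      finally have Y: "norm (symm Ft) \<le> \<tau> * norm Y" .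
      have "norm F \<le> norm (symm Ft)"
      proof -
        define S where "S = symm Ft"
        have e: "F $ i $ j = S $ emb23 i $ emb23 j" for i j
        proof -
          have "F $ i $ j = Ft $ emb23 i $ emb23 j" "F $ j $ i = Ft $ emb23 j $ emb23 i"
            using Ft by (auto simp: sub22_def)
          moreover have "F $ j $ i = F $ i $ j" by (rule symmetric_matrix_nth[OF F])
          ultimately show ?thesis by (simp add: S_def symm_def transpose_def)
        qed
        have "(norm F)\<^sup>2 \<le> (norm S)\<^sup>2"
          unfolding matrix_norm_sq sum_2 sum_3 e
          using zero_le_power2[of "S $ 1 $ 3"] zero_le_power2[of "S $ 2 $ 3"] zero_le_power2[of "S $ 3 $ 1"]
            zero_le_power2[of "S $ 3 $ 2"] zero_le_power2[of "S $ 3 $ 3"]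
          by (simp add: emb23_def)
        then show ?thesis unfolding S_def by (rule power2_le_imp_le) simp
      qed
      then have "(norm F)\<^sup>2 \<le> (\<tau> * norm Y)\<^sup>2" using Y by (intro power_mono) auto
      then have "c * (norm F)\<^sup>2 \<le> \<tau>\<^sup>2 * (c * (norm Y)\<^sup>2)" using c(1) by (simp add: power_mult_distrib mult.left_commute)
      also have "\<dots> \<le> \<tau>\<^sup>2 * Q3 W (Ai ** Ft ** Ai)" unfolding Y_def by (intro mult_left_mono c) simp
      finally show ?thesis using \<tau>0 by (simp add: pos_divide_le_eq mult.commute)
    qed
    \<comment> \<open>The completion by zeros shows that the infimum is taken over a nonempty set;
      otherwise a common lower bound would say nothing about \<open>Inf\<close>.\<close>
    have "sub22 (\<chi> i j. if i = 3 \<or> j = 3 then 0 else F $ (if i = 1 then 1 else 2) $ (if j = 1 then 1 else 2)) = F"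
      by (simp add: sub22_def emb23_def vec_eq_iff forall_2)
    then have "c * (norm F)\<^sup>2 / \<tau>\<^sup>2 \<le> Q2 W G x F"
      unfolding Q2_def Let_def A_def[symmetric] Ai_def[symmetric] using key by (intro cInf_greatest) auto
    then show ?thesis using \<tau>0 by (simp add: pos_divide_le_eq mult.commute)
  qed
  then show ?thesis using that c(1) by blast
qed

section \<open>Sobolev functions with smooth coefficients\<close>

text \<open>Agreement is asked on \<open>S\<close> rather than on its closure: at boundary points
  \<open>pd f\<close> would depend on values of \<open>f\<close> outside the closure, whereas in
  this form the notion is stable under differentiation on open sets.\<close>

definition smooth_upto :: "(real^2) set \<Rightarrow> (real^2 \<Rightarrow> 'b::real_normed_vector) \<Rightarrow> bool" where
  "smooth_upto S f \<longleftrightarrow> (\<exists>U g. open U \<and> closure S \<subseteq> U \<and> Cinf_on U g \<and> (\<forall>x\<in>S. g x = f x))"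

lemma smooth_uptoE:
  assumes "smooth_upto S f"
  obtains U g where "open U" "closure S \<subseteq> U" "Cinf_on U g" "\<And>x. x \<in> S \<Longrightarrow> g x = f x"
  using assms by (auto simp: smooth_upto_def)

lemma smooth_uptoI:
  "open U \<Longrightarrow> closure S \<subseteq> U \<Longrightarrow> Cinf_on U g \<Longrightarrow> (\<And>x. x \<in> S \<Longrightarrow> g x = f x) \<Longrightarrow> smooth_upto S f"
  unfolding smooth_upto_def by blast

lemma smooth_upto_cong: "smooth_upto S f \<Longrightarrow> (\<And>x. x \<in> S \<Longrightarrow> f x = h x) \<Longrightarrow> smooth_upto S h"
  unfolding smooth_upto_def by metis

lemma Cinf_on_subset: "Cinf_on S f \<Longrightarrow> T \<subseteq> S \<Longrightarrow> Cinf_on T f"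
  unfolding Cinf_on_def using Ck_on_subset by blast

lemma Cinf_on_cong: "open S \<Longrightarrow> (\<And>x. x \<in> S \<Longrightarrow> f x = g x) \<Longrightarrow> Cinf_on S f \<Longrightarrow> Cinf_on S g"
  unfolding Cinf_on_def using Ck_on_cong by blast

lemma smooth_upto_Cinf:
  assumes "open S" "smooth_upto S f"
  shows "Cinf_on S f"
proof -
  obtain U g where U: "open U" "closure S \<subseteq> U" "Cinf_on U g" "\<And>x. x \<in> S \<Longrightarrow> g x = f x"
    using smooth_uptoE[OF assms(2)] by blast
  have "S \<subseteq> U" using U(2) closure_subset by blast
  then show ?thesis using Cinf_on_cong[OF assms(1) U(4) Cinf_on_subset[OF U(3)]] by blast
qed

lemma smooth_upto_bounded:
  assumes "bounded S" "smooth_upto S f"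
  obtains B where "B > 0" "\<And>x. x \<in> S \<Longrightarrow> norm (f x) \<le> B"
proof -
  obtain U g where U: "open U" "closure S \<subseteq> U" "Cinf_on U g" "\<And>x. x \<in> S \<Longrightarrow> g x = f x"
    using smooth_uptoE[OF assms(2)] by blast
  have "compact (g ` closure S)"
    using continuous_on_subset[OF Cinf_on_continuous[OF U(3)] U(2)] assms(1)
    by (intro compact_continuous_image) (auto simp: compact_closure)
  then obtain B where "B > 0" "\<forall>y\<in>g ` closure S. norm y \<le> B"
    using compact_imp_bounded bounded_pos by blast
  then have "norm (f x) \<le> B" if "x \<in> S" for x using U(4)[OF that] closure_subset[of S] that by (metis image_eqI subsetD)
  then show ?thesis using that \<open>B > 0\<close> by blast
qed

lemma smooth_upto_pd:
  assumes S: "open S" and f: "smooth_upto S f"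
  shows "smooth_upto S (\<lambda>x. pd f v x)"
proof -
  obtain U g where U: "open U" "closure S \<subseteq> U" "Cinf_on U g" "\<And>x. x \<in> S \<Longrightarrow> g x = f x"
    using smooth_uptoE[OF f] by blast
  show ?thesis
    by (rule smooth_uptoI[OF U(1,2) Cinf_on_pd[OF U(3,1), of v]]) (rule pd_cong_open[OF S _ U(4)])
qed

lemma smooth_upto_const: "smooth_upto S (\<lambda>x. c)"
  by (rule smooth_uptoI[of UNIV _ "\<lambda>x. c"]) (auto simp: Cinf_on_def Ck_on_const)

lemma smooth_upto_linear:
  assumes L: "bounded_linear L" and f: "smooth_upto S f"
  shows "smooth_upto S (\<lambda>x. L (f x))"
proof -
  obtain U g where U: "open U" "closure S \<subseteq> U" "Cinf_on U g" "\<And>x. x \<in> S \<Longrightarrow> g x = f x"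
    using smooth_uptoE[OF f] by blast
  have "Cinf_on U (\<lambda>x. L (g x))"
    using U(3) Ck_on_bounded_linear[OF L U(1)] by (simp add: Cinf_on_def)
  then show ?thesis by (rule smooth_uptoI[OF U(1,2)]) (simp add: U(4))
qed

lemma smooth_upto_bilinear:
  assumes B: "bounded_bilinear B" and f: "smooth_upto S f" and h: "smooth_upto S h"
  shows "smooth_upto S (\<lambda>x. B (f x) (h x))"
proof -
  obtain U g where U: "open U" "closure S \<subseteq> U" "Cinf_on U g" "\<And>x. x \<in> S \<Longrightarrow> g x = f x"
    using smooth_uptoE[OF f] by blast
  obtain U' g' where U': "open U'" "closure S \<subseteq> U'" "Cinf_on U' g'" "\<And>x. x \<in> S \<Longrightarrow> g' x = h x"
    using smooth_uptoE[OF h] by blast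
  have "Cinf_on (U \<inter> U') (\<lambda>x. B (g x) (g' x))"
    using Cinf_on_subset[OF U(3), of "U \<inter> U'"] Cinf_on_subset[OF U'(3), of "U \<inter> U'"]
      Ck_on_bilinear[OF B open_Int[OF U(1) U'(1)]] by (simp add: Cinf_on_def)
  then show ?thesis
    by (rule smooth_uptoI[OF open_Int[OF U(1) U'(1)], rotated]) (use U(2,4) U'(2,4) in auto)
qed

lemmas smooth_upto_mult = smooth_upto_bilinear[OF bounded_bilinear_mult]
lemmas smooth_upto_scaleR = smooth_upto_bilinear[OF bounded_bilinear_scaleR]
lemmas smooth_upto_inner = smooth_upto_bilinear[OF bounded_bilinear_inner]

lemma smooth_upto_add:
  assumes f: "smooth_upto S f" and h: "smooth_upto S h"
  shows "smooth_upto S (\<lambda>x. f x + h x)"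
proof -
  obtain U g where U: "open U" "closure S \<subseteq> U" "Cinf_on U g" "\<And>x. x \<in> S \<Longrightarrow> g x = f x"
    using smooth_uptoE[OF f] by blast
  obtain U' g' where U': "open U'" "closure S \<subseteq> U'" "Cinf_on U' g'" "\<And>x. x \<in> S \<Longrightarrow> g' x = h x"
    using smooth_uptoE[OF h] by blast
  have "Cinf_on (U \<inter> U') (\<lambda>x. g x + g' x)"
    unfolding Cinf_on_def
    using Cinf_on_subset[OF U(3), of "U \<inter> U'"] Cinf_on_subset[OF U'(3), of "U \<inter> U'"]
    by (intro allI Ck_on_add[OF open_Int[OF U(1) U'(1)]]) (auto simp: Cinf_on_def)
  then show ?thesis
    by (rule smooth_uptoI[OF open_Int[OF U(1) U'(1)], rotated]) (use U(2,4) U'(2,4) in auto)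
qed

lemma smooth_upto_diff:
  "smooth_upto S f \<Longrightarrow> smooth_upto S h \<Longrightarrow> smooth_upto S (\<lambda>x. f x - h x)"
  using smooth_upto_add[of S f "\<lambda>x. - h x"] smooth_upto_linear[OF bounded_linear_minus[OF bounded_linear_ident], of S h]
  by simp

text \<open>The uniform lower bound passes to the closure by continuity, and the neighbourhood is
  shrunk to where the extension stays positive; inverses and square roots are then smooth
  there.\<close>

lemma smooth_upto_positive_extension:
  fixes f :: "real^2 \<Rightarrow> real"
  assumes f: "smooth_upto S f" and \<delta>: "\<delta> > 0" "\<And>x. x \<in> S \<Longrightarrow> f x \<ge> \<delta>"
  obtains U g where "open U" "closure S \<subseteq> U" "Cinf_on U g" "\<And>x. x \<in> S \<Longrightarrow> g x = f x" "\<And>x. x \<in> U \<Longrightarrow> g x > 0"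
proof -
  obtain U g where U: "open U" "closure S \<subseteq> U" "Cinf_on U g" "\<And>x. x \<in> S \<Longrightarrow> g x = f x"
    using smooth_uptoE[OF f] by blast
  have cont: "continuous_on U g" by (rule Cinf_on_continuous[OF U(3)])
  let ?V = "U \<inter> g -` {0<..}"
  have "open ?V" using continuous_open_preimage[OF cont U(1)] by auto
  moreover have "closure S \<subseteq> ?V"
  proof -
    have "\<delta> \<le> g x" if "x \<in> closure S" for x
      using continuous_ge_on_closure[OF continuous_on_subset[OF cont U(2)] that, of \<delta>] \<delta>(2) U(4) by auto
    then have "0 < g x" if "x \<in> closure S" for x using that \<delta>(1) by (meson less_le_trans)
    then show ?thesis using U(2) by auto
  qed
  ultimately show ?thesis using that[of ?V g] Cinf_on_subset[OF U(3), of ?V] U(4) by auto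
qed

lemma smooth_upto_inverse:
  fixes f :: "real^2 \<Rightarrow> real"
  assumes f: "smooth_upto S f" and \<delta>: "\<delta> > 0" "\<And>x. x \<in> S \<Longrightarrow> f x \<ge> \<delta>"
  shows "smooth_upto S (\<lambda>x. inverse (f x))"
proof -
  obtain U g where U: "open U" "closure S \<subseteq> U" "Cinf_on U g" "\<And>x. x \<in> S \<Longrightarrow> g x = f x" "\<And>x. x \<in> U \<Longrightarrow> g x > 0"
    using smooth_upto_positive_extension[OF assms] by blast
  have "Cinf_on U (\<lambda>x. inverse (g x))"
    unfolding Cinf_on_def
  proof
    show "Ck_on k U (\<lambda>x. inverse (g x))" for k
      using U(3) U(5) by (intro Ck_on_inverse[OF U(1)]) (auto simp: Cinf_on_def less_imp_neq[symmetric])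
  qed
  then show ?thesis by (rule smooth_uptoI[OF U(1,2)]) (simp add: U(4))
qed

lemma smooth_upto_sqrt:
  fixes f :: "real^2 \<Rightarrow> real"
  assumes f: "smooth_upto S f" and \<delta>: "\<delta> > 0" "\<And>x. x \<in> S \<Longrightarrow> f x \<ge> \<delta>"
  shows "smooth_upto S (\<lambda>x. sqrt (f x))"
proof -
  obtain U g where U: "open U" "closure S \<subseteq> U" "Cinf_on U g" "\<And>x. x \<in> S \<Longrightarrow> g x = f x" "\<And>x. x \<in> U \<Longrightarrow> g x > 0"
    using smooth_upto_positive_extension[OF assms] by blast
  have "Cinf_on U (\<lambda>x. sqrt (g x))"
    unfolding Cinf_on_def
  proof
    show "Ck_on k U (\<lambda>x. sqrt (g x))" for k
      using U(3) U(5) by (intro Ck_on_sqrt[OF U(1)]) (auto simp: Cinf_on_def)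
  qed
  then show ?thesis by (rule smooth_uptoI[OF U(1,2)]) (simp add: U(4))
qed

section \<open>Square integrable functions and Sobolev pairs\<close>

lemma set_borel_measurable_norm_sq:
  fixes h :: "'a \<Rightarrow> 'b::{banach,second_countable_topology}"
  assumes "set_borel_measurable M U h"
  shows "(\<lambda>x. indicator U x * (norm (h x))\<^sup>2) \<in> borel_measurable M"
proof -
  have "(\<lambda>x. (norm (indicator U x *\<^sub>R h x))\<^sup>2) \<in> borel_measurable M"
    using measurable_compose[OF assms[unfolded set_borel_measurable_def] borel_measurable_norm]
    by (rule borel_measurable_power)
  moreover have "(norm (indicator U x *\<^sub>R h x))\<^sup>2 = indicator U x * (norm (h x))\<^sup>2" for x
    by (simp add: indicator_def)
  ultimately show ?thesis by (simp only:)
qed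

lemma L2_bound:
  fixes f :: "real^'n \<Rightarrow> real^'m" and h :: "real^'n \<Rightarrow> real^'k"
  assumes f: "L2 U f" and h: "set_borel_measurable lebesgue U h"
    and le: "\<And>x. x \<in> U \<Longrightarrow> norm (h x) \<le> K * norm (f x)"
  shows "L2 U h"
  unfolding L2_def
proof
  show "set_borel_measurable lebesgue U h" by (rule h)
  have i: "integrable lebesgue (\<lambda>x. K\<^sup>2 * (indicator U x * (norm (f x))\<^sup>2))"
    using f by (simp add: L2_def set_integrable_def)
  note m = set_borel_measurable_norm_sq[OF h]
  show "set_integrable lebesgue U (\<lambda>x. (norm (h x))\<^sup>2)"
    unfolding set_integrable_def real_scaleR_def
  proof (rule Bochner_Integration.integrable_bound[OF i m], rule AE_I2)
    fix x
    show "norm (indicator U x * (norm (h x))\<^sup>2) \<le> norm (K\<^sup>2 * (indicator U x * (norm (f x))\<^sup>2))"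
    proof (cases "x \<in> U")
      case True
      have "(norm (h x))\<^sup>2 \<le> (K * norm (f x))\<^sup>2" using le[OF True] by (rule power_mono) simp
      then show ?thesis using True by (simp add: power_mult_distrib)
    qed simp
  qed
qed

lemma L2_add:
  fixes f h :: "real^'n \<Rightarrow> real^'m"
  assumes f: "L2 U f" and h: "L2 U h"
  shows "L2 U (\<lambda>x. f x + h x)"
  unfolding L2_def
proof
  have "(\<lambda>x. indicator U x *\<^sub>R f x + indicator U x *\<^sub>R h x) \<in> borel_measurable lebesgue"
    using f h by (intro borel_measurable_add) (auto simp: L2_def set_borel_measurable_def)
  then show m: "set_borel_measurable lebesgue U (\<lambda>x. f x + h x)"
    by (simp add: set_borel_measurable_def scaleR_add_right)
  have i: "integrable lebesgue (\<lambda>x. 2 * (indicator U x * (norm (f x))\<^sup>2) + 2 * (indicator U x * (norm (h x))\<^sup>2))"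
    using f h by (simp add: L2_def set_integrable_def)
  note m' = set_borel_measurable_norm_sq[OF m]
  show "set_integrable lebesgue U (\<lambda>x. (norm (f x + h x))\<^sup>2)"
    unfolding set_integrable_def real_scaleR_def
  proof (rule Bochner_Integration.integrable_bound[OF i m'], rule AE_I2)
    fix x
    show "norm (indicator U x * (norm (f x + h x))\<^sup>2) \<le> norm (2 * (indicator U x * (norm (f x))\<^sup>2) + 2 * (indicator U x * (norm (h x))\<^sup>2))"
      using norm_diff_sq_le[of "f x" "- h x" 0] by (simp add: indicator_def)
  qed
qed

lemma L2_bilinear:
  fixes f :: "real^2 \<Rightarrow> real^'m" and a :: "real^2 \<Rightarrow> 'b::euclidean_space" and B :: "'b \<Rightarrow> real^'m \<Rightarrow> real^'k"
  assumes S: "open S" "bounded S" and B: "bounded_bilinear B" and a: "smooth_upto S a" and f: "L2 S f"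
  shows "L2 S (\<lambda>x. B (a x) (f x))"
proof -
  interpret B: bounded_bilinear B by (rule B)
  obtain K where K: "K > 0" "\<And>u v. norm (B u v) \<le> norm u * norm v * K" using B.pos_bounded by blast
  obtain D where D: "D > 0" "\<And>x. x \<in> S \<Longrightarrow> norm (a x) \<le> D" using smooth_upto_bounded[OF S(2) a] by blast
  have am: "(\<lambda>x. indicator S x *\<^sub>R a x) \<in> borel_measurable lebesgue"
    using borel_measurable_continuous_on_indicator[OF _ Cinf_on_continuous[OF smooth_upto_Cinf[OF S(1) a]]] S(1)
    by (intro measurable_completion) auto
  have fm: "(\<lambda>x. indicator S x *\<^sub>R f x) \<in> borel_measurable lebesgue"
    using f by (simp add: L2_def set_borel_measurable_def)
  have "continuous_on UNIV (\<lambda>p. B (fst p) (snd p))"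
    by (intro B.continuous_on continuous_intros)
  then have "(\<lambda>x. B (indicator S x *\<^sub>R a x) (indicator S x *\<^sub>R f x)) \<in> borel_measurable lebesgue"
    using borel_measurable_continuous_Pair[OF am fm, of B] by (simp add: case_prod_beta')
  moreover have "B (indicator S x *\<^sub>R a x) (indicator S x *\<^sub>R f x) = indicator S x *\<^sub>R B (a x) (f x)" for x
    by (simp add: indicator_def B.zero_left)
  ultimately have m: "set_borel_measurable lebesgue S (\<lambda>x. B (a x) (f x))"
    by (simp only: set_borel_measurable_def)
  have "norm (B (a x) (f x)) \<le> (D * K) * norm (f x)" if "x \<in> S" for x
  proof -
    have "norm (B (a x) (f x)) \<le> norm (a x) * norm (f x) * K" by (rule K)
    also have "\<dots> \<le> D * norm (f x) * K" using D(2)[OF that] K(1) by (intro mult_right_mono) auto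
    finally show ?thesis by (simp add: mult_ac)
  qed
  then show ?thesis using L2_bound[OF f m] by blast
qed

text \<open>Smoothness up to the boundary of a bounded set bounds the coefficient and its
  derivatives, which keeps all products square integrable.\<close>

lemma sobolev_bilinear:
  fixes f :: "real^2 \<Rightarrow> real^'m" and a :: "real^2 \<Rightarrow> 'b::euclidean_space" and B :: "'b \<Rightarrow> real^'m \<Rightarrow> real^'k"
  assumes S: "open S" "bounded S" and B: "bounded_bilinear B" and a: "smooth_upto S a" and f: "sobolev S f g"
  shows "sobolev S (\<lambda>x. B (a x) (f x)) (\<lambda>i x. B (pd a (axis i 1) x) (f x) + B (a x) (g i x))"
  using f unfolding sobolev_def
  by (auto intro!: L2_add L2_bilinear[OF S B] a smooth_upto_pd[OF S(1)] weak_partial_bilinear[OF S(1) B] smooth_upto_Cinf[OF S(1)])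

lemma sobolev_add:
  "sobolev S f g \<Longrightarrow> sobolev S f' g' \<Longrightarrow> sobolev S (\<lambda>x. f x + f' x) (\<lambda>i x. g i x + g' i x)"
  unfolding sobolev_def by (auto intro!: L2_add weak_partial_add)

lemma sobolev_const:
  fixes c :: "real^'m"
  assumes S: "open S" "bounded S"
  shows "sobolev S (\<lambda>x. c) (\<lambda>i x. 0)"
proof -
  have "integrable lebesgue (indicator S :: _ \<Rightarrow> real)"
    using emeasure_bounded_finite[OF S(2)] S(1) by (simp add: integrable_indicator_iff)
  then have "L2 S (\<lambda>x. c)" for c :: "real^'m"
    unfolding L2_def set_borel_measurable_def set_integrable_def
    by (auto intro!: integrable_mult_left borel_measurable_scaleR borel_measurable_integrable)
  then show ?thesis by (simp add: sobolev_def weak_partial_const)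
qed

lemma sobolev_smooth:
  fixes a :: "real^2 \<Rightarrow> real^'m"
  assumes S: "open S" "bounded S" and a: "smooth_upto S a"
  shows "sobolev S a (\<lambda>i x. pd a (axis i 1) x)"
proof -
  have B: "bounded_bilinear (\<lambda>(v::real^'m) (r::real^1). r $ 1 *\<^sub>R v)"
    by (rule bounded_bilinear.flip[OF bounded_bilinear.comp1[OF bounded_bilinear_scaleR bounded_linear_vec_nth]])
  show ?thesis
    using sobolev_bilinear[OF S B a sobolev_const[OF S, of "1::real^1"]] by simp
qed

lemma sobolev_diff:
  assumes "sobolev S f g" "sobolev S f' g'"
  shows "sobolev S (\<lambda>x. f x - f' x) (\<lambda>i x. g i x - g' i x)"
proof -
  have "L2 S (\<lambda>x. h x - h' x)" if h: "L2 S h" and h': "L2 S h'" for h h' :: "real^'a \<Rightarrow> real^'b"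
  proof -
    have "set_borel_measurable lebesgue S (\<lambda>x. - h' x)"
      using h' by (simp add: L2_def set_borel_measurable_def)
    then have "L2 S (\<lambda>x. - h' x)" using L2_bound[OF h', of "\<lambda>x. - h' x" 1] by simp
    from L2_add[OF h this] show ?thesis by simp
  qed
  then show ?thesis using assms weak_partial_diff unfolding sobolev_def by blast
qed

lemma W22_sobolev:
  assumes "W22 S V"
  obtains h where "sobolev S V (wpd S V)" "\<And>i. sobolev S (wpd S V i) (h i)"
proof -
  have "\<exists>k. sobolev S (wpd S V i) k" for i
  proof -
    have "L2 S (wpd S V i)" "\<forall>j. \<exists>g. weak_partial S (wpd S V i) j g \<and> L2 S g"
      using assms unfolding W22_def W12_def by blast+
    then show ?thesis using choice[of "\<lambda>j g. weak_partial S (wpd S V i) j g \<and> L2 S g"] unfolding sobolev_def by blast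
  qed
  then have "\<exists>h. \<forall>i. sobolev S (wpd S V i) (h i)" by (intro choice) blast
  moreover have "sobolev S V (wpd S V)"
    using assms weak_partial_wpd unfolding W22_def W12_def sobolev_def by blast
  ultimately show ?thesis using that by blast
qed

lemma L2_norm_sq_measurable:
  assumes "L2 S f"
  shows "(\<lambda>x. ennreal ((norm (f x))\<^sup>2) * indicator S x) \<in> borel_measurable lebesgue"
proof -
  have "(\<lambda>x. ennreal (indicator S x * (norm (f x))\<^sup>2)) \<in> borel_measurable lebesgue"
    using assms unfolding L2_def by (intro measurable_compose_rev[OF measurable_ennreal] set_borel_measurable_norm_sq) auto
  moreover have "ennreal (indicator S x * (norm (f x))\<^sup>2) = ennreal ((norm (f x))\<^sup>2) * indicator S x" for x
    by (simp add: indicator_def)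
  ultimately show ?thesis by (simp only:)
qed

section \<open>Rigidity of infinitesimal isometries\<close>

unbundle cross3_syntax

lemma bounded_bilinear_cross3: "bounded_bilinear cross3"
  using bilinear_conv_bounded_bilinear bilinear_cross by blast

lemma norm_cross3_le: "norm (u \<times> v) \<le> norm u * norm v"
proof -
  have "(norm (u \<times> v))\<^sup>2 \<le> (norm u * norm v)\<^sup>2"
    using norm_cross_dot[of u v] zero_le_power2[of "u \<bullet> v"] by linarith
  then show ?thesis by (rule power2_le_imp_le) simp
qed

text \<open>Cramer's rule in three dimensions: expansion in the frame \<open>d1\<close>,
  \<open>d2\<close>, \<open>b\<close>, and in the dual frame of its cross products.\<close>

lemma triple_product_expansion:
  fixes u d1 d2 b :: "real^3"
  shows "(b \<bullet> (d1 \<times> d2)) *\<^sub>R u = (u \<bullet> (d2 \<times> b)) *\<^sub>R d1 + (u \<bullet> (b \<times> d1)) *\<^sub>R d2 + (u \<bullet> (d1 \<times> d2)) *\<^sub>R b"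
    and "(b \<bullet> (d1 \<times> d2)) *\<^sub>R u = (u \<bullet> d1) *\<^sub>R (d2 \<times> b) + (u \<bullet> d2) *\<^sub>R (b \<times> d1) + (u \<bullet> b) *\<^sub>R (d1 \<times> d2)"
  by (simp_all add: cross3_simps forall_3)

lemma cross_inner_eq: "(x \<times> y) \<bullet> z = x \<bullet> (y \<times> z)"
  by (simp add: cross3_simps)

lemma triple_product_swap: "x \<bullet> (y \<times> z) = - (x \<bullet> (z \<times> y))"
  by (simp add: cross3_simps)

lemma eq_if_frame_inner_eq:
  fixes u v d1 d2 b :: "real^3"
  assumes "b \<bullet> (d1 \<times> d2) \<noteq> 0" "u \<bullet> d1 = v \<bullet> d1" "u \<bullet> d2 = v \<bullet> d2" "u \<bullet> b = v \<bullet> b"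
  shows "u = v"
proof -
  have "(b \<bullet> (d1 \<times> d2)) *\<^sub>R u = (b \<bullet> (d1 \<times> d2)) *\<^sub>R v"
    unfolding triple_product_expansion(2) using assms by simp
  then show ?thesis using assms(1) by simp
qed

text \<open>The solution s of s x d1 = V1 and s x d2 = V2. These equations force s . (d2 x b) = b .
  V2, s . (b x d1) = -(b . V1) and s . (d1 x d2) = d2 . V1, which are the frame coefficients up to
  the determinant.\<close>

definition axial :: "real^3 \<Rightarrow> real^3 \<Rightarrow> real^3 \<Rightarrow> real^3 \<Rightarrow> real^3 \<Rightarrow> real^3" where
  "axial d1 d2 b V1 V2 = inverse (b \<bullet> (d1 \<times> d2)) *\<^sub>R ((b \<bullet> V2) *\<^sub>R d1 - (b \<bullet> V1) *\<^sub>R d2 + (d2 \<bullet> V1) *\<^sub>R b)"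

text \<open>Each identity is tested against the three frame vectors; the triple products of s come
  from its formula, and skewness supplies the missing one, s . (d2 x d1) = d1 . V2.\<close>

lemma axial_cross:
  fixes d1 d2 b V1 V2 p :: "real^3"
  assumes \<Delta>: "b \<bullet> (d1 \<times> d2) \<noteq> 0"
    and V: "d1 \<bullet> V1 = 0" "d2 \<bullet> V2 = 0" "d1 \<bullet> V2 + d2 \<bullet> V1 = 0"
    and p: "p \<bullet> d1 = - (V1 \<bullet> b)" "p \<bullet> d2 = - (V2 \<bullet> b)" "p \<bullet> b = 0"
  defines "s \<equiv> axial d1 d2 b V1 V2"
  shows "V1 = s \<times> d1" "V2 = s \<times> d2" "p = s \<times> b"
proof -
  have r: "d1 \<bullet> (d2 \<times> b) = b \<bullet> (d1 \<times> d2)" "d2 \<bullet> (b \<times> d1) = b \<bullet> (d1 \<times> d2)"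
    by (simp_all add: cross3_simps)
  have s: "s \<bullet> (d1 \<times> d2) = d2 \<bullet> V1" "s \<bullet> (d2 \<times> b) = b \<bullet> V2" "s \<bullet> (b \<times> d1) = - (b \<bullet> V1)"
    using \<Delta> by (simp_all add: s_def axial_def inner_add_left inner_diff_left dot_cross_self r)
  have s': "s \<bullet> (d2 \<times> d1) = d1 \<bullet> V2" "s \<bullet> (d1 \<times> b) = b \<bullet> V1" "s \<bullet> (b \<times> d2) = - (b \<bullet> V2)"
    using s V triple_product_swap[of s d2 d1] triple_product_swap[of s d1 b] triple_product_swap[of s b d2]
    by (simp_all add: add_eq_0_iff2)
  show "V1 = s \<times> d1"
    by (rule eq_if_frame_inner_eq[OF \<Delta>]) (use s s' V in \<open>simp_all add: cross_inner_eq dot_cross_self inner_commute[of V1] inner_commute[of V2]\<close>)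
  show "V2 = s \<times> d2"
    by (rule eq_if_frame_inner_eq[OF \<Delta>]) (use s s' V in \<open>simp_all add: cross_inner_eq dot_cross_self inner_commute[of V1] inner_commute[of V2]\<close>)
  show "p = s \<times> b"
    by (rule eq_if_frame_inner_eq[OF \<Delta>]) (use s s' p in \<open>simp_all add: cross_inner_eq dot_cross_self inner_commute[of V1] inner_commute[of V2]\<close>)
qed

text \<open>Pairing the hypothesis with d1 and with d2 gives s1 . (d1 x d2) = 0 and s2 . (d1 x d2) =
  0, so neither vector has a b-component; pairing it with b gives the symmetry.\<close>

lemma curvature_determines_axial_derivative:
  fixes d1 d2 b s1 s2 :: "real^3"
  assumes c: "s1 \<times> d2 = s2 \<times> d1"
  shows "d1 \<bullet> (s2 \<times> b) = d2 \<bullet> (s1 \<times> b)"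
    and "(b \<bullet> (d1 \<times> d2)) *\<^sub>R s1 = - (d2 \<bullet> (s1 \<times> b)) *\<^sub>R d1 + (d1 \<bullet> (s1 \<times> b)) *\<^sub>R d2"
    and "(b \<bullet> (d1 \<times> d2)) *\<^sub>R s2 = - (d2 \<bullet> (s2 \<times> b)) *\<^sub>R d1 + (d1 \<bullet> (s2 \<times> b)) *\<^sub>R d2"
proof -
  have 1: "s1 \<bullet> (d1 \<times> d2) = 0"
  proof -
    have "s1 \<bullet> (d1 \<times> d2) = - ((s1 \<times> d2) \<bullet> d1)" by (simp add: cross3_simps)
    then show ?thesis unfolding c by (simp add: dot_cross_self)
  qed
  have 2: "s2 \<bullet> (d1 \<times> d2) = 0"
  proof -
    have "s2 \<bullet> (d1 \<times> d2) = (s2 \<times> d1) \<bullet> d2" by (simp add: cross3_simps)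
    then show ?thesis unfolding c[symmetric] by (simp add: dot_cross_self)
  qed
  have e: "s \<bullet> (d2 \<times> b) = - (d2 \<bullet> (s \<times> b))" "s \<bullet> (b \<times> d1) = d1 \<bullet> (s \<times> b)" for s
    by (simp_all add: cross3_simps)
  have "d1 \<bullet> (s2 \<times> b) = - ((s2 \<times> d1) \<bullet> b)" "d2 \<bullet> (s1 \<times> b) = - ((s1 \<times> d2) \<bullet> b)" by (simp_all add: cross3_simps)
  then show "d1 \<bullet> (s2 \<times> b) = d2 \<bullet> (s1 \<times> b)" by (simp add: c)
  show "(b \<bullet> (d1 \<times> d2)) *\<^sub>R s1 = - (d2 \<bullet> (s1 \<times> b)) *\<^sub>R d1 + (d1 \<bullet> (s1 \<times> b)) *\<^sub>R d2"
    "(b \<bullet> (d1 \<times> d2)) *\<^sub>R s2 = - (d2 \<bullet> (s2 \<times> b)) *\<^sub>R d1 + (d1 \<bullet> (s2 \<times> b)) *\<^sub>R d2"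
    by (simp_all add: triple_product_expansion(1)[of b d1 d2] 1 2 e)
qed

definition outer :: "real^3 \<Rightarrow> real^3 \<Rightarrow> real^3^3" where
  "outer u v = (\<chi> i j. u $ i * v $ j)"

lemma outer_mult: "outer u v *v w = (v \<bullet> w) *\<^sub>R u"
  by (simp add: outer_def matrix_vector_mult_def inner_vec_def vec_eq_iff sum_distrib_left sum_distrib_right mult_ac)

lemma bounded_bilinear_outer: "bounded_bilinear outer"
proof -
  have "bilinear outer"
    unfolding bilinear_def by (auto intro!: linearI simp: outer_def vec_eq_iff algebra_simps)
  then show ?thesis using bilinear_conv_bounded_bilinear by blast
qed

lemma bounded_bilinear_matrix_vector: "bounded_bilinear ((*v) :: real^3^3 \<Rightarrow> real^3 \<Rightarrow> real^3)"
proof -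
  have "bilinear ((*v) :: real^3^3 \<Rightarrow> real^3 \<Rightarrow> real^3)"
    unfolding bilinear_def
    by (auto intro!: linearI simp: matrix_vector_mult_def vec_eq_iff sum.distrib sum_distrib_left algebra_simps)
  then show ?thesis using bilinear_conv_bounded_bilinear by blast
qed

lemmas smooth_upto_cross = smooth_upto_bilinear[OF bounded_bilinear_cross3]
lemmas smooth_upto_outer = smooth_upto_bilinear[OF bounded_bilinear_outer]

text \<open>\<open>axial\<close> is linear in the two gradient columns, with smooth matrix
  coefficients made of rank-one matrices, so the Leibniz rule for matrix actions applies.\<close>

lemma sobolev_axial:
  assumes S: "open S" "bounded S"
    and d: "smooth_upto S d1" "smooth_upto S d2" "smooth_upto S b"
    and \<delta>: "\<delta> > 0" "\<And>x. x \<in> S \<Longrightarrow> b x \<bullet> (d1 x \<times> d2 x) \<ge> \<delta>"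
    and V: "sobolev S V1 h1" "sobolev S V2 h2"
  shows "\<exists>\<sigma>. sobolev S (\<lambda>x. axial (d1 x) (d2 x) (b x) (V1 x) (V2 x)) \<sigma>"
proof -
  have i: "smooth_upto S (\<lambda>x. inverse (b x \<bullet> (d1 x \<times> d2 x)))"
    by (rule smooth_upto_inverse[OF smooth_upto_inner[OF d(3) smooth_upto_cross[OF d(1,2)]] \<delta>])
  have A: "smooth_upto S (\<lambda>x. inverse (b x \<bullet> (d1 x \<times> d2 x)) *\<^sub>R outer (d1 x) (b x))"
    by (intro smooth_upto_scaleR[OF i] smooth_upto_outer d)
  have B: "smooth_upto S (\<lambda>x. inverse (b x \<bullet> (d1 x \<times> d2 x)) *\<^sub>R (outer (b x) (d2 x) - outer (d2 x) (b x)))"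
    by (intro smooth_upto_scaleR[OF i] smooth_upto_diff smooth_upto_outer d)
  have eq: "(inverse (b x \<bullet> (d1 x \<times> d2 x)) *\<^sub>R outer (d1 x) (b x)) *v V2 x
      + (inverse (b x \<bullet> (d1 x \<times> d2 x)) *\<^sub>R (outer (b x) (d2 x) - outer (d2 x) (b x))) *v V1 x
      = axial (d1 x) (d2 x) (b x) (V1 x) (V2 x)" for x
    by (simp add: axial_def scaleR_matrix_vector_assoc[symmetric] matrix_vector_mult_diff_rdistrib outer_mult algebra_simps)
  show ?thesis
    using sobolev_add[OF sobolev_bilinear[OF S bounded_bilinear_matrix_vector A V(2)]
        sobolev_bilinear[OF S bounded_bilinear_matrix_vector B V(1)]] unfolding eq by blast
qed

section \<open>Integral inequalities in the extended nonnegative reals\<close>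

lemma ennreal_set_integral_le:
  assumes "\<And>x. h x \<ge> (0::real)"
  shows "ennreal (LINT x:U|M. h x) \<le> (\<integral>\<^sup>+x\<in>U. ennreal (h x) \<partial>M)"
proof (cases "set_integrable M U h")
  case True
  then have "(\<integral>\<^sup>+x. ennreal (indicator U x * h x) \<partial>M) = ennreal (LINT x:U|M. h x)"
    unfolding set_integrable_def set_lebesgue_integral_def real_scaleR_def
    using assms by (intro nn_integral_eq_integral) auto
  moreover have "ennreal (indicator U x * h x) = ennreal (h x) * indicator U x" for x by (simp add: indicator_def)
  ultimately show ?thesis by simp
next
  case False
  then show ?thesis by (simp add: set_integrable_def set_lebesgue_integral_def not_integrable_integral_eq)
qed

text \<open>A nonexistent Bochner integral has the value 0, so the bound holds without any
  integrability of the chosen weak derivatives.\<close>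

lemma W22_norm_sq_le:
  "ennreal ((W22_norm U f)\<^sup>2) \<le> (\<integral>\<^sup>+x\<in>U. ennreal ((norm (f x))\<^sup>2) \<partial>lebesgue)
      + (\<Sum>i\<in>UNIV. \<integral>\<^sup>+x\<in>U. ennreal ((norm (wpd U f i x))\<^sup>2) \<partial>lebesgue)
      + (\<Sum>i\<in>UNIV. \<Sum>j\<in>UNIV. \<integral>\<^sup>+x\<in>U. ennreal ((norm (wpd U (wpd U f i) j x))\<^sup>2) \<partial>lebesgue)"
proof -
  let ?I = "\<lambda>h. LINT x:U|lebesgue. (norm (h x))\<^sup>2"
  have nn: "?I h \<ge> 0" for h :: "real^'a \<Rightarrow> real^'b"
    unfolding set_lebesgue_integral_def by (intro Bochner_Integration.integral_nonneg) simp
  have "(W22_norm U f)\<^sup>2 = ?I f + (\<Sum>i\<in>UNIV. ?I (wpd U f i)) + (\<Sum>i\<in>UNIV. \<Sum>j\<in>UNIV. ?I (wpd U (wpd U f i) j))"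
    unfolding W22_norm_def by (intro real_sqrt_pow2 add_nonneg_nonneg sum_nonneg nn)
  then have "ennreal ((W22_norm U f)\<^sup>2) = ennreal (?I f) + (\<Sum>i\<in>UNIV. ennreal (?I (wpd U f i)))
      + (\<Sum>i\<in>UNIV. \<Sum>j\<in>UNIV. ennreal (?I (wpd U (wpd U f i) j)))"
    by (simp add: nn sum_nonneg sum_ennreal)
  then show ?thesis by (simp only:) (intro add_mono sum_mono ennreal_set_integral_le; simp)
qed

lemma nn_integral_AE_le_cmult:
  assumes ae: "AE x in lebesgue. x \<in> S \<longrightarrow> (norm (f x))\<^sup>2 \<le> K * h x" and K: "K \<ge> 0" and h: "\<And>x. h x \<ge> 0"
    and m: "(\<lambda>x. ennreal (h x) * indicator S x) \<in> borel_measurable lebesgue"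
  shows "(\<integral>\<^sup>+x\<in>S. ennreal ((norm (f x))\<^sup>2) \<partial>lebesgue) \<le> ennreal K * (\<integral>\<^sup>+x\<in>S. ennreal (h x) \<partial>lebesgue)"
proof -
  have "(\<integral>\<^sup>+x\<in>S. ennreal ((norm (f x))\<^sup>2) \<partial>lebesgue) \<le> (\<integral>\<^sup>+x. ennreal K * (ennreal (h x) * indicator S x) \<partial>lebesgue)"
  proof (rule nn_integral_mono_AE)
    show "AE x in lebesgue. ennreal ((norm (f x))\<^sup>2) * indicator S x \<le> ennreal K * (ennreal (h x) * indicator S x)"
      using ae by eventually_elim (auto simp: indicator_def ennreal_mult[symmetric] K h intro!: ennreal_leI)
  qed
  then show ?thesis using nn_integral_cmult[OF m] by simp
qed

text \<open>\<open>f\<close> is arbitrary because the integrands built from the bending strain are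
  not shown to be measurable. The integral is a supremum over simple functions below the integrand,
  and each of them can be divided by \<open>k\<close>.\<close>

lemma nn_integral_cmult_le:
  assumes k: "k > 0"
  shows "(\<integral>\<^sup>+x. ennreal k * f x \<partial>M) \<le> ennreal k * (\<integral>\<^sup>+x. f x \<partial>M)"
  unfolding nn_integral_def[of M "\<lambda>x. ennreal k * f x"]
proof (rule SUP_least)
  fix g assume "g \<in> {g. simple_function M g \<and> g \<le> (\<lambda>x. ennreal k * f x)}"
  then have g: "simple_function M g" "\<And>x. g x \<le> ennreal k * f x" by (auto simp: le_fun_def)
  have [measurable]: "g \<in> borel_measurable M" by (rule borel_measurable_simple_function[OF g(1)])
  have 1: "ennreal k * ennreal (1 / k) = 1" using k by (subst ennreal_mult[symmetric]) auto
  have le: "ennreal (1 / k) * g x \<le> f x" for x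
  proof -
    have "ennreal (1 / k) * g x \<le> ennreal (1 / k) * (ennreal k * f x)" by (intro mult_left_mono g) simp
    then show ?thesis using 1 by (simp only: mult.assoc[symmetric] mult.commute[of "ennreal (1 / k)"] mult_1)
  qed
  have "g x = ennreal k * (ennreal (1 / k) * g x)" for x using 1 by (simp only: mult.assoc[symmetric] mult_1)
  then have "(\<integral>\<^sup>+x. g x \<partial>M) = (\<integral>\<^sup>+x. ennreal k * (ennreal (1 / k) * g x) \<partial>M)" by (intro nn_integral_cong) blast
  also have "\<dots> = ennreal k * (\<integral>\<^sup>+x. ennreal (1 / k) * g x \<partial>M)" by (rule nn_integral_cmult) measurable
  also have "\<dots> \<le> ennreal k * (\<integral>\<^sup>+x. f x \<partial>M)" by (intro mult_left_mono nn_integral_mono le) simp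
  finally show "integral\<^sup>S M g \<le> ennreal k * (\<integral>\<^sup>+x. f x \<partial>M)" using nn_integral_eq_simple_integral[OF g(1)] by simp
qed

lemma norm_add_sq_le: "(norm (a + b))\<^sup>2 \<le> 2 * (norm a)\<^sup>2 + 2 * (norm (b::'a::real_normed_vector))\<^sup>2"
  using norm_diff_sq_le[of a "- b" 0] by simp

text \<open>Each derivative is a combination of d1 and d2 with entries of F as coefficients, divided
  by a determinant of size at least \<open>\<delta>\<close>; the factor 2 stems from squaring a sum
  of two terms.\<close>

lemma axial_derivative_bound:
  fixes d1 d2 b s1 s2 :: "real^3" and F :: "real^2^2"
  assumes c: "s1 \<times> d2 = s2 \<times> d1" and \<delta>: "\<delta> > 0" "b \<bullet> (d1 \<times> d2) \<ge> \<delta>" and D: "norm d1 \<le> D" "norm d2 \<le> D"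
    and F: "F $ 1 $ 1 = d1 \<bullet> (s1 \<times> b)" "F $ 1 $ 2 = d1 \<bullet> (s2 \<times> b)"
      "F $ 2 $ 1 = d2 \<bullet> (s1 \<times> b)" "F $ 2 $ 2 = d2 \<bullet> (s2 \<times> b)"
  shows "transpose F = F" "(norm s1)\<^sup>2 + (norm s2)\<^sup>2 \<le> 2 * D\<^sup>2 / \<delta>\<^sup>2 * (norm F)\<^sup>2"
proof -
  note K = curvature_determines_axial_derivative[OF c, of b]
  show "transpose F = F" using K(1) F by (simp add: transpose_def vec_eq_iff forall_2)
  have *: "\<delta>\<^sup>2 * (norm s)\<^sup>2 \<le> 2 * D\<^sup>2 * (p\<^sup>2 + q\<^sup>2)"
    if "(b \<bullet> (d1 \<times> d2)) *\<^sub>R s = - p *\<^sub>R d1 + q *\<^sub>R d2" for s p q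
  proof -
    have "\<delta> * norm s \<le> norm ((b \<bullet> (d1 \<times> d2)) *\<^sub>R s)" using \<delta> by (simp add: mult_right_mono)
    then have "(\<delta> * norm s)\<^sup>2 \<le> (norm (- p *\<^sub>R d1 + q *\<^sub>R d2))\<^sup>2" unfolding that using \<delta>(1) by (intro power_mono) auto
    also have "\<dots> \<le> 2 * (norm (- p *\<^sub>R d1))\<^sup>2 + 2 * (norm (q *\<^sub>R d2))\<^sup>2" by (rule norm_add_sq_le)
    also have "\<dots> = 2 * (p\<^sup>2 * (norm d1)\<^sup>2) + 2 * (q\<^sup>2 * (norm d2)\<^sup>2)" by (simp add: power_mult_distrib)
    also have "\<dots> \<le> 2 * (p\<^sup>2 * D\<^sup>2) + 2 * (q\<^sup>2 * D\<^sup>2)" using D by (intro add_mono mult_left_mono power_mono) auto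
    finally show ?thesis by (simp add: power_mult_distrib algebra_simps)
  qed
  have "\<delta>\<^sup>2 * ((norm s1)\<^sup>2 + (norm s2)\<^sup>2) \<le> 2 * D\<^sup>2 * (norm F)\<^sup>2"
    using *[OF K(2)] *[OF K(3)] by (simp add: matrix_norm_sq sum_2 F algebra_simps)
  then show "(norm s1)\<^sup>2 + (norm s2)\<^sup>2 \<le> 2 * D\<^sup>2 / \<delta>\<^sup>2 * (norm F)\<^sup>2"
    using \<delta>(1) by (simp add: pos_le_divide_eq mult.commute)
qed

lemma cross_matrix_skew:
  obtains M where "M \<in> so3" "\<And>z. M *v z = c \<times> z"
proof
  let ?M = "matrix ((\<times>) c)"
  have M: "?M *v z = c \<times> z" for z
  proof -
    have "linear ((\<times>) c)" using bilinear_cross unfolding bilinear_def by blast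
    then show ?thesis using matrix_vector_mul(2) by metis
  qed
  then show "\<And>z. ?M *v z = c \<times> z" .
  show "?M \<in> so3"
    by (simp add: so3_def transpose_def matrix_def vec_eq_iff forall_3 cross3_def axis_def)
qed

text \<open>Stated for an arbitrary frame, smooth up to the boundary, whose determinant is bounded
  below. The metric does not appear, and \<open>p\<close> and \<open>F\<close> enter only through
  the equations that they satisfy.\<close>

theorem infinitesimal_rigidity:
  fixes y0 b :: "real^2 \<Rightarrow> real^3"
  assumes bd: "bounded S" and conn: "connected S" and lip: "lipschitz_domain S"
    and y: "smooth_upto S y0" and b: "smooth_upto S b"
    and \<delta>: "\<delta> > 0" "\<And>x. x \<in> S \<Longrightarrow> b x \<bullet> (pd y0 (axis 1 1) x \<times> pd y0 (axis 2 1) x) \<ge> \<delta>"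
  obtains C :: real where "C > 0" "\<And>V p F. W22 S V \<Longrightarrow>
     (AE x in lebesgue. x \<in> S \<longrightarrow> (\<forall>i j. pd y0 (axis i 1) x \<bullet> wpd S V j x + pd y0 (axis j 1) x \<bullet> wpd S V i x = 0)) \<Longrightarrow>
     (\<And>x. x \<in> S \<Longrightarrow> (\<forall>i. p x \<bullet> pd y0 (axis i 1) x = - (wpd S V i x \<bullet> b x)) \<and> p x \<bullet> b x = 0) \<Longrightarrow>
     (\<And>x i j. x \<in> S \<Longrightarrow> F x $ i $ j = pd y0 (axis i 1) x \<bullet> wpd S p j x + wpd S V i x \<bullet> pd b (axis j 1) x) \<Longrightarrow>
     (AE x in lebesgue. x \<in> S \<longrightarrow> transpose (F x) = F x) \<and>
     (\<exists>M\<in>so3. \<exists>c. ennreal ((W22_norm S (\<lambda>x. V x - (M *v y0 x + c)))\<^sup>2)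
        \<le> ennreal C * (\<integral>\<^sup>+x\<in>S. ennreal ((norm (F x :: real^2^2))\<^sup>2) \<partial>lebesgue))"
proof -
  have oS: "open S" using lip by (simp add: lipschitz_domain_def)
  note S = oS bd
  define d where "d i = (\<lambda>x. pd y0 (axis i 1) x)" for i :: 2
  have sd: "smooth_upto S (d i)" for i unfolding d_def by (rule smooth_upto_pd[OF oS y])
  have sdd: "smooth_upto S (\<lambda>x. pd (d i) (axis j 1) x)" for i j by (rule smooth_upto_pd[OF oS sd])
  obtain B1 where B1: "B1 > 0" "\<And>x. x \<in> S \<Longrightarrow> norm (d 1 x) \<le> B1" using smooth_upto_bounded[OF bd sd] by blast
  obtain B2 where B2: "B2 > 0" "\<And>x. x \<in> S \<Longrightarrow> norm (d 2 x) \<le> B2" using smooth_upto_bounded[OF bd sd] by blast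
  have "\<forall>i j. \<exists>B. \<forall>x\<in>S. norm (pd (d i) (axis j 1) x) \<le> B" using smooth_upto_bounded[OF bd sdd] by metis
  then obtain B3 where B3: "\<And>i j x. x \<in> S \<Longrightarrow> norm (pd (d i) (axis j 1) x) \<le> B3 i j" by metis
  \<comment> \<open>A common bound for the frame vectors and their derivatives; the absolute values
    are there because nothing is known about the signs of the chosen bounds
    \<open>B3\<close>.\<close>
  define D where "D = B1 + B2 + (\<bar>B3 1 1\<bar> + \<bar>B3 1 2\<bar> + \<bar>B3 2 1\<bar> + \<bar>B3 2 2\<bar>)"
  have D0: "D > 0" using B1(1) B2(1) by (simp add: D_def)
  have D1: "norm (d i x) \<le> D" if "x \<in> S" for i x
    using B1(1) B2(1) B1(2)[OF that] B2(2)[OF that] exhaust_2[of i] by (auto simp: D_def)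
  have D2: "norm (pd (d i) (axis j 1) x) \<le> D" if "x \<in> S" for i j x
    using B1(1) B2(1) B3[OF that, of i j] exhaust_2[of i] exhaust_2[of j] by (auto simp: D_def)
  obtain P where P: "P \<ge> 0" "\<And>(f::real^2 \<Rightarrow> real^3) g. sobolev S f g \<Longrightarrow>
    \<exists>c. (\<integral>\<^sup>+x\<in>S. ennreal ((norm (f x - c))\<^sup>2) \<partial>lebesgue)
       \<le> ennreal P * (\<integral>\<^sup>+x\<in>S. ennreal (\<Sum>i\<in>UNIV. (norm (g i x))\<^sup>2) \<partial>lebesgue)"
    using poincare_inequality[OF bd conn lip] by blast
  \<comment> \<open>Multiples of D^2 times the integral of |s - a|^2, itself at most P E: 2 P from
    the function, 2 from the gradient, 8 from the four second derivatives, which also contribute 4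
    D^2 E. The last factor passes from E, the energy of s, to the strain.\<close>
  define K where "K = ((2 * P + 10) * P + 4) * D\<^sup>2 * (2 * D\<^sup>2 / \<delta>\<^sup>2)"
  have K: "K \<ge> 0" using P(1) by (simp add: K_def)
  show ?thesis
  proof (rule that[of "K + 1"])
    show "K + 1 > 0" using K by simp
    fix V p :: "real^2 \<Rightarrow> real^3" and F :: "real^2 \<Rightarrow> real^2^2"
    assume V: "W22 S V"
      and sym: "AE x in lebesgue. x \<in> S \<longrightarrow> (\<forall>i j. pd y0 (axis i 1) x \<bullet> wpd S V j x + pd y0 (axis j 1) x \<bullet> wpd S V i x = 0)"
      and p: "\<And>x. x \<in> S \<Longrightarrow> (\<forall>i. p x \<bullet> pd y0 (axis i 1) x = - (wpd S V i x \<bullet> b x)) \<and> p x \<bullet> b x = 0"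
      and F: "\<And>x i j. x \<in> S \<Longrightarrow> F x $ i $ j = pd y0 (axis i 1) x \<bullet> wpd S p j x + wpd S V i x \<bullet> pd b (axis j 1) x"
    obtain h where V1: "sobolev S V (wpd S V)" and V2: "\<And>i. sobolev S (wpd S V i) (h i)"
      using W22_sobolev[OF V] by blast
    define s where "s x = axial (d 1 x) (d 2 x) (b x) (wpd S V 1 x) (wpd S V 2 x)" for x
    obtain \<sigma> where \<sigma>: "sobolev S s \<sigma>"
      using sobolev_axial[OF S sd[of 1] sd[of 2] b \<delta>(1) _ V2[of 1] V2[of 2]] \<delta>(2) unfolding s_def[abs_def] d_def by blast
    have w\<sigma>: "weak_partial S s j (\<sigma> j)" and L\<sigma>: "L2 S s" "L2 S (\<sigma> j)" for j using \<sigma> by (auto simp: sobolev_def)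
    have ae_s: "AE x in lebesgue. x \<in> S \<longrightarrow> (\<forall>i. wpd S V i x = s x \<times> d i x) \<and> p x = s x \<times> b x"
      using sym
    proof eventually_elim
      fix x assume *: "x \<in> S \<longrightarrow> (\<forall>i j. pd y0 (axis i 1) x \<bullet> wpd S V j x + pd y0 (axis j 1) x \<bullet> wpd S V i x = 0)"
      show "x \<in> S \<longrightarrow> (\<forall>i. wpd S V i x = s x \<times> d i x) \<and> p x = s x \<times> b x"
      proof
        assume x: "x \<in> S"
        have q: "d i x \<bullet> wpd S V j x + d j x \<bullet> wpd S V i x = 0" for i j using * x by (simp add: d_def)
        have n: "b x \<bullet> (d 1 x \<times> d 2 x) \<noteq> 0" using \<delta>(1) \<delta>(2)[OF x] by (auto simp: d_def)
        have "d 1 x \<bullet> wpd S V 1 x = 0" "d 2 x \<bullet> wpd S V 2 x = 0" using q[of 1 1] q[of 2 2] by simp_all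
        note A = axial_cross[OF n this q[of 1 2], of "p x"]
        have "p x \<bullet> d 1 x = - (wpd S V 1 x \<bullet> b x)" "p x \<bullet> d 2 x = - (wpd S V 2 x \<bullet> b x)" "p x \<bullet> b x = 0"
          using p[OF x] by (auto simp: d_def)
        from A[OF this] show "(\<forall>i. wpd S V i x = s x \<times> d i x) \<and> p x = s x \<times> b x"
          unfolding forall_2 s_def by blast
      qed
    qed
    note flip = bounded_bilinear.flip[OF bounded_bilinear_cross3]
    have w_d: "weak_partial S (\<lambda>x. s x \<times> d i x) j (\<lambda>x. s x \<times> pd (d i) (axis j 1) x + \<sigma> j x \<times> d i x)" for i j
      by (rule weak_partial_bilinear[OF oS flip smooth_upto_Cinf[OF oS sd] w\<sigma>])
    have w_b: "weak_partial S (\<lambda>x. s x \<times> b x) j (\<lambda>x. s x \<times> pd b (axis j 1) x + \<sigma> j x \<times> b x)" for j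
      by (rule weak_partial_bilinear[OF oS flip smooth_upto_Cinf[OF oS b] w\<sigma>])
    have w_V: "weak_partial S (wpd S V i) j (\<lambda>x. s x \<times> pd (d i) (axis j 1) x + \<sigma> j x \<times> d i x)" for i j
      by (rule weak_partial_cong_AE[OF w_d]) (use ae_s in \<open>auto elim!: eventually_mono\<close>)
    \<comment> \<open>\<open>p\<close> is given only pointwise in terms of \<open>wpd S V\<close>;
      its weak derivative becomes known through the representation \<open>s x b\<close>.\<close>
    have ae_p: "AE x in lebesgue. x \<in> S \<longrightarrow> wpd S p j x = s x \<times> pd b (axis j 1) x + \<sigma> j x \<times> b x" for j
    proof (rule wpd_AE_eq[OF oS], rule weak_partial_cong_AE[OF w_b])
      show "AE x in lebesgue. x \<in> S \<longrightarrow> s x \<times> b x = p x" using ae_s by eventually_elim auto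
    qed simp
    \<comment> \<open>Mixed derivatives of the smooth immersion are interchanged by the weak
      commutation lemma, almost everywhere, which suffices here.\<close>
    have ae_y: "AE x in lebesgue. x \<in> S \<longrightarrow> pd (d 1) (axis 2 1) x = pd (d 2) (axis 1 1) x"
      using weak_partial_commute[OF oS weak_partial_smooth[OF oS smooth_upto_Cinf[OF oS y]] weak_partial_smooth[OF oS smooth_upto_Cinf[OF oS sd[of 1, unfolded d_def]]]
          weak_partial_smooth[OF oS smooth_upto_Cinf[OF oS y]] weak_partial_smooth[OF oS smooth_upto_Cinf[OF oS sd[of 2, unfolded d_def]]]]
      unfolding d_def .
    have wV: "weak_partial S V i (wpd S V i)" for i using V1 by (simp add: sobolev_def)
    \<comment> \<open>The two mixed second derivatives of V are expanded by the Leibniz rule; the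
      terms with undifferentiated s agree by \<open>ae_y\<close> and drop out.\<close>
    have ae_c: "AE x in lebesgue. x \<in> S \<longrightarrow> \<sigma> 1 x \<times> d 2 x = \<sigma> 2 x \<times> d 1 x"
      using weak_partial_commute[OF oS wV w_V[of 1 2] wV w_V[of 2 1]] ae_y by eventually_elim auto
    have ae_F: "AE x in lebesgue. x \<in> S \<longrightarrow> transpose (F x) = F x \<and> (norm (\<sigma> 1 x))\<^sup>2 + (norm (\<sigma> 2 x))\<^sup>2 \<le> 2 * D\<^sup>2 / \<delta>\<^sup>2 * (norm (F x))\<^sup>2"
      using ae_c ae_s ae_p[of 1] ae_p[of 2]
    proof eventually_elim
      case (elim x)
      show ?case
      proof
        assume x: "x \<in> S"
        \<comment> \<open>By antisymmetry of the triple product, (s x d_i) . (d_j b) is the negative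
          of d_i . (s x d_j b), with d_j b the j-th derivative of b; this is the cancellation in the
          strain.\<close>
        have f: "F x $ i $ j = d i x \<bullet> (\<sigma> j x \<times> b x)" for i j
        proof -
          have "wpd S p j x = s x \<times> pd b (axis j 1) x + \<sigma> j x \<times> b x" using elim x exhaust_2[of j] by auto
          moreover have "wpd S V i x = s x \<times> d i x" using elim x by auto
          moreover have "(s x \<times> d i x) \<bullet> pd b (axis j 1) x = - (d i x \<bullet> (s x \<times> pd b (axis j 1) x))" by (simp add: cross3_simps)
          ultimately show ?thesis using F[OF x, of i j] by (simp add: d_def inner_add_right)
        qed
        have c: "\<sigma> 1 x \<times> d 2 x = \<sigma> 2 x \<times> d 1 x" using elim x by blast
        have "b x \<bullet> (d 1 x \<times> d 2 x) \<ge> \<delta>" using \<delta>(2)[OF x] by (simp add: d_def)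
        from axial_derivative_bound[OF c \<delta>(1) this D1[OF x] D1[OF x] f f f f]
        show "transpose (F x) = F x \<and> (norm (\<sigma> 1 x))\<^sup>2 + (norm (\<sigma> 2 x))\<^sup>2 \<le> 2 * D\<^sup>2 / \<delta>\<^sup>2 * (norm (F x))\<^sup>2" by blast
      qed
    qed
    define E where "E = (\<integral>\<^sup>+x\<in>S. ennreal (\<Sum>i\<in>UNIV. (norm (\<sigma> i x))\<^sup>2) \<partial>lebesgue)"
    define IF where "IF = (\<integral>\<^sup>+x\<in>S. ennreal ((norm (F x))\<^sup>2) \<partial>lebesgue)"
    obtain a where a: "(\<integral>\<^sup>+x\<in>S. ennreal ((norm (s x - a))\<^sup>2) \<partial>lebesgue) \<le> ennreal P * E"
      using P(2)[OF \<sigma>] unfolding E_def by blast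
    obtain M where M: "M \<in> so3" "\<And>z. M *v z = a \<times> z" using cross_matrix_skew[of a] by blast
    \<comment> \<open>Subtracting the infinitesimal rotation with axis a replaces s by r in all
      first derivatives, and r is small in L2 by the choice of a.\<close>
    define r where "r x = s x - a" for x
    have Lr: "L2 S r"
      using sobolev_diff[OF \<sigma> sobolev_const[OF S, of a]] by (simp add: sobolev_def r_def[abs_def])
    define u where "u x = V x - a \<times> y0 x" for x
    have ay: "sobolev S (\<lambda>x. a \<times> y0 x) (\<lambda>i x. a \<times> d i x)"
      using sobolev_bilinear[OF S bounded_bilinear_cross3 smooth_upto_const[of S a] sobolev_smooth[OF S y]]
      by (simp add: pd_def d_def)
    have u: "sobolev S u (\<lambda>i x. wpd S V i x - a \<times> d i x)"
      using sobolev_diff[OF V1 ay] by (simp add: u_def[abs_def])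
    obtain c where c: "(\<integral>\<^sup>+x\<in>S. ennreal ((norm (u x - c))\<^sup>2) \<partial>lebesgue)
        \<le> ennreal P * (\<integral>\<^sup>+x\<in>S. ennreal (\<Sum>i\<in>UNIV. (norm (wpd S V i x - a \<times> d i x))\<^sup>2) \<partial>lebesgue)"
      using P(2)[OF u] by blast
    let ?f = "\<lambda>x. V x - (M *v y0 x + c)"
    have fu: "?f = (\<lambda>x. u x - c)" by (auto simp: u_def M)
    have wr: "weak_partial S (\<lambda>x. r x \<times> d i x) j (\<lambda>x. r x \<times> pd (d i) (axis j 1) x + \<sigma> j x \<times> d i x)" for i j
    proof -
      have "weak_partial S r j (\<sigma> j)"
        using weak_partial_diff[OF w\<sigma> weak_partial_const[of S a]] by (simp add: r_def[abs_def])
      then show ?thesis by (rule weak_partial_bilinear[OF oS flip smooth_upto_Cinf[OF oS sd]])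
    qed
    have ae_r: "AE x in lebesgue. x \<in> S \<longrightarrow> wpd S V i x - a \<times> d i x = r x \<times> d i x" for i
      using ae_s by eventually_elim (auto simp: r_def Cross3.left_diff_distrib)
    have w1: "weak_partial S ?f i (\<lambda>x. r x \<times> d i x)" for i
    proof -
      have "weak_partial S (\<lambda>x. u x - c) i (\<lambda>x. (wpd S V i x - a \<times> d i x) - 0)"
        using u by (intro weak_partial_diff weak_partial_const) (simp add: sobolev_def)
      then show ?thesis unfolding fu by (rule weak_partial_cong_AE) (use ae_r in auto)
    qed
    have e1: "AE x in lebesgue. x \<in> S \<longrightarrow> wpd S ?f i x = r x \<times> d i x" for i by (rule wpd_AE_eq[OF oS w1])
    \<comment> \<open>As a is constant, r has the same weak derivatives as s, so the second
      derivatives involve only r and the fields already bounded by the strain.\<close>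
    have e2: "AE x in lebesgue. x \<in> S \<longrightarrow> wpd S (wpd S ?f i) j x = r x \<times> pd (d i) (axis j 1) x + \<sigma> j x \<times> d i x" for i j
    proof (rule wpd_AE_eq[OF oS], rule weak_partial_cong_AE[OF wr])
      show "AE x in lebesgue. x \<in> S \<longrightarrow> r x \<times> d i x = wpd S ?f i x" using e1[of i] by eventually_elim auto
    qed simp
    define R where "R = (\<integral>\<^sup>+x\<in>S. ennreal ((norm (r x))\<^sup>2) \<partial>lebesgue)"
    have R: "R \<le> ennreal P * E" using a by (simp add: R_def r_def)
    have mr: "(\<lambda>x. ennreal ((norm (r x))\<^sup>2) * indicator S x) \<in> borel_measurable lebesgue" by (rule L2_norm_sq_measurable[OF Lr])
    have m\<sigma>: "(\<lambda>x. ennreal ((norm (\<sigma> j x))\<^sup>2) * indicator S x) \<in> borel_measurable lebesgue" for j by (rule L2_norm_sq_measurable[OF L\<sigma>(2)])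
    have cr: "(norm (v \<times> w))\<^sup>2 \<le> D\<^sup>2 * (norm v)\<^sup>2" if "norm w \<le> D" for v w :: "real^3"
    proof -
      have "norm (v \<times> w) \<le> D * norm v"
        using norm_cross3_le[of v w] mult_left_mono[OF that, of "norm v"] by (simp add: mult.commute)
      then have "(norm (v \<times> w))\<^sup>2 \<le> (D * norm v)\<^sup>2" by (rule power_mono) simp
      then show ?thesis by (simp add: power_mult_distrib)
    qed
    have t1: "(\<integral>\<^sup>+x\<in>S. ennreal ((norm (g x))\<^sup>2) \<partial>lebesgue) \<le> ennreal (D\<^sup>2) * R"
      if "AE x in lebesgue. x \<in> S \<longrightarrow> g x = r x \<times> d i x" for g i
      unfolding R_def
    proof (rule nn_integral_AE_le_cmult[OF _ _ _ mr])
      show "AE x in lebesgue. x \<in> S \<longrightarrow> (norm (g x))\<^sup>2 \<le> D\<^sup>2 * (norm (r x))\<^sup>2"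
        using that by eventually_elim (auto intro: cr D1)
    qed auto
    have t2: "(\<integral>\<^sup>+x\<in>S. ennreal ((norm (wpd S (wpd S ?f i) j x))\<^sup>2) \<partial>lebesgue) \<le> ennreal (2 * D\<^sup>2) * (R + J j)"
      if J: "\<And>j. J j = (\<integral>\<^sup>+x\<in>S. ennreal ((norm (\<sigma> j x))\<^sup>2) \<partial>lebesgue)" for i j J
    proof -
      have eqm: "ennreal ((norm (r x))\<^sup>2 + (norm (\<sigma> j x))\<^sup>2) * indicator S x
        = ennreal ((norm (r x))\<^sup>2) * indicator S x + ennreal ((norm (\<sigma> j x))\<^sup>2) * indicator S x" for x
        by (simp add: distrib_right)
      have "(\<integral>\<^sup>+x\<in>S. ennreal ((norm (wpd S (wpd S ?f i) j x))\<^sup>2) \<partial>lebesgue)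
        \<le> ennreal (2 * D\<^sup>2) * (\<integral>\<^sup>+x\<in>S. ennreal ((norm (r x))\<^sup>2 + (norm (\<sigma> j x))\<^sup>2) \<partial>lebesgue)"
      proof (rule nn_integral_AE_le_cmult)
        show "AE x in lebesgue. x \<in> S \<longrightarrow> (norm (wpd S (wpd S ?f i) j x))\<^sup>2 \<le> 2 * D\<^sup>2 * ((norm (r x))\<^sup>2 + (norm (\<sigma> j x))\<^sup>2)"
          using e2[of i j]
        proof eventually_elim
          fix x assume *: "x \<in> S \<longrightarrow> wpd S (wpd S ?f i) j x = r x \<times> pd (d i) (axis j 1) x + \<sigma> j x \<times> d i x"
          show "x \<in> S \<longrightarrow> (norm (wpd S (wpd S ?f i) j x))\<^sup>2 \<le> 2 * D\<^sup>2 * ((norm (r x))\<^sup>2 + (norm (\<sigma> j x))\<^sup>2)"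
          proof
            assume x: "x \<in> S"
            have "(norm (wpd S (wpd S ?f i) j x))\<^sup>2 \<le> 2 * (norm (r x \<times> pd (d i) (axis j 1) x))\<^sup>2 + 2 * (norm (\<sigma> j x \<times> d i x))\<^sup>2"
              using * x norm_add_sq_le by auto
            then show "(norm (wpd S (wpd S ?f i) j x))\<^sup>2 \<le> 2 * D\<^sup>2 * ((norm (r x))\<^sup>2 + (norm (\<sigma> j x))\<^sup>2)"
              using cr[OF D2[OF x], of "r x" i j] cr[OF D1[OF x], of "\<sigma> j x" i] by (simp add: algebra_simps)
          qed
        qed
        show "(\<lambda>x. ennreal ((norm (r x))\<^sup>2 + (norm (\<sigma> j x))\<^sup>2) * indicator S x) \<in> borel_measurable lebesgue"
          unfolding eqm by (intro borel_measurable_add mr m\<sigma>)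
      qed auto
      also have "(\<integral>\<^sup>+x\<in>S. ennreal ((norm (r x))\<^sup>2 + (norm (\<sigma> j x))\<^sup>2) \<partial>lebesgue) = R + J j"
        unfolding eqm R_def J by (rule nn_integral_add[OF mr m\<sigma>])
      finally show ?thesis .
    qed
    define J where "J j = (\<integral>\<^sup>+x\<in>S. ennreal ((norm (\<sigma> j x))\<^sup>2) \<partial>lebesgue)" for j
    have JE: "J 1 + J 2 = E"
      unfolding J_def E_def by (subst nn_integral_add[OF m\<sigma> m\<sigma>, symmetric]) (simp add: sum_2 distrib_right)
    have t0: "(\<integral>\<^sup>+x\<in>S. ennreal ((norm (?f x))\<^sup>2) \<partial>lebesgue) \<le> ennreal P * (2 * (ennreal (D\<^sup>2) * R))"
    proof -
      have "(\<integral>\<^sup>+x\<in>S. ennreal (\<Sum>i\<in>UNIV. (norm (wpd S V i x - a \<times> d i x))\<^sup>2) \<partial>lebesgue)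
        \<le> ennreal (2 * D\<^sup>2) * R"
      proof -
        have "(\<integral>\<^sup>+x\<in>S. ennreal (\<Sum>i\<in>UNIV. (norm (wpd S V i x - a \<times> d i x))\<^sup>2) \<partial>lebesgue)
          \<le> (\<integral>\<^sup>+x. ennreal (2 * D\<^sup>2) * (ennreal ((norm (r x))\<^sup>2) * indicator S x) \<partial>lebesgue)"
        proof (rule nn_integral_mono_AE)
          show "AE x in lebesgue. ennreal (\<Sum>i\<in>UNIV. (norm (wpd S V i x - a \<times> d i x))\<^sup>2) * indicator S x
            \<le> ennreal (2 * D\<^sup>2) * (ennreal ((norm (r x))\<^sup>2) * indicator S x)"
            using ae_r[of 1] ae_r[of 2]
          proof eventually_elim
            case (elim x)
            show ?case
            proof (cases "x \<in> S")
              case True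
              have "(\<Sum>i\<in>UNIV. (norm (wpd S V i x - a \<times> d i x))\<^sup>2) \<le> 2 * D\<^sup>2 * (norm (r x))\<^sup>2"
                using elim True cr[OF D1[OF True], of "r x" 1] cr[OF D1[OF True], of "r x" 2] by (simp add: sum_2)
              then show ?thesis using True by (simp add: ennreal_mult[symmetric] ennreal_leI)
            qed simp
          qed
        qed
        then show ?thesis unfolding R_def using nn_integral_cmult[OF mr] by simp
      qed
      then have "ennreal P * (\<integral>\<^sup>+x\<in>S. ennreal (\<Sum>i\<in>UNIV. (norm (wpd S V i x - a \<times> d i x))\<^sup>2) \<partial>lebesgue)
          \<le> ennreal P * (2 * (ennreal (D\<^sup>2) * R))" by (intro mult_left_mono) (simp_all add: ennreal_mult mult.assoc)
      moreover have "?f x = u x - c" for x by (simp add: u_def M)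
      ultimately show ?thesis using c by (simp only:)
    qed
    have EF: "E \<le> ennreal (2 * D\<^sup>2 / \<delta>\<^sup>2) * IF"
    proof -
      let ?k = "2 * D\<^sup>2 / \<delta>\<^sup>2"
      have k: "?k > 0" using D0 \<delta>(1) by simp
      have "E \<le> (\<integral>\<^sup>+x. ennreal ?k * (ennreal ((norm (F x))\<^sup>2) * indicator S x) \<partial>lebesgue)"
        unfolding E_def
      proof (rule nn_integral_mono_AE)
        show "AE x in lebesgue. ennreal (\<Sum>i\<in>UNIV. (norm (\<sigma> i x))\<^sup>2) * indicator S x
            \<le> ennreal ?k * (ennreal ((norm (F x))\<^sup>2) * indicator S x)"
          using ae_F
        proof eventually_elim
          case (elim x)
          show ?case
          proof (cases "x \<in> S")
            case True
            then have "(\<Sum>i\<in>UNIV. (norm (\<sigma> i x))\<^sup>2) \<le> ?k * (norm (F x))\<^sup>2" using elim by (simp add: sum_2)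
            then have "ennreal (\<Sum>i\<in>UNIV. (norm (\<sigma> i x))\<^sup>2) \<le> ennreal (?k * (norm (F x))\<^sup>2)"
              by (rule ennreal_leI)
            then show ?thesis using True k by (subst (asm) ennreal_mult) auto
          qed simp
        qed
      qed
      \<comment> \<open>No measurability of F is among the assumptions, hence the one-sided rule for
        constant factors.\<close>
      also have "\<dots> \<le> ennreal ?k * IF" unfolding IF_def by (rule nn_integral_cmult_le[OF k])
      finally show ?thesis .
    qed
    have "ennreal ((W22_norm S ?f)\<^sup>2) \<le> ennreal P * (2 * (ennreal (D\<^sup>2) * R))
        + (\<Sum>i\<in>(UNIV::2 set). ennreal (D\<^sup>2) * R) + (\<Sum>i\<in>(UNIV::2 set). \<Sum>j\<in>UNIV. ennreal (2 * D\<^sup>2) * (R + J j))"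
      by (rule order_trans[OF W22_norm_sq_le]) (intro add_mono sum_mono t0 t1[OF e1] t2 J_def)
    also have "\<dots> = (2 * ennreal P + 10) * (ennreal (D\<^sup>2) * R) + 4 * (ennreal (D\<^sup>2) * (J 1 + J 2))"
    proof -
      have *: "p * (2 * (e * x)) + (e * x + e * x) + ((2 * e * (x + y) + 2 * e * (x + z)) + (2 * e * (x + y) + 2 * e * (x + z)))
          = (2 * p + 10) * (e * x) + 4 * (e * (y + z))" for p e x y z :: ennreal
        by (simp only: numeral_Bit0 numeral_Bit1 numeral_One distrib_left distrib_right mult_1 mult_ac add_ac)
      have "ennreal (2 * D\<^sup>2) = 2 * ennreal (D\<^sup>2)" by (simp add: ennreal_mult)
      then show ?thesis unfolding sum_2 by (simp only: *)
    qed
    also have "\<dots> = ennreal ((2 * P + 10) * D\<^sup>2) * R + ennreal (4 * D\<^sup>2) * E"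
      using P(1) by (simp add: JE ennreal_mult mult.assoc)
    also have "\<dots> \<le> ennreal ((2 * P + 10) * D\<^sup>2) * (ennreal P * E) + ennreal (4 * D\<^sup>2) * E"
      by (intro add_mono mult_left_mono R) auto
    also have "\<dots> = ennreal (((2 * P + 10) * P + 4) * D\<^sup>2) * E"
    proof -
      have "((2 * P + 10) * P + 4) * D\<^sup>2 = (2 * P + 10) * D\<^sup>2 * P + 4 * D\<^sup>2" by (simp add: algebra_simps)
      then have "ennreal (((2 * P + 10) * P + 4) * D\<^sup>2) = ennreal ((2 * P + 10) * D\<^sup>2) * ennreal P + ennreal (4 * D\<^sup>2)"
        using P(1) by (simp only:) (subst ennreal_plus, simp, simp, subst ennreal_mult, simp_all)
      then show ?thesis by (simp only: distrib_right mult.assoc)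
    qed
    also have "\<dots> \<le> ennreal (((2 * P + 10) * P + 4) * D\<^sup>2) * (ennreal (2 * D\<^sup>2 / \<delta>\<^sup>2) * IF)"
      by (intro mult_left_mono EF) auto
    also have "\<dots> = ennreal K * IF"
      unfolding K_def using P(1) by (subst mult.assoc[symmetric], subst ennreal_mult[symmetric]) auto
    also have "\<dots> \<le> ennreal (K + 1) * IF" by (intro mult_right_mono ennreal_leI) auto
    finally show "(AE x in lebesgue. x \<in> S \<longrightarrow> transpose (F x) = F x) \<and>
     (\<exists>M\<in>so3. \<exists>c. ennreal ((W22_norm S (\<lambda>x. V x - (M *v y0 x + c)))\<^sup>2)
        \<le> ennreal (K + 1) * (\<integral>\<^sup>+x\<in>S. ennreal ((norm (F x))\<^sup>2) \<partial>lebesgue))"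
      using M(1) ae_F unfolding IF_def by (auto elim!: eventually_mono)
  qed
qed

section \<open>The metric and the frame on the midplane\<close>

lemma sym_posdef_det_pos:
  fixes A :: "real^'n^'n"
  assumes "sym_posdef A"
  shows "det A > 0"
proof -
  \<comment> \<open>The determinant of A is the square of the nonzero determinant of its
    root.\<close>
  let ?B = "msqrt A"
  have "det ?B * det (matrix_inv ?B) = 1"
    using sym_posdef_inv(1)[OF msqrt(1)[OF assms]] by (simp add: det_mul[symmetric] det_I)
  then have "det ?B \<noteq> 0" by auto
  then show ?thesis using msqrt(2)[OF assms] det_mul[of ?B ?B] by (metis not_real_square_gt_zero)
qed

lemma sym_posdef_sub22:
  assumes "sym_posdef A"
  shows "sym_posdef (sub22 A)"
  unfolding sym_posdef_def
proof (intro conjI allI impI)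
  have t: "transpose A = A" using assms by (simp add: sym_posdef_def)
  show "transpose (sub22 A) = sub22 A"
    by (simp add: vec_eq_iff transpose_def sub22_def symmetric_matrix_nth[OF t])
  fix v :: "real^2" assume v: "v \<noteq> 0"
  then have "lift3 v \<noteq> 0" by (auto simp: lift3_def vec_eq_iff forall_2 forall_3)
  then have "lift3 v \<bullet> (A *v lift3 v) > 0" using assms by (simp add: sym_posdef_def)
  moreover have "lift3 v \<bullet> (A *v lift3 v) = v \<bullet> (sub22 A *v v)"
    by (simp add: inner_vec_def matrix_vector_mult_def sum_2 sum_3 lift3_def sub22_def emb23_def)
  ultimately show "v \<bullet> (sub22 A *v v) > 0" by simp
qed

lemma pt3_eq_lift3: "pt3 x 0 = lift3 x"
  by (simp add: pt3_def lift3_def)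

lemma bounded_linear_lift3: "bounded_linear lift3"
  unfolding linear_conv_bounded_linear[symmetric]
  by (rule linearI) (auto simp: lift3_def vec_eq_iff)

lemma lift3_closure_plate:
  assumes "x \<in> closure S"
  shows "lift3 x \<in> closure (plate S 1)"
proof -
  have "lift3 ` S \<subseteq> closure (plate S 1)"
  proof -
    have "lift3 y \<in> plate S 1" if "y \<in> S" for y
      unfolding plate_def mem_Collect_eq using that by (intro exI[of _ y] exI[of _ 0]) (auto simp: pt3_eq_lift3)
    then show ?thesis using closure_subset[of "plate S 1"] by auto
  qed
  then have "lift3 ` closure S \<subseteq> closure (plate S 1)"
    by (intro image_closure_subset bounded_linear.continuous_on[OF bounded_linear_lift3] continuous_on_id) auto
  then show ?thesis using assms by auto
qed

text \<open>The embedding \<open>lift3\<close> of the midplane is linear and maps the closure into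
  the closed plate, so a smooth extension of the metric pulls back to a neighbourhood of the
  closure.\<close>

lemma midplane_metric_smooth:
  assumes "Cinf_closure (plate S 1) G"
  shows "smooth_upto S (\<lambda>x. G (pt3 x 0))" "continuous_on (closure S) (\<lambda>x. G (pt3 x 0))"
proof -
  obtain U g where U: "open U" "closure (plate S 1) \<subseteq> U" "Cinf_on U g" "\<forall>x\<in>closure (plate S 1). g x = G x"
    using assms unfolding Cinf_closure_def by blast
  let ?V = "lift3 -` U"
  have V: "open ?V" by (intro open_vimage U(1) bounded_linear.continuous_on[OF bounded_linear_lift3] continuous_on_id)
  have sub: "closure S \<subseteq> ?V" using lift3_closure_plate U(2) by auto
  have C: "Cinf_on ?V (\<lambda>x. g (lift3 x))"
    unfolding Cinf_on_def
  proof
    fix k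
    have "Ck_on k U g" using U(3) by (simp add: Cinf_on_def)
    then show "Ck_on k ?V (\<lambda>x. g (lift3 x))"
      using Ck_on_affine[OF bounded_linear_lift3 V U(1), of 0 k g] by simp
  qed
  have eq: "g (lift3 x) = G (pt3 x 0)" if "x \<in> closure S" for x
    using U(4) lift3_closure_plate[OF that] by (simp add: pt3_eq_lift3)
  show "smooth_upto S (\<lambda>x. G (pt3 x 0))"
    by (rule smooth_uptoI[OF V sub C]) (use eq closure_subset in auto)
  show "continuous_on (closure S) (\<lambda>x. G (pt3 x 0))"
    using continuous_on_subset[OF Cinf_on_continuous[OF C] sub] eq by (simp cong: continuous_on_cong)
qed

lemma positive_lower_bound_on_closure:
  fixes f :: "real^2 \<Rightarrow> real"
  assumes "bounded S" "continuous_on (closure S) f" "\<And>x. x \<in> closure S \<Longrightarrow> f x > 0"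
  obtains \<delta> where "\<delta> > 0" "\<And>x. x \<in> S \<Longrightarrow> f x \<ge> \<delta>"
proof (cases "S = {}")
  case True
  then show ?thesis using that[of 1] by simp
next
  case False
  then have "closure S \<noteq> {}" by simp
  then obtain z where z: "z \<in> closure S" "\<And>x. x \<in> closure S \<Longrightarrow> f z \<le> f x"
    using continuous_attains_inf[OF _ _ assms(2)] assms(1) by (auto simp: compact_closure)
  show ?thesis
  proof (rule that)
    show "f z > 0" by (rule assms(3)[OF z(1)])
    show "f z \<le> f x" if "x \<in> S" for x using z(2) closure_subset[of S] that by blast
  qed
qed

lemma grad_nth: "grad f x $ a $ i = pd f (axis i 1) x $ a"
  by (simp add: grad_def jacobian_def matrix_def pd_def)

lemma transpose_mult_nth:
  fixes A B :: "real^2^3"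
  assumes "\<And>a i. A $ a $ i = u i $ a" "\<And>a i. B $ a $ i = v i $ a"
  shows "(transpose A ** B) $ i $ j = u i \<bullet> v j"
  by (simp add: matrix_matrix_mult_def transpose_def inner_vec_def assms)

text \<open>Lagrange's identity: the squared length of a cross product is the Gram
  determinant.\<close>

lemma frame_normal:
  fixes y0 :: "real^2 \<Rightarrow> real^3"
  assumes "transpose (grad y0 x) ** grad y0 x = M"
  shows "(norm (pd y0 (axis 1 1) x \<times> pd y0 (axis 2 1) x))\<^sup>2 = det M"
proof -
  have M: "M $ i $ j = pd y0 (axis i 1) x \<bullet> pd y0 (axis j 1) x" for i j
    unfolding assms[symmetric] by (rule transpose_mult_nth) (rule grad_nth)+
  have "(norm u * norm v)\<^sup>2 = (u \<bullet> u) * (v \<bullet> v)" for u v :: "real^3"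
    by (simp add: power_mult_distrib power2_norm_eq_inner)
  then show ?thesis
    using norm_cross_dot[of "pd y0 (axis 1 1) x" "pd y0 (axis 2 1) x"]
    by (simp add: det_2 M power2_eq_square[of "_ \<bullet> _"] inner_commute[of "pd y0 (axis 2 1) x" "pd y0 (axis 1 1) x"])
qed

text \<open>Cramer's rule removes the inverse matrix, and the normalisation disappears since |d1 x
  d2| is the root of the 2x2 determinant. The result is visibly smooth, which the defining formula
  is not.\<close>

lemma b0_eq:
  fixes G :: "real^3 \<Rightarrow> real^3^3" and y0 :: "real^2 \<Rightarrow> real^3" and x :: "real^2"
  defines "Gb \<equiv> G (pt3 x 0)" and "d1 \<equiv> pd y0 (axis 1 1) x" and "d2 \<equiv> pd y0 (axis 2 1) x"
  assumes G: "sym_posdef Gb" and iso: "transpose (grad y0 x) ** grad y0 x = sub22 Gb"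
  shows "b0 G y0 x = (inverse (det (sub22 Gb)) * (Gb $ 2 $ 2 * Gb $ 1 $ 3 - Gb $ 1 $ 2 * Gb $ 2 $ 3)) *\<^sub>R d1
     + (inverse (det (sub22 Gb)) * (Gb $ 1 $ 1 * Gb $ 2 $ 3 - Gb $ 2 $ 1 * Gb $ 1 $ 3)) *\<^sub>R d2
     + (sqrt (det Gb) * inverse (det (sub22 Gb))) *\<^sub>R (d1 \<times> d2)"
proof -
  let ?M = "sub22 Gb"
  have pos: "det Gb > 0" "det ?M > 0" using G sym_posdef_sub22 sym_posdef_det_pos by blast+
  define w :: "real^2" where "w = vector [inverse (det ?M) * (Gb $ 2 $ 2 * Gb $ 1 $ 3 - Gb $ 1 $ 2 * Gb $ 2 $ 3),
      inverse (det ?M) * (Gb $ 1 $ 1 * Gb $ 2 $ 3 - Gb $ 2 $ 1 * Gb $ 1 $ 3)]"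
  let ?k = "(\<chi> i. Gb $ emb23 i $ 3) :: real^2"
  have sub22_nth: "?M $ 1 $ 1 = Gb $ 1 $ 1" "?M $ 1 $ 2 = Gb $ 1 $ 2" "?M $ 2 $ 1 = Gb $ 2 $ 1" "?M $ 2 $ 2 = Gb $ 2 $ 2"
    by (simp_all add: sub22_def emb23_def)
  have dM: "det ?M = Gb $ 1 $ 1 * Gb $ 2 $ 2 - Gb $ 1 $ 2 * Gb $ 2 $ 1" by (simp add: det_2 sub22_def emb23_def)
  have "?M *v w = ?k"
  proof -
    let ?i = "inverse (det ?M)"
    have "(?M *v w) $ 1 = ?i * (Gb $ 1 $ 1 * Gb $ 2 $ 2 - Gb $ 1 $ 2 * Gb $ 2 $ 1) * Gb $ 1 $ 3"
      "(?M *v w) $ 2 = ?i * (Gb $ 1 $ 1 * Gb $ 2 $ 2 - Gb $ 1 $ 2 * Gb $ 2 $ 1) * Gb $ 2 $ 3"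
      unfolding w_def matrix_vector_mult_def sum_2 by (simp_all add: sub22_nth algebra_simps)
    then show ?thesis unfolding dM[symmetric] using pos(2) by (simp add: vec_eq_iff forall_2 emb23_def)
  qed
  then have "matrix_inv ?M *v ?k = (matrix_inv ?M ** ?M) *v w" by (simp add: matrix_vector_mul_assoc[symmetric])
  then have w: "matrix_inv ?M *v ?k = w" using sym_posdef_inv(2)[OF sym_posdef_sub22[OF G]] by simp
  have gw: "grad y0 x *v w = w $ 1 *\<^sub>R d1 + w $ 2 *\<^sub>R d2"
    by (simp add: vec_eq_iff matrix_vector_mult_def sum_2 grad_nth d1_def d2_def mult.commute)
  have "(norm (d1 \<times> d2))\<^sup>2 = det ?M" unfolding d1_def d2_def by (rule frame_normal[OF iso])
  then have n: "norm (d1 \<times> d2) = sqrt (det ?M)" by (metis norm_ge_zero real_sqrt_unique)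
  have "sqrt (det Gb / det ?M) / sqrt (det ?M) = sqrt (det Gb) * inverse (det ?M)"
    using pos by (simp add: real_sqrt_divide field_simps)
  then show ?thesis
    unfolding b0_def Let_def Gb_def[symmetric] d1_def[symmetric] d2_def[symmetric] w gw n by (simp add: w_def)
qed

text \<open>Multiplying the definition by the transpose of \<open>Q0\<close> gives a linear system
  whose rows are the inner products with the columns of \<open>Q0\<close>; the hypothesis is that
  the determinant of \<open>Q0\<close> does not vanish.\<close>

lemma pvec_frame:
  assumes "b0 G y0 x \<bullet> (pd y0 (axis 1 1) x \<times> pd y0 (axis 2 1) x) \<noteq> 0"
  shows "pvec G y0 S V x \<bullet> pd y0 (axis i 1) x = - (wpd S V i x \<bullet> b0 G y0 x)" "pvec G y0 S V x \<bullet> b0 G y0 x = 0"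
proof -
  let ?Q = "Q0 G y0 x" and ?l = "lift3 (transpose (wgrad S V x) *v b0 G y0 x)" and ?p = "pvec G y0 S V x"
  have "det ?Q = b0 G y0 x \<bullet> (pd y0 (axis 1 1) x \<times> pd y0 (axis 2 1) x)"
    by (simp add: Q0_def col3_def cross3_simps)
  then have "invertible ?Q" using assms by (simp add: invertible_det_nz)
  then have "?Q ** matrix_inv ?Q = mat 1 \<and> matrix_inv ?Q ** ?Q = mat 1"
    unfolding invertible_def matrix_inv_def by (rule someI_ex)
  then have "transpose ?Q ** transpose (matrix_inv ?Q) = mat 1"
    by (simp add: matrix_transpose_mul[symmetric] transpose_mat)
  then have *: "transpose ?Q *v ?p = - ?l"
    unfolding pvec_def by (simp add: linear_neg[OF matrix_vector_mul_linear] matrix_vector_mul_assoc del: transpose_matrix_vector)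
  have l: "?l $ 1 = wpd S V 1 x \<bullet> b0 G y0 x" "?l $ 2 = wpd S V 2 x \<bullet> b0 G y0 x" "?l $ 3 = 0"
    by (simp_all add: lift3_def matrix_vector_mult_def transpose_def wgrad_def inner_vec_def del: transpose_matrix_vector)
  have q: "(transpose ?Q *v ?p) $ 1 = ?p \<bullet> pd y0 (axis 1 1) x" "(transpose ?Q *v ?p) $ 2 = ?p \<bullet> pd y0 (axis 2 1) x"
    "(transpose ?Q *v ?p) $ 3 = ?p \<bullet> b0 G y0 x"
    by (simp_all add: matrix_vector_mult_def transpose_def Q0_def col3_def inner_vec_def mult.commute del: transpose_matrix_vector)
  show "?p \<bullet> pd y0 (axis i 1) x = - (wpd S V i x \<bullet> b0 G y0 x)"
    using exhaust_2[of i] q(1,2)[unfolded *] l(1,2) by auto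
  show "?p \<bullet> b0 G y0 x = 0" using q(3)[unfolded *] l(3) by simp
qed

theorem theorem8p3:
  fixes \<omega> :: "(real^2) set" and W :: "real^3^3 \<Rightarrow> ennreal"
    and G :: "real^3 \<Rightarrow> real^3^3" and y0 :: "real^2 \<Rightarrow> real^3"
  assumes "bounded \<omega>" and "connected \<omega>" and "lipschitz_domain \<omega>"
    and "admissible_W W"
    and "Cinf_closure (plate \<omega> 1) G"
    and "\<forall>x\<in>closure (plate \<omega> 1). sym_posdef (G x)"
    and "((\<lambda>h. ennreal (1 / h\<^sup>2) * inf_energy W G \<omega> h) \<longlongrightarrow> 0) (at_right 0)"
    and "\<forall>x'\<in>\<omega>. \<forall>i k l m. Riemann G i k l m (pt3 x' 0) = 0"
    and "Cinf_closure \<omega> y0"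
    and "\<forall>x'\<in>\<omega>. transpose (grad y0 x') ** grad y0 x' = sub22 (G (pt3 x' 0))"
    and "\<forall>x'\<in>\<omega>. symm (transpose (grad y0 x') ** grad (b0 G y0) x')
                  = (1/2) *\<^sub>R sub22 (pd G (axis 3 1) (pt3 x' 0))"
  shows "\<exists>C>0. \<forall>V. W22 \<omega> V
            \<and> (AE x in lebesgue. x \<in> \<omega> \<longrightarrow> symm (transpose (grad y0 x) ** wgrad \<omega> V x) = 0)
          \<longrightarrow> ennreal ((Inf {W22_norm \<omega> (\<lambda>x. V x - (S *v y0 x + c)) | S c. S \<in> so3})\<^sup>2)
              \<le> ennreal C * (\<integral>\<^sup>+ x\<in>\<omega>. ennreal (Q2 W G x
                    (transpose (grad y0 x) ** wgrad \<omega> (pvec G y0 \<omega> V) x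
                     + transpose (wgrad \<omega> V x) ** grad (b0 G y0) x)) \<partial>lebesgue)"
proof -
  note bd = assms(1) and conn = assms(2) and lip = assms(3) and W = assms(4) and G = assms(5) and pos = assms(6) and iso = assms(10)
  have oS: "open \<omega>" using lip by (simp add: lipschitz_domain_def)
  let ?G = "\<lambda>x. G (pt3 x 0)"
  have posc: "sym_posdef (?G x)" if "x \<in> closure \<omega>" for x
    using pos lift3_closure_plate[OF that] by (simp add: pt3_eq_lift3)
  have posS: "sym_posdef (?G x)" if "x \<in> \<omega>" for x using posc closure_subset that by blast
  have sG: "smooth_upto \<omega> ?G" and cG: "continuous_on (closure \<omega>) ?G" using midplane_metric_smooth[OF G] by auto
  have sGij: "smooth_upto \<omega> (\<lambda>x. ?G x $ i $ j)" for i j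
    using smooth_upto_linear[OF bounded_linear_compose[OF bounded_linear_vec_nth[of j] bounded_linear_vec_nth[of i]] sG] .
  have cGij: "continuous_on (closure \<omega>) (\<lambda>x. ?G x $ i $ j)" for i j by (intro continuous_intros cG)
  have c1: "continuous_on (closure \<omega>) (\<lambda>x. det (?G x))"
    unfolding det_3 by (intro continuous_on_add continuous_on_diff continuous_on_mult cGij)
  have c2: "continuous_on (closure \<omega>) (\<lambda>x. det (sub22 (?G x)))"
    unfolding det_2 sub22_def emb23_def by (simp, intro continuous_on_diff continuous_on_mult cGij)
  obtain \<delta>1 where \<delta>1: "\<delta>1 > 0" "\<And>x. x \<in> \<omega> \<Longrightarrow> det (?G x) \<ge> \<delta>1"
    using positive_lower_bound_on_closure[OF bd c1] sym_posdef_det_pos[OF posc] by blast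
  obtain \<delta>2 where \<delta>2: "\<delta>2 > 0" "\<And>x. x \<in> \<omega> \<Longrightarrow> det (sub22 (?G x)) \<ge> \<delta>2"
    using positive_lower_bound_on_closure[OF bd c2] sym_posdef_det_pos[OF sym_posdef_sub22[OF posc]] by blast
  have s1: "smooth_upto \<omega> (\<lambda>x. sqrt (det (?G x)))"
    by (rule smooth_upto_sqrt[OF _ \<delta>1]) (unfold det_3, intro smooth_upto_add smooth_upto_diff smooth_upto_mult sGij)
  have s2: "smooth_upto \<omega> (\<lambda>x. inverse (det (sub22 (?G x))))"
    by (rule smooth_upto_inverse[OF _ \<delta>2]) (simp add: det_2 sub22_def emb23_def, intro smooth_upto_diff smooth_upto_mult sGij)
  have y: "smooth_upto \<omega> y0"
  proof -
    obtain U g where "open U" "closure \<omega> \<subseteq> U" "Cinf_on U g" "\<forall>x\<in>closure \<omega>. g x = y0 x"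
      using assms(9) unfolding Cinf_closure_def by blast
    then show ?thesis using closure_subset by (intro smooth_uptoI[of U _ g]) auto
  qed
  have d: "smooth_upto \<omega> (\<lambda>x. pd y0 v x)" for v by (rule smooth_upto_pd[OF oS y])
  let ?n = "\<lambda>x. pd y0 (axis 1 1) x \<times> pd y0 (axis 2 1) x"
  have b: "smooth_upto \<omega> (b0 G y0)"
  proof (rule smooth_upto_cong)
    show "smooth_upto \<omega> (\<lambda>x. (inverse (det (sub22 (?G x))) * (?G x $ 2 $ 2 * ?G x $ 1 $ 3 - ?G x $ 1 $ 2 * ?G x $ 2 $ 3)) *\<^sub>R pd y0 (axis 1 1) x
     + (inverse (det (sub22 (?G x))) * (?G x $ 1 $ 1 * ?G x $ 2 $ 3 - ?G x $ 2 $ 1 * ?G x $ 1 $ 3)) *\<^sub>R pd y0 (axis 2 1) x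
     + (sqrt (det (?G x)) * inverse (det (sub22 (?G x)))) *\<^sub>R ?n x)"
      by (intro smooth_upto_add smooth_upto_scaleR smooth_upto_mult smooth_upto_diff smooth_upto_cross s1 s2 sGij d)
    fix x assume "x \<in> \<omega>"
    from b0_eq[of G x y0, OF posS[OF this] iso[rule_format, OF this]]
    show "(inverse (det (sub22 (?G x))) * (?G x $ 2 $ 2 * ?G x $ 1 $ 3 - ?G x $ 1 $ 2 * ?G x $ 2 $ 3)) *\<^sub>R pd y0 (axis 1 1) x
     + (inverse (det (sub22 (?G x))) * (?G x $ 1 $ 1 * ?G x $ 2 $ 3 - ?G x $ 2 $ 1 * ?G x $ 1 $ 3)) *\<^sub>R pd y0 (axis 2 1) x
     + (sqrt (det (?G x)) * inverse (det (sub22 (?G x)))) *\<^sub>R ?n x = b0 G y0 x" by (rule sym)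
  qed
  \<comment> \<open>The tangential parts of b0 drop out. The normal coefficient times |d1 x d2|^2,
    which is the 2x2 determinant, leaves the square root of \<open>det G\<close>.\<close>
  have bn: "b0 G y0 x \<bullet> ?n x \<ge> sqrt \<delta>1" if x: "x \<in> \<omega>" for x
  proof -
    have M: "det (sub22 (?G x)) > 0" by (rule sym_posdef_det_pos[OF sym_posdef_sub22[OF posS[OF x]]])
    have "b0 G y0 x \<bullet> ?n x = sqrt (det (?G x)) * inverse (det (sub22 (?G x))) * (norm (?n x))\<^sup>2"
      using b0_eq[of G x y0, OF posS[OF x] iso[rule_format, OF x]]
      by (simp add: inner_add_left dot_cross_self power2_norm_eq_inner)
    then have "b0 G y0 x \<bullet> ?n x = sqrt (det (?G x))"
      unfolding frame_normal[OF iso[rule_format, OF x]] using M by simp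
    then show ?thesis using \<delta>1(2)[OF x] by simp
  qed
  have "sqrt \<delta>1 > 0" using \<delta>1(1) by simp
  from infinitesimal_rigidity[OF bd conn lip y b this bn] obtain C :: real where C: "C > 0"
    "\<And>V p F. W22 \<omega> V \<Longrightarrow>
     (AE x in lebesgue. x \<in> \<omega> \<longrightarrow> (\<forall>i j. pd y0 (axis i 1) x \<bullet> wpd \<omega> V j x + pd y0 (axis j 1) x \<bullet> wpd \<omega> V i x = 0)) \<Longrightarrow>
     (\<And>x. x \<in> \<omega> \<Longrightarrow> (\<forall>i. p x \<bullet> pd y0 (axis i 1) x = - (wpd \<omega> V i x \<bullet> b0 G y0 x)) \<and> p x \<bullet> b0 G y0 x = 0) \<Longrightarrow>
     (\<And>x i j. x \<in> \<omega> \<Longrightarrow> F x $ i $ j = pd y0 (axis i 1) x \<bullet> wpd \<omega> p j x + wpd \<omega> V i x \<bullet> pd (b0 G y0) (axis j 1) x) \<Longrightarrow>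
     (AE x in lebesgue. x \<in> \<omega> \<longrightarrow> transpose (F x) = F x) \<and>
     (\<exists>M\<in>so3. \<exists>c. ennreal ((W22_norm \<omega> (\<lambda>x. V x - (M *v y0 x + c)))\<^sup>2)
        \<le> ennreal C * (\<integral>\<^sup>+x\<in>\<omega>. ennreal ((norm (F x :: real^2^2))\<^sup>2) \<partial>lebesgue))" by blast
  obtain B where B: "B > 0" "\<And>x. x \<in> \<omega> \<Longrightarrow> norm (?G x) \<le> B" using smooth_upto_bounded[OF bd sG] by blast
  \<comment> \<open>Each of the three diagonal entries is at most the norm of the metric.\<close>
  define \<tau> where "\<tau> = 3 * B"
  have \<tau>: "\<tau> > 0" "trace (?G x) \<le> \<tau>" if "x \<in> \<omega>" for x
  proof -
    have "?G x $ i $ i \<le> B" for i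
    proof -
      have "norm (?G x $ i) \<le> norm (?G x)" by (rule Finite_Cartesian_Product.norm_nth_le)
      then show ?thesis using component_le_norm_cart[of "?G x $ i" i] B(2)[OF that] by linarith
    qed
    from this[of 1] this[of 2] this[of 3] show "trace (?G x) \<le> \<tau>" by (simp add: trace_def sum_3 \<tau>_def)
  qed (simp add: \<tau>_def B)
  obtain c where c: "c > 0" "\<And>G x F \<tau>. sym_posdef (G (pt3 x 0)) \<Longrightarrow> trace (G (pt3 x 0)) \<le> \<tau> \<Longrightarrow> transpose F = F
    \<Longrightarrow> c * (norm F)\<^sup>2 \<le> \<tau>\<^sup>2 * Q2 W G x F"
    using Q2_coercive[OF W] by blast
  \<comment> \<open>The factor by which coercivity yields |F|^2 <= k Q2(F).\<close>
  define k where "k = \<tau>\<^sup>2 / c"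
  have k: "k > 0" using B(1) c(1) by (simp add: k_def \<tau>_def)
  show ?thesis
  proof (intro exI[of _ "C * k"] conjI allI impI)
    show "C * k > 0" using C(1) k by simp
    fix V assume "W22 \<omega> V \<and> (AE x in lebesgue. x \<in> \<omega> \<longrightarrow> symm (transpose (grad y0 x) ** wgrad \<omega> V x) = 0)"
    then have V: "W22 \<omega> V"
      and sym: "AE x in lebesgue. x \<in> \<omega> \<longrightarrow> symm (transpose (grad y0 x) ** wgrad \<omega> V x) = 0" by auto
    let ?p = "pvec G y0 \<omega> V"
    let ?F = "\<lambda>x. transpose (grad y0 x) ** wgrad \<omega> ?p x + transpose (wgrad \<omega> V x) ** grad (b0 G y0) x"
    have wg: "wgrad \<omega> f x $ a $ i = wpd \<omega> f i x $ a" for f :: "real^2 \<Rightarrow> real^3" and x a i by (simp add: wgrad_def)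
    have sym': "AE x in lebesgue. x \<in> \<omega> \<longrightarrow> (\<forall>i j. pd y0 (axis i 1) x \<bullet> wpd \<omega> V j x + pd y0 (axis j 1) x \<bullet> wpd \<omega> V i x = 0)"
      using sym
    proof eventually_elim
      case (elim x)
      show ?case
      proof (intro impI allI)
        fix i j assume "x \<in> \<omega>"
        then have "symm (transpose (grad y0 x) ** wgrad \<omega> V x) $ i $ j = 0" using elim by simp
        moreover have t: "(transpose (grad y0 x) ** wgrad \<omega> V x) $ i $ j = pd y0 (axis i 1) x \<bullet> wpd \<omega> V j x" for i j
          by (rule transpose_mult_nth[OF grad_nth wg])
        ultimately show "pd y0 (axis i 1) x \<bullet> wpd \<omega> V j x + pd y0 (axis j 1) x \<bullet> wpd \<omega> V i x = 0"
          unfolding symm_def by (simp add: transpose_def[of "_ ** _"])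
      qed
    qed
    have F: "?F x $ i $ j = pd y0 (axis i 1) x \<bullet> wpd \<omega> ?p j x + wpd \<omega> V i x \<bullet> pd (b0 G y0) (axis j 1) x" for x i j
      using transpose_mult_nth[OF grad_nth[of y0 x] wg[of ?p x], of i j] transpose_mult_nth[OF wg[of V x] grad_nth[of "b0 G y0" x], of i j]
      by simp
    have p: "(\<forall>i. ?p x \<bullet> pd y0 (axis i 1) x = - (wpd \<omega> V i x \<bullet> b0 G y0 x)) \<and> ?p x \<bullet> b0 G y0 x = 0" if "x \<in> \<omega>" for x
    proof -
      have "b0 G y0 x \<bullet> ?n x \<noteq> 0" using bn[OF that] \<open>sqrt \<delta>1 > 0\<close> by linarith
      then show ?thesis using pvec_frame by blast
    qed
    have main: "(AE x in lebesgue. x \<in> \<omega> \<longrightarrow> transpose (?F x) = ?F x) \<and>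
     (\<exists>M\<in>so3. \<exists>c. ennreal ((W22_norm \<omega> (\<lambda>x. V x - (M *v y0 x + c)))\<^sup>2)
        \<le> ennreal C * (\<integral>\<^sup>+x\<in>\<omega>. ennreal ((norm (?F x))\<^sup>2) \<partial>lebesgue))"
      by (rule C(2)[OF V sym' p F])
    then obtain M a where M: "M \<in> so3" "ennreal ((W22_norm \<omega> (\<lambda>x. V x - (M *v y0 x + a)))\<^sup>2)
        \<le> ennreal C * (\<integral>\<^sup>+x\<in>\<omega>. ennreal ((norm (?F x))\<^sup>2) \<partial>lebesgue)" by blast
    let ?A = "{W22_norm \<omega> (\<lambda>x. V x - (S *v y0 x + c)) | S c. S \<in> so3}"
    have nn: "W22_norm \<omega> f \<ge> 0" for f :: "real^2 \<Rightarrow> real^3"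
      unfolding W22_norm_def set_lebesgue_integral_def
      by (intro real_sqrt_ge_zero add_nonneg_nonneg sum_nonneg Bochner_Integration.integral_nonneg) auto
    have inA: "W22_norm \<omega> (\<lambda>x. V x - (M *v y0 x + a)) \<in> ?A" using M(1) by blast
    have "Inf ?A \<le> W22_norm \<omega> (\<lambda>x. V x - (M *v y0 x + a))"
      by (rule cInf_lower[OF inA]) (use nn in \<open>auto intro!: bdd_belowI[of _ 0]\<close>)
    \<comment> \<open>Nonnegativity is required for squaring the comparison of the infimum with one
      of its members.\<close>
    moreover have "Inf ?A \<ge> 0" using inA nn by (intro cInf_greatest) auto
    ultimately have I: "ennreal ((Inf ?A)\<^sup>2) \<le> ennreal ((W22_norm \<omega> (\<lambda>x. V x - (M *v y0 x + a)))\<^sup>2)"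
      by (intro ennreal_leI power_mono)
    have Q: "(\<integral>\<^sup>+x\<in>\<omega>. ennreal ((norm (?F x))\<^sup>2) \<partial>lebesgue) \<le> ennreal k * (\<integral>\<^sup>+x\<in>\<omega>. ennreal (Q2 W G x (?F x)) \<partial>lebesgue)"
    proof -
      have "(\<integral>\<^sup>+x\<in>\<omega>. ennreal ((norm (?F x))\<^sup>2) \<partial>lebesgue) \<le> (\<integral>\<^sup>+x. ennreal k * (ennreal (Q2 W G x (?F x)) * indicator \<omega> x) \<partial>lebesgue)"
      proof (rule nn_integral_mono_AE)
        show "AE x in lebesgue. ennreal ((norm (?F x))\<^sup>2) * indicator \<omega> x \<le> ennreal k * (ennreal (Q2 W G x (?F x)) * indicator \<omega> x)"
          using main[THEN conjunct1]
        proof eventually_elim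
          case (elim x)
          show ?case
          proof (cases "x \<in> \<omega>")
            case True
            have "c * (norm (?F x))\<^sup>2 \<le> \<tau>\<^sup>2 * Q2 W G x (?F x)"
              using elim True by (intro c(2) posS \<tau>(2)) auto
            then have "(norm (?F x))\<^sup>2 \<le> k * Q2 W G x (?F x)"
              using c(1) by (simp add: k_def pos_le_divide_eq mult.commute)
            then have "ennreal ((norm (?F x))\<^sup>2) \<le> ennreal (k * Q2 W G x (?F x))" by (rule ennreal_leI)
            then show ?thesis using True k by (simp add: ennreal_mult')
          qed simp
        qed
      qed
      \<comment> \<open>The one-sided rule is used again, as the dependence of \<open>Q2\<close> at
        the strain on the point is not known to be measurable.\<close>
      also have "\<dots> \<le> ennreal k * (\<integral>\<^sup>+x\<in>\<omega>. ennreal (Q2 W G x (?F x)) \<partial>lebesgue)" by (rule nn_integral_cmult_le[OF k])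
      finally show ?thesis .
    qed
    note I
    also note M(2)
    also have "ennreal C * (\<integral>\<^sup>+x\<in>\<omega>. ennreal ((norm (?F x))\<^sup>2) \<partial>lebesgue)
        \<le> ennreal C * (ennreal k * (\<integral>\<^sup>+x\<in>\<omega>. ennreal (Q2 W G x (?F x)) \<partial>lebesgue))" using Q by (rule mult_left_mono) simp
    also have "\<dots> = ennreal (C * k) * (\<integral>\<^sup>+x\<in>\<omega>. ennreal (Q2 W G x (?F x)) \<partial>lebesgue)"
      using C(1) k by (simp add: ennreal_mult mult.assoc)
    finally show "ennreal ((Inf ?A)\<^sup>2) \<le> ennreal (C * k) * (\<integral>\<^sup>+x\<in>\<omega>. ennreal (Q2 W G x (?F x)) \<partial>lebesgue)" .
  qed
qed

end
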